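(* Let $\mathbb{T}$ be a time scale with $\sup\mathbb{T}=\infty$, $t_0\in\mathbb{T}$, let $A:[t_0,\infty)_{\mathbb{T}}\to[0,\infty)$ and $\alpha:[t_0,\infty)_{\mathbb{T}}\to\mathbb{T}$ be rd-continuous with $\lim_{t\to\infty}\alpha(t)=\infty$, where $\alpha$ has one of the following two properties: (A1) $\alpha(t)\le t$ for all $t\in[t_0,\infty)_{\mathbb{T}}$; (A2) $\alpha(\sigma(t))\le t$ for all $t\in[t_0,\infty)_{\mathbb{T}}$. Consider the delay dynamic equation $$x^{\Delta}(t)+A(t)x(\alpha(t))=0,\qquad t\in[t_0,\infty)_{\mathbb{T}}. \quad (E)$$ Assume $$\sup_{s\in[t_0,\infty)_{\mathbb{T}}}\int_s^{\alpha_{-1}(s)}A(\eta)\,\Delta\eta<\infty .$$ Then the following statements are equivalent: (i) the trivial solution of (E) is uniformly stable; (ii) there exists $M_0>0$ such that $|\mathcal{X}(t,s)|\le M_0$ for all $t,s\in\mathbb{T}$ with $t\ge s\ge t_0$, where $\mathcal{X}$ is the fundamental solution of (E).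
   Context: Time scales: a time scale $\mathbb{T}$ is a nonempty closed subset of $\mathbb{R}$; an interval with subscript $\mathbb{T}$ means its intersection with $\mathbb{T}$. $\sigma(t)=\inf(t,\infty)_{\mathbb{T}}$, $\mu(t)=\sigma(t)-t$; $t$ is right-dense if $\mu(t)=0$, right-scattered otherwise; left-dense and left-scattered points are defined similarly with $\rho(t)=\sup(-\infty,t)_{\mathbb{T}}$. $f^{\Delta}(t)$ is the $\Delta$-derivative: the number such that for every $\varepsilon>0$ there is a neighbourhood $U$ of $t$ in $\mathbb T$ with $|f(\sigma(t))-f(r)-f^{\Delta}(t)(\sigma(t)-r)|\le\varepsilon|\sigma(t)-r|$ for all $r\in U$. A function is rd-continuous if it is continuous at right-dense points and has finite limits at left-dense points. The $\Delta$-integral of an rd-continuous $f$ is $\int_s^t f(\eta)\Delta\eta=F(t)-F(s)$ with $F^{\Delta}=f$. Delay functions: $\alpha_*(t):=\inf\{\alpha(\eta):\eta\in[t,\infty)_{\mathbb{T}}\}$ and $\alpha_{-1}(t):=\sup\{\eta\in[t_0,\infty)_{\mathbb{T}}:\alpha_*(\eta)\le t\}$ for $t\in[t_0,\infty)_{\mathbb T}$. Initial value problem: for $s\in[t_0,\infty)_{\mathbb{T}}$, a solution of (E) with data $(s,x_0,\varphi)$ is a function $x:[\alpha_*(s),\infty)_{\mathbb{T}}\to\mathbb{R}$ that is rd-continuous on $[\alpha_*(s),s]_{\mathbb{T}}$, is $\Delta$-differentiable on $[s,\infty)_{\mathbb{T}}$ with an rd-continuous derivative, satisfies $x^{\Delta}(t)+A(t)x(\alpha(t))=0$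 identically on $[s,\infty)_{\mathbb{T}}$, and has $x(s)=x_0$ and $x(t)=\varphi(t)$ for $t\in[\alpha_*(s),s)_{\mathbb{T}}$. The fundamental solution $\mathcal{X}(\cdot,s):[\alpha_*(s),\infty)_{\mathbb T}\to\mathbb R$ is the solution with $x_0=1$, $\varphi\equiv0$. Uniform stability of the trivial solution: for every $\varepsilon>0$ there is $\delta>0$ such that for every $s\in[t_0,\infty)_{\mathbb{T}}$, every solution $x$ with data $(s,x_0,\varphi)$ satisfying $|x_0|+\sup_{\eta\in[\alpha_*(s),s)_{\mathbb{T}}}|\varphi(\eta)|<\delta$ satisfies $|x(t)|<\varepsilon$ for all $t\in[s,\infty)_{\mathbb{T}}$.
   Formalization: Solutions are taken locally Lipschitz on [s,∞)_T and satisfy (E) Δ-almost everywhere (derivative at s within [s,∞)_T), since the fundamental solution need not be differentiable everywhere; also α(t) ≤ σ(t) is assumed, since (A2) leaves α free at t_0 and at left-dense right-scattered points. *)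

theory Defs
  imports "HOL-Analysis.Analysis"
begin

(* A time scale is a set S of reals; an interval of T with subscript T is the intersection of T with
   a real interval and is again a time scale.  All notions are relative to the time scale S, so that
   a function on an interval is only tested at points of that interval. *)

definition time_scale :: "real set \<Rightarrow> bool" where
  "time_scale S \<longleftrightarrow> S \<noteq> {} \<and> closed S"

(* The convention Inf {} = sup S (resp. Sup {} = inf S) only matters at a greatest (least) point. *)

definition fwd_jump :: "real set \<Rightarrow> real \<Rightarrow> real" where
  "fwd_jump S t = (if S \<inter> {t<..} = {} then t else Inf (S \<inter> {t<..}))"

definition bwd_jump :: "real set \<Rightarrow> real \<Rightarrow> real" where
  "bwd_jump S t = (if S \<inter> {..<t} = {} then t else Sup (S \<inter> {..<t}))"

definition graininess :: "real set \<Rightarrow> real \<Rightarrow> real" where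
  "graininess S t = fwd_jump S t - t"

(* As usual, a greatest point of S is not right-dense and a least point is not left-dense.  So a
   function on [a, s] is only required to have a left limit at a left-dense end point s. *)

definition right_dense :: "real set \<Rightarrow> real \<Rightarrow> bool" where
  "right_dense S t \<longleftrightarrow> t \<in> S \<and> S \<inter> {t<..} \<noteq> {} \<and> graininess S t = 0"

definition left_dense :: "real set \<Rightarrow> real \<Rightarrow> bool" where
  "left_dense S t \<longleftrightarrow> t \<in> S \<and> S \<inter> {..<t} \<noteq> {} \<and> bwd_jump S t = t"

definition has_delta_derivative :: "real set \<Rightarrow> (real \<Rightarrow> real) \<Rightarrow> real \<Rightarrow> real \<Rightarrow> bool" where
  "has_delta_derivative S f d t \<longleftrightarrow>
     (\<forall>\<epsilon>>0. \<exists>U. open U \<and> t \<in> U \<and>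
        (\<forall>r\<in>U \<inter> S. \<bar>f (fwd_jump S t) - f r - d * (fwd_jump S t - r)\<bar>
                      \<le> \<epsilon> * \<bar>fwd_jump S t - r\<bar>))"

definition rd_continuous_on :: "real set \<Rightarrow> (real \<Rightarrow> real) \<Rightarrow> bool" where
  "rd_continuous_on S f \<longleftrightarrow>
     (\<forall>t. right_dense S t \<longrightarrow> continuous (at t within S) f) \<and>
     (\<forall>t. left_dense S t \<longrightarrow> (\<exists>l. (f \<longlongrightarrow> l) (at t within (S \<inter> {..<t}))))"

definition delta_integral :: "real set \<Rightarrow> (real \<Rightarrow> real) \<Rightarrow> real \<Rightarrow> real \<Rightarrow> real" where
  "delta_integral S f a b =
     (THE I. \<exists>F. (\<forall>t\<in>S. has_delta_derivative S F (f t) t) \<and> I = F b - F a)"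

(* Sets of Lebesgue delta-measure zero: the measure of {t} is the graininess of t, so such a set
   contains no right-scattered point. *)

definition delta_null :: "real set \<Rightarrow> real set \<Rightarrow> bool" where
  "delta_null S N \<longleftrightarrow> N \<subseteq> S \<and> negligible N \<and> (\<forall>t\<in>N. right_dense S t)"

definition alpha_star :: "real set \<Rightarrow> (real \<Rightarrow> real) \<Rightarrow> real \<Rightarrow> real" where
  "alpha_star T \<alpha> t = Inf (\<alpha> ` (T \<inter> {t..}))"

definition alpha_inv :: "real set \<Rightarrow> real \<Rightarrow> (real \<Rightarrow> real) \<Rightarrow> real \<Rightarrow> real" where
  "alpha_inv T t0 \<alpha> t = Sup {\<eta> \<in> T \<inter> {t0..}. alpha_star T \<alpha> \<eta> \<le> t}"

(* Solutions of x^Delta(t) + A(t) x(alpha(t)) = 0 with data (s, x0, phi).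

   The delta-derivative is taken in the time scale [s, oo) (one-sided at s), because x may jump at s.
   For the same reason the equation can only be required delta-almost everywhere: x o alpha need not
   be rd-continuous.  For instance, if T is the real line and alpha(t) = t - 1, then the solution with
   x0 = 1 and phi = 0 has left derivative 0 and right derivative -A(s+1) at s + 1, so that with an
   everywhere differentiable solution there would be no fundamental solution.  Since x o alpha and A
   are locally bounded, local absolute continuity amounts to being locally Lipschitz.  A function that
   satisfies the equation everywhere with rd-continuous derivative is a solution in this sense; if
   A (x o alpha) is rd-continuous, then a solution in this sense satisfies the equation everywhere. *)

definition solution ::
  "real set \<Rightarrow> (real \<Rightarrow> real) \<Rightarrow> (real \<Rightarrow> real) \<Rightarrow> real \<Rightarrow> real \<Rightarrow> (real \<Rightarrow> real) \<Rightarrow> (real \<Rightarrow> real) \<Rightarrow> bool"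
where
  "solution T A \<alpha> s x0 \<phi> x \<longleftrightarrow>
     rd_continuous_on (T \<inter> {alpha_star T \<alpha> s..s}) x \<and>
     (\<forall>b. \<exists>L. L-lipschitz_on (T \<inter> {s..b}) x) \<and>
     (\<exists>N. delta_null (T \<inter> {s..}) N \<and>
        (\<forall>t\<in>T \<inter> {s..} - N.
           \<exists>d. has_delta_derivative (T \<inter> {s..}) x d t \<and> d + A t * x (\<alpha> t) = 0)) \<and>
     x s = x0 \<and>
     (\<forall>t\<in>T \<inter> {alpha_star T \<alpha> s..<s}. x t = \<phi> t)"

(* X(t, s); as a function on [alpha_star(s), oo) it is made unique by extensionality. *)

definition fundamental_solution ::
  "real set \<Rightarrow> (real \<Rightarrow> real) \<Rightarrow> (real \<Rightarrow> real) \<Rightarrow> real \<Rightarrow> real \<Rightarrow> real" where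
  "fundamental_solution T A \<alpha> t s =
     (THE x. x \<in> extensional (T \<inter> {alpha_star T \<alpha> s..}) \<and> solution T A \<alpha> s 1 (\<lambda>_. 0) x) t"

(* The supremum over an empty initial interval is 0, as it is in ennreal. *)

definition uniformly_stable ::
  "real set \<Rightarrow> real \<Rightarrow> (real \<Rightarrow> real) \<Rightarrow> (real \<Rightarrow> real) \<Rightarrow> bool" where
  "uniformly_stable T t0 A \<alpha> \<longleftrightarrow>
     (\<forall>\<epsilon>>0. \<exists>\<delta>>0. \<forall>s\<in>T \<inter> {t0..}. \<forall>x0 \<phi> x.
        solution T A \<alpha> s x0 \<phi> x \<longrightarrow>
        ennreal \<bar>x0\<bar> + (SUP \<eta>\<in>T \<inter> {alpha_star T \<alpha> s..<s}. ennreal \<bar>\<phi> \<eta>\<bar>) < ennreal \<delta> \<longrightarrow>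
        (\<forall>t\<in>T \<inter> {s..}. \<bar>x t\<bar> < \<epsilon>))"

end

theory Submission
  imports Defs
begin

text \<open>
  Filling the gaps of the time scale linearly, a solution becomes a locally Lipschitz function on the
  real line that satisfies \<open>y'(v) = - a v * y (\<beta> v)\<close> almost everywhere, with measurable \<open>a\<close>, \<open>\<beta>\<close> and
  \<open>\<beta> v \<le> v\<close>; equivalently, it satisfies the integrated equation. Picard iteration and a Gronwall
  estimate give the existence and uniqueness of the fundamental solution. Uniform stability bounds it
  by scaling. Conversely, the initial function of a solution started at \<open>s\<close> acts as a forcing term that
  vanishes after \<open>\<alpha>\<^sub>-\<^sub>1(s)\<close> and whose integral is bounded by the hypothesis; the solution is a limit of
  superpositions of fundamental solutions, with total weight at most \<open>\<bar>x0\<bar>\<close> plus this integral.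
\<close>

section \<open>Lebesgue density and almost everywhere derivatives\<close>

text \<open>A solution may jump at \<open>s\<close>, and the delay transports this jump, so the
  slope of a solution is in general only a bounded measurable function. Hence the Lebesgue theory at
  the start: the passage from the dynamic equation to the integrated one is a fundamental theorem
  for Lipschitz functions whose derivative is known off a null set, and the passage back is the
  differentiation of indefinite integrals of bounded Borel functions. The integrated equation asks
  only boundedness and measurability of its data and passes to limits by dominated convergence. One
  obstacle comes from the gaps of \<open>T\<close>. The delta-integral up to
  \<open>m = alpha_inv T t0 \<alpha> s\<close> stops at \<open>m\<close>, but the equation at
  \<open>m\<close> acts on the whole gap up to \<open>\<sigma> m\<close>, and the initial function
  may still be read there. The hypothesis does not see this rectangle, of area
  \<open>A m * (\<sigma> m - m)\<close>; it is bounded through the fundamental solution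
  instead.\<close>

lemma integrable_on_bounded_borel:
  fixes f :: "real \<Rightarrow> real"
  assumes "f \<in> borel_measurable borel" and "\<And>x. x \<in> {a..b} \<Longrightarrow> \<bar>f x\<bar> \<le> C"
  shows "f integrable_on {a..b}"
proof (rule measurable_bounded_by_integrable_imp_integrable)
  show "f \<in> borel_measurable (lebesgue_on {a..b})"
    using assms(1) by (simp add: measurable_completion measurable_restrict_space1)
  show "(\<lambda>x. C) integrable_on {a..b}" by (rule integrable_const_ivl)
qed (use assms in auto)

lemma abs_integral_le_const:
  fixes f :: "real \<Rightarrow> real"
  assumes "f integrable_on {a..b}" "a \<le> b" "\<And>x. x \<in> {a..b} \<Longrightarrow> \<bar>f x\<bar> \<le> C"
  shows "\<bar>integral {a..b} f\<bar> \<le> C * (b - a)"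
  using integral_norm_bound_integral[of f "{a..b}" "\<lambda>_. C"] assms by (simp add: integrable_const_ivl mult.commute)

text \<open>Inner approximation of \<open>G\<close> by a closed set \<open>K\<close>: near a point outside \<open>G\<close> only
  \<open>G - K\<close> contributes, and a Vitali covering bounds the bad points by the measure of \<open>G - K\<close>.\<close>

lemma density_exceptional_set_negligible:
  fixes G :: "real set"
  assumes G: "G \<in> sets lebesgue" and "e > 0"
  defines "E \<equiv> {x \<in> -G. \<forall>\<delta>>0. \<exists>d. 0 < d \<and> d < \<delta> \<and> measure lebesgue (G \<inter> ball x d) > e * d}"
  shows "negligible E"
  unfolding negligible_outer_le
proof (intro allI impI)
  fix \<eta> :: real assume "\<eta> > 0"
  \<comment> \<open>A selected ball of radius d has length 2d and contains more than
    \<open>e * d\<close> of \<open>G - K\<close>, so the disjoint balls have total length at most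
    \<open>2 / e\<close> times the measure of \<open>G - K\<close>; the factor \<open>e / 2\<close>
    turns this into \<open>\<eta>\<close>.\<close>
  then obtain K where K: "closed K" "K \<subseteq> G" "G - K \<in> lmeasurable"
      and small: "emeasure lebesgue (G - K) < ennreal (\<eta> * e / 2)"
    using sets_lebesgue_inner_closed[OF G, of "\<eta> * e / 2"] \<open>e > 0\<close> by auto
  have small': "measure lebesgue (G - K) \<le> \<eta> * e / 2"
    using small K(3) \<open>\<eta> > 0\<close> \<open>e > 0\<close>
    by (simp add: emeasure_eq_measure2 ennreal_less_iff)
  define I where "I = {p. snd p > 0 \<and> measure lebesgue ((G - K) \<inter> ball (fst p) (snd p)) > e * snd p}"
  have "\<exists>p. p \<in> I \<and> x \<in> ball (fst p) (snd p) \<and> snd p < d" if "x \<in> E" "0 < d" for x d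
  proof -
    note xd = that
    from xd K(2) have "x \<in> -K" by (auto simp: E_def)
    then obtain r where "r > 0" and r: "ball x r \<subseteq> -K"
      using K(1) open_contains_ball by (metis open_Compl)
    obtain d' where d': "0 < d'" "d' < min r d" "measure lebesgue (G \<inter> ball x d') > e * d'"
      using xd \<open>r > 0\<close> unfolding E_def mem_Collect_eq by (metis min_less_iff_conj)
    have "ball x d' \<subseteq> ball x r" using d' by (simp add: subset_ball)
    then have "G \<inter> ball x d' = (G - K) \<inter> ball x d'" using r by blast
    then show ?thesis using d' by (intro exI[of _ "(x, d')"]) (auto simp: I_def)
  qed
  note cover = this
  obtain C where C: "countable C" "C \<subseteq> I"
      "pairwise (\<lambda>i j. disjnt (ball (fst i) (snd i)) (ball (fst j) (snd j))) C"
      "negligible (E - (\<Union>i\<in>C. ball (fst i) (snd i)))"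
    by (rule Vitali_covering_theorem_balls[OF cover])
  let ?B = "\<lambda>i::real \<times> real. ball (fst i) (snd i)"
  have fin: "measure lebesgue (\<Union>i\<in>F. ?B i) \<le> \<eta>" if F: "F \<subseteq> C" "finite F" for F
  proof -
    have "measure lebesgue (\<Union>i\<in>F. ?B i) \<le> (\<Sum>i\<in>F. measure lebesgue (?B i))"
      by (rule measure_UNION_le[OF F(2)]) auto
    also have "\<dots> \<le> (\<Sum>i\<in>F. (2 / e) * measure lebesgue ((G - K) \<inter> ?B i))"
    proof (rule sum_mono)
      fix i assume "i \<in> F"
      then have "i \<in> I" using F C by auto
      then show "measure lebesgue (?B i) \<le> (2 / e) * measure lebesgue ((G - K) \<inter> ?B i)"
        using \<open>e > 0\<close> by (auto simp: I_def ball_eq_greaterThanLessThan field_simps)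
    qed
    also have "\<dots> = (2 / e) * measure lebesgue (\<Union>i\<in>F. (G - K) \<inter> ?B i)"
    proof -
      have "(G - K) \<inter> ?B i \<in> lmeasurable" for i
        using K(3) by (intro fmeasurable.Int) auto
      moreover have "pairwise (\<lambda>i j. disjnt ((G - K) \<inter> ?B i) ((G - K) \<inter> ?B j)) F"
        by (rule pairwise_mono[OF C(3) _ F(1)]) (auto simp: disjnt_iff)
      ultimately have "measure lebesgue (\<Union>i\<in>F. (G - K) \<inter> ?B i) = (\<Sum>i\<in>F. measure lebesgue ((G - K) \<inter> ?B i))"
        using F(2) by (intro measure_UNION')
      then show ?thesis
        by (simp only: sum_distrib_left)
    qed
    also have "\<dots> \<le> (2 / e) * measure lebesgue (G - K)"
    proof (intro mult_left_mono measure_mono_fmeasurable)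
      show "(\<Union>i\<in>F. (G - K) \<inter> ?B i) \<in> sets lebesgue"
        using F K by (intro sets.finite_UN) (auto simp: fmeasurableD)
    qed (use K \<open>e > 0\<close> in auto)
    also have "\<dots> \<le> \<eta>"
      using small' \<open>e > 0\<close> by (simp add: field_simps)
    finally show ?thesis .
  qed
  have U: "(\<Union>i\<in>C. ?B i) \<in> lmeasurable" "measure lebesgue (\<Union>i\<in>C. ?B i) \<le> \<eta>"
    by (rule fmeasurable_UN_bound[OF C(1) _ fin] measure_UN_bound[OF C(1) _ fin]; simp)+
  let ?T = "(E - (\<Union>i\<in>C. ?B i)) \<union> (\<Union>i\<in>C. ?B i)"
  show "\<exists>T. E \<subseteq> T \<and> T \<in> lmeasurable \<and> measure lebesgue T \<le> \<eta>"
  proof (intro exI[of _ ?T] conjI)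
    show "?T \<in> lmeasurable"
      using U(1) C(4) by (intro fmeasurable.Un) (auto intro: negligible_imp_measurable)
    have "measure lebesgue ?T \<le> measure lebesgue (E - (\<Union>i\<in>C. ?B i)) + measure lebesgue (\<Union>i\<in>C. ?B i)"
      using U(1) C(4) by (intro measure_Un_le) (auto intro: negligible_imp_measurable fmeasurableD)
    then show "measure lebesgue ?T \<le> \<eta>"
      using U(2) C(4) by (simp add: negligible_imp_measure0)
  qed auto
qed

text \<open>The exceptional sets grow as \<open>e\<close> decreases, so countably many thresholds
  cover all of them. Only points outside \<open>G\<close> are treated; points of \<open>G\<close>
  are reached by applying the lemma to \<open>- G\<close>.\<close>

lemma lebesgue_density:
  fixes G :: "real set"
  assumes G: "G \<in> sets lebesgue"
  obtains N where "negligible N"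
    "\<And>x e. \<lbrakk>x \<notin> G; x \<notin> N; e > 0\<rbrakk> \<Longrightarrow> \<exists>\<delta>>0. \<forall>d. 0 < d \<and> d < \<delta> \<longrightarrow> measure lebesgue (G \<inter> ball x d) \<le> e * d"
proof
  define E where "E e = {x \<in> -G. \<forall>\<delta>>0. \<exists>d. 0 < d \<and> d < \<delta> \<and> measure lebesgue (G \<inter> ball x d) > e * d}" for e
  define N where "N = (\<Union>n. E (1 / real (Suc n)))"
  show "negligible N"
    unfolding N_def
  proof (intro negligible_countable_Union)
    fix S assume "S \<in> range (\<lambda>n. E (1 / real (Suc n)))"
    then obtain n where "S = E (1 / real (Suc n))" by blast
    moreover have "1 / real (Suc n) > 0" by simp
    ultimately show "negligible S"
      unfolding E_def by (simp only: density_exceptional_set_negligible[OF G])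
  qed auto
  fix x e :: real assume x: "x \<notin> G" "x \<notin> N" and "e > 0"
  obtain n where n: "1 / real (Suc n) < e"
    using \<open>e > 0\<close> nat_approx_posE by blast
  have "x \<notin> E (1 / real (Suc n))" using x(2) by (auto simp: N_def)
  then obtain \<delta> where "\<delta> > 0" and \<delta>: "\<forall>d. 0 < d \<and> d < \<delta> \<longrightarrow> measure lebesgue (G \<inter> ball x d) \<le> 1 / real (Suc n) * d"
    using x(1) by (clarsimp simp: E_def not_less) (metis linorder_not_less)
  have "1 / real (Suc n) * d \<le> e * d" if "d > 0" for d
    using n that by (intro mult_right_mono) auto
  with \<delta> \<open>\<delta> > 0\<close> show "\<exists>\<delta>>0. \<forall>d. 0 < d \<and> d < \<delta> \<longrightarrow> measure lebesgue (G \<inter> ball x d) \<le> e * d"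
    by (metis order_trans)
qed

text \<open>Where \<open>H\<close> has density zero, its measure in an interval ending at
  \<open>x\<close> is small compared with the length, so the indefinite integral has derivative 0.
  This settles points outside \<open>G\<close>; at points of \<open>G\<close> it is applied to
  \<open>- G\<close>, since the two indefinite integrals add up to \<open>t - a\<close>.\<close>

lemma indefinite_integral_indicator_derivative:
  fixes G :: "real set"
  assumes G: "G \<in> sets borel" and "a \<le> b"
  obtains N where "negligible N"
    "\<And>x. \<lbrakk>x \<in> {a<..<b}; x \<notin> N\<rbrakk> \<Longrightarrow>
       ((\<lambda>t. integral {a..t} (indicat_real G)) has_real_derivative indicat_real G x) (at x)"
proof -
  have int: "indicat_real H integrable_on {u..v}" if "H \<in> sets borel" for H :: "real set" and u v
    using that by (intro integrable_on_bounded_borel[where C=1]) (auto simp: indicator_def)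
  have zero: "((\<lambda>t. integral {a..t} (indicat_real H)) has_real_derivative 0) (at x)"
    if H: "H \<in> sets borel" and x: "x \<in> {a<..<b}"
      and dens: "\<And>e. e > 0 \<Longrightarrow> \<exists>\<delta>>0. \<forall>d. 0 < d \<and> d < \<delta> \<longrightarrow> measure lebesgue (H \<inter> ball x d) \<le> e * d"
    for H x
    unfolding has_field_derivative_def has_derivative_at_alt
  proof (intro conjI allI impI)
    fix e :: real assume "e > 0"
    obtain \<delta> where "\<delta> > 0" and \<delta>: "\<And>d. \<lbrakk>0 < d; d < \<delta>\<rbrakk> \<Longrightarrow> measure lebesgue (H \<inter> ball x d) \<le> e / 2 * d"
      using dens[of "e / 2"] \<open>e > 0\<close> by auto
    have lmH: "H \<inter> S \<in> lmeasurable" if "bounded S" "S \<in> sets borel" for S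
      using H that by (intro bounded_set_imp_lmeasurable) (auto simp: bounded_Int)
    have bd: "integral {u..v} (indicat_real H) \<le> e * (v - u)"
      if "u < v" "x \<in> {u..v}" "v - u < \<delta> / 2" "x = u \<or> x = v" for u v
    proof -
      have "integral {u..v} (indicat_real H) = measure lebesgue (H \<inter> {u..v})"
        by (intro integral_indicator lmH) auto
      \<comment> \<open>The open ball of radius \<open>v - u\<close> about one end point misses the
        other one. Doubling the radius is paid for by \<open>e / 2\<close> and
        \<open>\<delta> / 2\<close>.\<close>
      also have "\<dots> \<le> measure lebesgue (H \<inter> ball x (2 * (v - u)))"
        using H that by (intro measure_mono_fmeasurable)
          (auto intro!: lmH borel_open simp: ball_eq_greaterThanLessThan)
      also have "\<dots> \<le> e / 2 * (2 * (v - u))"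
        using that by (intro \<delta>) auto
      also have "\<dots> = e * (v - u)" by simp
      finally show ?thesis .
    qed
    show "\<exists>d>0. \<forall>y. norm (y - x) < d \<longrightarrow>
      norm (integral {a..y} (indicat_real H) - integral {a..x} (indicat_real H) - 0 * (y - x)) \<le> e * norm (y - x)"
    proof (intro exI[of _ "min (\<delta> / 2) (x - a)"] conjI allI impI)
      fix y assume y: "norm (y - x) < min (\<delta> / 2) (x - a)"
      consider "y = x" | "x < y" | "y < x" by linarith
      then show "norm (integral {a..y} (indicat_real H) - integral {a..x} (indicat_real H) - 0 * (y - x)) \<le> e * norm (y - x)"
      proof cases
        case 2
        have "integral {a..x} (indicat_real H) + integral {x..y} (indicat_real H) = integral {a..y} (indicat_real H)"
          using 2 x by (intro Henstock_Kurzweil_Integration.integral_combine int H) auto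
        moreover have "integral {x..y} (indicat_real H) \<ge> 0"
          by (intro Henstock_Kurzweil_Integration.integral_nonneg int H) auto
        moreover have "integral {x..y} (indicat_real H) \<le> e * (y - x)"
          using 2 y by (intro bd) auto
        moreover have "norm (y - x) = y - x" using 2 by simp
        ultimately show ?thesis by simp
      next
        case 3
        have "integral {a..y} (indicat_real H) + integral {y..x} (indicat_real H) = integral {a..x} (indicat_real H)"
          using 3 x y by (intro Henstock_Kurzweil_Integration.integral_combine int H) auto
        moreover have "integral {y..x} (indicat_real H) \<ge> 0"
          by (intro Henstock_Kurzweil_Integration.integral_nonneg int H) auto
        moreover have "integral {y..x} (indicat_real H) \<le> e * (x - y)"
          using 3 y by (intro bd) auto
        moreover have "norm (y - x) = x - y" using 3 by simp
        ultimately show ?thesis by simp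
      qed auto
    qed (use x \<open>\<delta> > 0\<close> in auto)
  qed (rule bounded_linear_mult_right)
  have sets: "G \<in> sets lebesgue" "-G \<in> sets lebesgue" "-G \<in> sets borel"
    using G by (auto simp: borel_comp)
  obtain N1 where N1: "negligible N1" "\<And>x e. \<lbrakk>x \<notin> G; x \<notin> N1; e > 0\<rbrakk> \<Longrightarrow> \<exists>\<delta>>0. \<forall>d. 0 < d \<and> d < \<delta> \<longrightarrow> measure lebesgue (G \<inter> ball x d) \<le> e * d"
    using lebesgue_density[OF sets(1)] by blast
  obtain N2 where N2: "negligible N2" "\<And>x e. \<lbrakk>x \<notin> -G; x \<notin> N2; e > 0\<rbrakk> \<Longrightarrow> \<exists>\<delta>>0. \<forall>d. 0 < d \<and> d < \<delta> \<longrightarrow> measure lebesgue (-G \<inter> ball x d) \<le> e * d"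
    using lebesgue_density[OF sets(2)] by blast
  show thesis
  proof
    show "negligible (N1 \<union> N2)" using N1(1) N2(1) by (rule negligible_Un)
    fix x assume x: "x \<in> {a<..<b}" "x \<notin> N1 \<union> N2"
    show "((\<lambda>t. integral {a..t} (indicat_real G)) has_real_derivative indicat_real G x) (at x)"
    proof (cases "x \<in> G")
      case False
      then show ?thesis using zero[OF G x(1)] N1(2)[of x] x(2) by simp
    next
      case True
      have "((\<lambda>t. integral {a..t} (indicat_real (-G))) has_real_derivative 0) (at x)"
        using True N2(2)[of x] x(2) by (intro zero[OF sets(3) x(1)]) auto
      then have "((\<lambda>t. (t - a) - integral {a..t} (indicat_real (-G))) has_real_derivative 1) (at x)"
        by (auto intro!: derivative_eq_intros)
      moreover have "\<forall>\<^sub>F t in nhds x. (t - a) - integral {a..t} (indicat_real (-G)) = integral {a..t} (indicat_real G)"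
      proof (rule eventually_nhds_in_open[of "{a<..<b}", THEN eventually_mono])
        fix t assume t: "t \<in> {a<..<b}"
        have "integral {a..t} (\<lambda>x. indicat_real G x + indicat_real (-G) x) = integral {a..t} (indicat_real G) + integral {a..t} (indicat_real (-G))"
          using int G sets(3) by (intro Henstock_Kurzweil_Integration.integral_add) auto
        moreover have "(\<lambda>x. indicat_real G x + indicat_real (-G) x) = (\<lambda>_. 1)"
          by (auto simp: indicator_def)
        ultimately show "(t - a) - integral {a..t} (indicat_real (-G)) = integral {a..t} (indicat_real G)"
          using t by simp
      qed (use x in auto)
      ultimately show ?thesis using True by (simp add: DERIV_cong_ev)
    qed
  qed
qed

text \<open>Dominated convergence for the difference quotients \<open>n (f (x + 1/n) - f x)\<close>.\<close>

lemma has_integral_lipschitz_derivative: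
  fixes f h :: "real \<Rightarrow> real"
  assumes lip: "L-lipschitz_on {a..b} f" and "a \<le> b" and N: "negligible N"
    and deriv: "\<And>x. \<lbrakk>x \<in> {a<..<b}; x \<notin> N\<rbrakk> \<Longrightarrow> (f has_real_derivative h x) (at x)"
  shows "(h has_integral f b - f a) {a..b}"
proof -
  \<comment> \<open>Constant continuation keeps the Lipschitz constant and gives the quotients at
    \<open>x + 1 / real (Suc n)\<close> a meaning up to the right end.\<close>
  define g where "g x = f (max a (min b x))" for x
  have g_lip: "\<bar>g x - g y\<bar> \<le> L * \<bar>x - y\<bar>" for x y
  proof -
    have "\<bar>g x - g y\<bar> \<le> L * \<bar>max a (min b x) - max a (min b y)\<bar>"
      using lipschitz_onD[OF lip, of "max a (min b x)" "max a (min b y)"] \<open>a \<le> b\<close>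
      by (auto simp: g_def dist_real_def)
    also have "\<dots> \<le> L * \<bar>x - y\<bar>"
      using lipschitz_on_nonneg[OF lip] by (intro mult_left_mono) auto
    finally show ?thesis .
  qed
  have g_cont: "continuous_on S g" for S
  proof (rule lipschitz_on_continuous_on)
    show "L-lipschitz_on S g"
      using g_lip lipschitz_on_nonneg[OF lip] by (auto simp: lipschitz_on_def dist_real_def)
  qed
  define q where "q n x = real (Suc n) * (g (x + 1 / real (Suc n)) - g x)" for n x
  \<comment> \<open>Dominated convergence is used with limits at every point, so the integrands are
    set to 0 on \<open>N\<close> and at the end points, where nothing is known about
    convergence.\<close>
  define Z where "Z = N \<union> {a, b}"
  have Z: "negligible Z" unfolding Z_def using N by (rule negligible_Un) (auto intro: negligible_finite)
  define h' where "h' x = (if x \<in> Z then 0 else h x)" for x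
  define q' where "q' n x = (if x \<in> Z then 0 else q n x)" for n x
  have q_int: "q n integrable_on {u..v}" for n u v
    unfolding q_def
    by (intro integrable_continuous_real continuous_intros continuous_on_compose2[OF g_cont[of UNIV]]) auto
  have q'_int: "(q' n has_integral integral {a..b} (q n)) {a..b}" for n
    by (rule has_integral_spike[OF Z _ integrable_integral[OF q_int]]) (auto simp: q'_def)
  have q_bound: "\<bar>q n x\<bar> \<le> L" for n x
  proof -
    have "\<bar>q n x\<bar> \<le> real (Suc n) * (L * \<bar>x + 1 / real (Suc n) - x\<bar>)"
      unfolding q_def abs_mult using g_lip[of "x + 1 / real (Suc n)" x]
      by (intro mult_mono) (simp_all del: of_nat_Suc)
    then show ?thesis by simp
  qed
  have inv: "(\<lambda>n. inverse (real (Suc n))) \<longlonglongrightarrow> 0" by (rule LIMSEQ_inverse_real_of_nat)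
  have inv': "filterlim (\<lambda>n. inverse (real (Suc n))) (at 0) sequentially"
    by (rule filterlim_atI[OF inv]) auto
  have quot: "(\<lambda>n. real (Suc n) * (F (x + 1 / real (Suc n)) - F x)) \<longlonglongrightarrow> D"
    if "(F has_real_derivative D) (at x)" for F D and x :: real
  proof -
    have "((\<lambda>h. (F (x + h) - F x) / h) \<longlongrightarrow> D) (at 0)"
      using that by (simp add: DERIV_def)
    from filterlim_compose[OF this inv'] show ?thesis
      by (simp add: field_simps)
  qed
  have q'_lim: "(\<lambda>n. q' n x) \<longlonglongrightarrow> h' x" if "x \<in> {a..b}" for x
  proof (cases "x \<in> Z")
    case True
    then show ?thesis by (simp add: q'_def h'_def)
  next
    case False
    then have x: "x \<in> {a<..<b}" "x \<notin> N" using that by (auto simp: Z_def)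
    have ev: "\<forall>\<^sub>F y in nhds x. g y = f y"
      by (rule eventually_nhds_in_open[of "{a<..<b}", THEN eventually_mono]) (use x in \<open>auto simp: g_def\<close>)
    have "(g has_real_derivative h x) (at x)"
      using DERIV_cong_ev[OF refl ev refl] deriv[OF x] by simp
    from quot[OF this] show ?thesis
      using False by (simp add: q'_def h'_def q_def)
  qed
  have edge: "(\<lambda>n. real (Suc n) * integral {c..c + 1 / real (Suc n)} g) \<longlonglongrightarrow> g c" for c
  proof -
    have "((\<lambda>u. integral {c - 1..u} g) has_real_derivative g c) (at c within {c - 1..c + 1})"
      by (rule integral_has_real_derivative) (auto intro: g_cont)
    then have "((\<lambda>u. integral {c - 1..u} g) has_real_derivative g c) (at c)"
      by (simp add: at_within_Icc_at)
    from quot[OF this]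
    have "(\<lambda>n. real (Suc n) * (integral {c - 1..c + 1 / real (Suc n)} g - integral {c - 1..c} g)) \<longlonglongrightarrow> g c" .
    moreover have "integral {c - 1..c + 1 / real (Suc n)} g - integral {c - 1..c} g = integral {c..c + 1 / real (Suc n)} g" for n
      using Henstock_Kurzweil_Integration.integral_combine[of "c - 1" c "c + 1 / real (Suc n)" g]
        integrable_continuous_real[OF g_cont] by (simp add: algebra_simps del: of_nat_Suc)
    ultimately show ?thesis by simp
  qed
  \<comment> \<open>Shifting the integral cancels everything but two means of \<open>g\<close>, over
    short intervals to the right of \<open>b\<close> and \<open>a\<close>; by \<open>edge\<close>
    they tend to \<open>g b\<close> and \<open>g a\<close>.\<close>
  have q_val: "integral {a..b} (q n) = real (Suc n) * integral {b..b + 1 / real (Suc n)} g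
      - real (Suc n) * integral {a..a + 1 / real (Suc n)} g" for n
  proof -
    define \<delta> where "\<delta> = 1 / real (Suc n)"
    have "\<delta> > 0" by (simp add: \<delta>_def)
    have gi: "g integrable_on {u..v}" for u v by (intro integrable_continuous_real g_cont)
    have "integral {a..b} (q n) = real (Suc n) * (integral {a..b} (\<lambda>x. g (x + \<delta>)) - integral {a..b} g)"
      unfolding q_def \<delta>_def[symmetric]
      by (subst integral_mult_right, subst Henstock_Kurzweil_Integration.integral_diff)
        (auto intro!: integrable_continuous_real g_cont continuous_intros continuous_on_compose2[OF g_cont[of UNIV]])
    also have "integral {a..b} (\<lambda>x. g (x + \<delta>)) = integral {a + \<delta>..b + \<delta>} g"
      using integral_shift[of a \<delta> b g] g_cont by (simp add: o_def)
    also have "integral {a + \<delta>..b + \<delta>} g - integral {a..b} g = integral {b..b + \<delta>} g - integral {a..a + \<delta>} g"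
      using Henstock_Kurzweil_Integration.integral_combine[of a "a + \<delta>" "b + \<delta>" g]
        Henstock_Kurzweil_Integration.integral_combine[of a b "b + \<delta>" g] gi \<open>\<delta> > 0\<close> \<open>a \<le> b\<close> by simp
    finally show ?thesis by (simp add: \<delta>_def algebra_simps)
  qed
  have "(h' has_integral g b - g a) {a..b}"
  proof (rule has_integral_dominated_convergence[OF q'_int])
    show "(\<lambda>_. L) integrable_on {a..b}" by (rule integrable_const_ivl)
    show "\<forall>x\<in>{a..b}. norm (q' n x) \<le> L" for n
      using q_bound lipschitz_on_nonneg[OF lip] by (auto simp: q'_def)
    show "(\<lambda>n. integral {a..b} (q n)) \<longlonglongrightarrow> g b - g a"
      unfolding q_val by (intro tendsto_diff edge)
  qed (use q'_lim in blast)
  moreover have "g b = f b" "g a = f a" using \<open>a \<le> b\<close> by (auto simp: g_def)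
  ultimately show ?thesis
    by (intro has_integral_spike[OF Z, of _ h h']) (auto simp: h'_def)
qed

text \<open>\<open>h\<close> is a uniform limit of step functions \<open>\<lfloor>n h\<rfloor> / n\<close>, for which this is Lebesgue density.\<close>

lemma indefinite_integral_derivative_ae:
  fixes h :: "real \<Rightarrow> real"
  assumes h: "h \<in> borel_measurable borel" and "a \<le> b"
    and bound: "\<And>x. x \<in> {a..b} \<Longrightarrow> \<bar>h x\<bar> \<le> C"
  obtains N where "negligible N"
    "\<And>x. \<lbrakk>x \<in> {a<..<b}; x \<notin> N\<rbrakk> \<Longrightarrow> ((\<lambda>t. integral {a..t} h) has_real_derivative h x) (at x)"
proof -
  define E where "E n j = {x. \<lfloor>real (Suc n) * h x\<rfloor> = j}" for n j
  have E[measurable]: "E n j \<in> sets borel" for n j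
    unfolding E_def using h by measurable
  have "\<forall>n j. \<exists>N. negligible N \<and> (\<forall>x. x \<in> {a<..<b} \<longrightarrow> x \<notin> N \<longrightarrow>
       ((\<lambda>t. integral {a..t} (indicat_real (E n j))) has_real_derivative indicat_real (E n j) x) (at x))"
    using indefinite_integral_indicator_derivative[OF E \<open>a \<le> b\<close>] by metis
  then obtain N where N: "\<And>n j. negligible (N n j)"
    and dN: "\<And>n j x. \<lbrakk>x \<in> {a<..<b}; x \<notin> N n j\<rbrakk> \<Longrightarrow>
       ((\<lambda>t. integral {a..t} (indicat_real (E n j))) has_real_derivative indicat_real (E n j) x) (at x)"
    by metis
  define M where "M = (\<Union>n. \<Union>j. N n j)"
  have "negligible M"
    unfolding M_def by (intro negligible_countable_Union countable_image) (auto intro!: negligible_countable_Union N)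
  moreover have "((\<lambda>t. integral {a..t} h) has_real_derivative h x) (at x)" if x: "x \<in> {a<..<b}" "x \<notin> M" for x
    unfolding has_field_derivative_def has_derivative_at_alt
  proof (intro conjI allI impI)
    fix e :: real assume "e > 0"
    \<comment> \<open>Three errors of relative size \<open>e / 4\<close> occur: between the
      integrals of \<open>h\<close> and \<open>hn\<close>, in the derivative of the integral of
      \<open>hn\<close>, and between \<open>hn x\<close> and \<open>h x\<close>.\<close>
    obtain n where n: "1 / real (Suc n) < e / 4"
      using \<open>e > 0\<close> nat_approx_posE by (metis zero_less_divide_iff zero_less_numeral)
    \<comment> \<open>A finite range that contains the rounded value of
      \<open>real (Suc n) * h y\<close> for all \<open>y\<close> in the interval; the extra 1 on
      either side absorbs the rounding.\<close>
    define J where "J = {- \<lceil>real (Suc n) * C\<rceil> - 1..\<lceil>real (Suc n) * C\<rceil> + 1}"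
    define hn where "hn y = (\<Sum>j\<in>J. real_of_int j / real (Suc n) * indicat_real (E n j) y)" for y
    have hn_eq: "hn y = real_of_int \<lfloor>real (Suc n) * h y\<rfloor> / real (Suc n)" if "y \<in> {a..b}" for y
    proof -
      have "\<bar>real (Suc n) * h y\<bar> \<le> real (Suc n) * C"
        using bound[OF that] by (simp add: abs_mult)
      then have "\<lfloor>real (Suc n) * h y\<rfloor> \<in> J"
        unfolding J_def by (simp only: atLeastAtMost_iff) linarith
      then have "hn y = (\<Sum>j\<in>{\<lfloor>real (Suc n) * h y\<rfloor>}. real_of_int j / real (Suc n))"
        unfolding hn_def by (intro sum.mono_neutral_cong_right) (auto simp: J_def E_def indicator_def)
      then show ?thesis by simp
    qed
    have near: "\<bar>h y - hn y\<bar> \<le> e / 4" if "y \<in> {a..b}" for y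
    proof -
      have "h y - hn y = (real (Suc n) * h y - real_of_int \<lfloor>real (Suc n) * h y\<rfloor>) / real (Suc n)"
        by (simp add: hn_eq[OF that] field_simps)
      also have "\<bar>\<dots>\<bar> = \<bar>real (Suc n) * h y - real_of_int \<lfloor>real (Suc n) * h y\<rfloor>\<bar> / real (Suc n)"
        by simp
      also have "\<dots> \<le> 1 / real (Suc n)"
        by (intro divide_right_mono) linarith+
      finally show ?thesis using n by linarith
    qed
    have ind_int: "indicat_real (E n j) integrable_on {u..v}" for j u v
      by (intro integrable_on_bounded_borel[where C=1]) (auto simp: indicator_def)
    have h_int: "h integrable_on {u..v}" if "{u..v} \<subseteq> {a..b}" for u v
      using that bound by (intro integrable_on_bounded_borel[OF h, where C=C]) auto
    have hn_int: "hn integrable_on {u..v}" for u v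
      unfolding hn_def by (intro integrable_sum integrable_on_mult_right ind_int) (auto simp: J_def)
    have "((\<lambda>t. \<Sum>j\<in>J. real_of_int j / real (Suc n) * integral {a..t} (indicat_real (E n j))) has_real_derivative hn x) (at x)"
      unfolding hn_def using x by (intro DERIV_sum DERIV_cmult dN) (auto simp: M_def)
    moreover have "(\<lambda>t. \<Sum>j\<in>J. real_of_int j / real (Suc n) * integral {a..t} (indicat_real (E n j))) = (\<lambda>t. integral {a..t} hn)"
      unfolding hn_def by (subst integral_sum) (auto simp: J_def intro!: integrable_on_mult_right ind_int)
    ultimately have "((\<lambda>t. integral {a..t} hn) has_real_derivative hn x) (at x)" by simp
    then obtain d where "d > 0" and d: "\<And>y. norm (y - x) < d \<Longrightarrow>
        norm (integral {a..y} hn - integral {a..x} hn - hn x * (y - x)) \<le> e / 4 * norm (y - x)"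
      using \<open>e > 0\<close> unfolding has_field_derivative_def has_derivative_at_alt by (meson divide_pos_pos zero_less_numeral)
    have diff: "\<bar>(integral {a..v} h - integral {a..u} h) - (integral {a..v} hn - integral {a..u} hn)\<bar> \<le> e / 4 * (v - u)"
      if "a \<le> u" "u \<le> v" "v \<le> b" for u v
    proof -
      have "integral {a..v} h - integral {a..u} h = integral {u..v} h"
        using Henstock_Kurzweil_Integration.integral_combine[of a u v h] that h_int[of a v] by auto
      moreover have "integral {a..v} hn - integral {a..u} hn = integral {u..v} hn"
        using Henstock_Kurzweil_Integration.integral_combine[of a u v hn] that hn_int by auto
      moreover have "integral {u..v} h - integral {u..v} hn = integral {u..v} (\<lambda>y. h y - hn y)"
        using that hn_int h_int by (intro Henstock_Kurzweil_Integration.integral_diff[symmetric]) auto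
      moreover have "\<bar>integral {u..v} (\<lambda>y. h y - hn y)\<bar> \<le> e / 4 * (v - u)"
        using that near hn_int h_int by (intro abs_integral_le_const Henstock_Kurzweil_Integration.integrable_diff) auto
      ultimately show ?thesis by simp
    qed
    show "\<exists>d>0. \<forall>y. norm (y - x) < d \<longrightarrow>
      norm (integral {a..y} h - integral {a..x} h - h x * (y - x)) \<le> e * norm (y - x)"
    proof (intro exI[of _ "min d (min (x - a) (b - x))"] conjI allI impI)
      fix y assume y: "norm (y - x) < min d (min (x - a) (b - x))"
      have 1: "\<bar>(integral {a..y} h - integral {a..x} h) - (integral {a..y} hn - integral {a..x} hn)\<bar> \<le> e / 4 * \<bar>y - x\<bar>"
        using diff[of x y] diff[of y x] x y by (cases "x \<le> y") (auto simp: abs_if split: if_splits)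
      have 2: "\<bar>integral {a..y} hn - integral {a..x} hn - hn x * (y - x)\<bar> \<le> e / 4 * \<bar>y - x\<bar>"
        using d[of y] y by simp
      have "\<bar>(hn x - h x) * (y - x)\<bar> \<le> e / 4 * \<bar>y - x\<bar>"
        unfolding abs_mult using near[of x] x by (intro mult_right_mono) (simp_all add: abs_minus_commute)
      then have 3: "\<bar>hn x * (y - x) - h x * (y - x)\<bar> \<le> e / 4 * \<bar>y - x\<bar>"
        by (simp add: left_diff_distrib)
      have "e * \<bar>y - x\<bar> \<ge> 0" using \<open>e > 0\<close> by simp
      with 1 2 3 show "norm (integral {a..y} h - integral {a..x} h - h x * (y - x)) \<le> e * norm (y - x)"
        unfolding real_norm_def by linarith
    qed (use x \<open>d > 0\<close> in auto)
  qed (rule bounded_linear_mult_right)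
  ultimately show thesis by (rule that)
qed

section \<open>Linear delay equations on the real line\<close>

lemma has_integral_exp_weight:
  fixes L s t :: real
  assumes "s \<le> t"
  shows "((\<lambda>v. L * exp (2 * L * (v - s))) has_integral (exp (2 * L * (t - s)) - 1) / 2) {s..t}"
proof -
  have "((\<lambda>v. L * exp (2 * L * (v - s))) has_integral exp (2 * L * (t - s)) / 2 - exp (2 * L * (s - s)) / 2) {s..t}"
  proof (rule fundamental_theorem_of_calculus[OF assms])
    fix x
    have "((\<lambda>x. exp (2 * L * (x - s)) / 2) has_real_derivative L * exp (2 * L * (x - s))) (at x within {s..t})"
      by (auto intro!: derivative_eq_intros)
    then show "((\<lambda>x. exp (2 * L * (x - s)) / 2) has_vector_derivative L * exp (2 * L * (x - s))) (at x within {s..t})"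
      by (simp add: has_real_derivative_iff_has_vector_derivative)
  qed
  then show ?thesis by (simp add: diff_divide_distrib)
qed

text \<open>The exponent is \<open>2 * L\<close> so that integrating \<open>L\<close> times the
  weight returns at most half of the weight at \<open>t\<close>. This factor 1/2 is the contraction
  constant of the Picard iteration and lets the Gronwall estimate absorb its own right-hand
  side.\<close>

lemma exp_weighted_integral_bound:
  fixes g :: "real \<Rightarrow> real"
  assumes "(g has_integral I) {s..t}" "s \<le> t" "m \<ge> 0"
    and bound: "\<And>v. v \<in> {s..t} \<Longrightarrow> \<bar>g v\<bar> \<le> L * (m * exp (2 * L * (v - s)))"
  shows "\<bar>I\<bar> \<le> m / 2 * exp (2 * L * (t - s))"
proof -
  have w: "((\<lambda>v. m * (L * exp (2 * L * (v - s)))) has_integral m * ((exp (2 * L * (t - s)) - 1) / 2)) {s..t}"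
    by (intro has_integral_mult_right has_integral_exp_weight assms)
  have "norm (integral {s..t} g) \<le> integral {s..t} (\<lambda>v. m * (L * exp (2 * L * (v - s))))"
  proof (rule Henstock_Kurzweil_Integration.integral_norm_bound_integral)
    show "norm (g v) \<le> m * (L * exp (2 * L * (v - s)))" if "v \<in> {s..t}" for v
      using bound[OF that] by (simp add: algebra_simps)
  qed (use assms(1) w in auto)
  then have "\<bar>I\<bar> \<le> m * ((exp (2 * L * (t - s)) - 1) / 2)"
    by (simp only: integral_unique[OF w] integral_unique[OF assms(1)] real_norm_def)
  also have "\<dots> \<le> m / 2 * exp (2 * L * (t - s))"
    using \<open>m \<ge> 0\<close> by (simp add: algebra_simps)
  finally show ?thesis .
qed

text \<open>In the weighted supremum \<open>m\<close> of \<open>e\<close> the integral term costs at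
  most \<open>m / 2\<close>, whence \<open>m \<le> 2 * R\<close>. \<open>B\<close> serves to make
  \<open>m\<close> finite and does not enter the bound. The conditions on \<open>e\<close> concern
  points of \<open>T\<close> and delayed arguments before \<open>s\<close>, because a solution is
  controlled only there while the integral runs over the real line.\<close>

lemma delay_gronwall:
  fixes a \<beta> e I :: "real \<Rightarrow> real"
  assumes a: "\<And>v. v \<in> {s..b} \<Longrightarrow> \<bar>a v\<bar> \<le> L"
    and \<beta>: "\<And>v. v \<in> {s..b} \<Longrightarrow> \<beta> v \<le> v"
    and \<beta>T: "\<And>v. v \<in> {s..b} \<Longrightarrow> \<beta> v < s \<Longrightarrow> e (\<beta> v) = 0"
      "\<And>v. v \<in> {s..b} \<Longrightarrow> s \<le> \<beta> v \<Longrightarrow> \<beta> v \<in> T"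
    and I: "\<And>t. t \<in> T \<inter> {s..b} \<Longrightarrow> ((\<lambda>v. a v * e (\<beta> v)) has_integral I t) {s..t}"
    and e: "\<And>t. t \<in> T \<inter> {s..b} \<Longrightarrow> \<bar>e t\<bar> \<le> R + \<bar>I t\<bar>"
    and B: "\<And>t. t \<in> T \<inter> {s..b} \<Longrightarrow> \<bar>e t\<bar> \<le> B"
    and t: "t \<in> T \<inter> {s..b}" and "R \<ge> 0"
  shows "\<bar>e t\<bar> \<le> 2 * R * exp (2 * L * (t - s))"
proof -
  have "L \<ge> 0" using a[of s] t by force
  define w where "w t = exp (2 * L * (t - s))" for t
  define m where "m = (SUP t\<in>T \<inter> {s..b}. \<bar>e t\<bar> / w t)"
  have w_pos: "w t > 0" for t by (simp add: w_def)
  have w_ge1: "w t \<ge> 1" if "t \<ge> s" for t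
    using that \<open>L \<ge> 0\<close> by (simp add: w_def)
  have w_mono: "w u \<le> w v" if "u \<le> v" for u v
    using that \<open>L \<ge> 0\<close> by (simp add: w_def mult_left_mono)
  have "B \<ge> 0" using B[OF t] by linarith
  have bdd: "bdd_above ((\<lambda>t. \<bar>e t\<bar> / w t) ` (T \<inter> {s..b}))"
  proof (rule bdd_aboveI2)
    fix t assume t: "t \<in> T \<inter> {s..b}"
    have "\<bar>e t\<bar> * 1 \<le> B * w t"
      using B[OF t] w_ge1[of t] t \<open>B \<ge> 0\<close> by (intro mult_mono) auto
    then show "\<bar>e t\<bar> / w t \<le> B" using w_pos[of t] by (simp add: pos_divide_le_eq)
  qed
  have le_m: "\<bar>e t\<bar> \<le> m * w t" if "t \<in> T \<inter> {s..b}" for t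
    using cSUP_upper[OF that bdd] w_pos[of t] by (simp add: m_def pos_divide_le_eq)
  have "m \<ge> 0"
    using le_m[OF t] w_pos[of t] by (metis abs_ge_zero order_trans zero_le_mult_iff not_le)
  have "m \<le> R + m / 2"
    unfolding m_def
  proof (rule cSUP_least)
    fix t assume t: "t \<in> T \<inter> {s..b}"
    have "\<bar>I t\<bar> \<le> m / 2 * exp (2 * L * (t - s))"
    proof (rule exp_weighted_integral_bound[OF I[OF t]])
      fix v assume v: "v \<in> {s..t}"
      have "\<bar>e (\<beta> v)\<bar> \<le> m * w v"
      proof (cases "\<beta> v < s")
        case True
        then show ?thesis using \<beta>T(1)[of v] v t \<open>m \<ge> 0\<close> w_pos[of v] by simp
      next
        case False
        then have "\<bar>e (\<beta> v)\<bar> \<le> m * w (\<beta> v)"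
          using \<beta>[of v] \<beta>T(2)[of v] v t by (intro le_m) auto
        \<comment> \<open>A delayed argument meets a smaller weight, so the size of the delay does
          not matter.\<close>
        also have "\<dots> \<le> m * w v"
          using \<beta>[of v] v t \<open>m \<ge> 0\<close> by (intro mult_left_mono w_mono) auto
        finally show ?thesis .
      qed
      then show "\<bar>a v * e (\<beta> v)\<bar> \<le> L * (m * exp (2 * L * (v - s)))"
        unfolding abs_mult w_def using a[of v] v t \<open>L \<ge> 0\<close> by (intro mult_mono) auto
    qed (use t \<open>m \<ge> 0\<close> in auto)
    then have "\<bar>e t\<bar> \<le> R + m / 2 * w t" using e[OF t] by (simp add: w_def)
    also have "\<dots> \<le> (R + m / 2) * w t"
      using mult_left_mono[OF w_ge1[of t] \<open>R \<ge> 0\<close>] t by (simp add: distrib_right)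
    finally have "\<bar>e t\<bar> / w t \<le> R + m / 2" using w_pos[of t] by (simp add: pos_divide_le_eq)
    then show "\<bar>e t\<bar> / w t \<le> R + (SUP t\<in>T \<inter> {s..b}. \<bar>e t\<bar> / w t) / 2" by (simp add: m_def)
  qed (use t in auto)
  then have "m \<le> 2 * R" by simp
  then have "m * w t \<le> 2 * R * w t" using w_pos[of t] by (intro mult_right_mono) auto
  from order_trans[OF le_m[OF t] this] show ?thesis by (simp only: w_def)
qed

lemma borel_measurable_truncated:
  fixes y :: "real \<Rightarrow> real"
  assumes "\<And>t. t < s \<Longrightarrow> y t = 0" and "continuous_on {s..} y"
  shows "y \<in> borel_measurable borel"
proof -
  have "(\<lambda>t. if t \<in> {s..} then y t else 0) \<in> borel_measurable borel"
    using assms(2) by (intro borel_measurable_continuous_on_if) auto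
  also have "(\<lambda>t. if t \<in> {s..} then y t else 0) = y"
    using assms(1) by (auto simp: fun_eq_iff)
  finally show ?thesis .
qed

lemma truncated_bounded:
  fixes y :: "real \<Rightarrow> real"
  assumes "\<And>t. t < s \<Longrightarrow> y t = 0" and "continuous_on {s..} y"
  obtains C where "C \<ge> 0" "\<And>t. t \<le> b \<Longrightarrow> \<bar>y t\<bar> \<le> C"
proof -
  have "compact (y ` {s..b})"
    by (intro compact_continuous_image continuous_on_subset[OF assms(2)]) auto
  then obtain C where C: "\<forall>x\<in>y ` {s..b}. norm x \<le> C"
    using compact_imp_bounded bounded_iff by metis
  show thesis
  proof (rule that[of "max C 0"])
    show "\<bar>y t\<bar> \<le> max C 0" if "t \<le> b" for t
      using C assms(1)[of t] that by (cases "t < s") (auto simp: le_max_iff_disj)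
  qed auto
qed

section \<open>Fundamental solutions on the real line and variation of constants\<close>

locale linear_delay =
  fixes a \<beta> :: "real \<Rightarrow> real" and t0 :: real
  assumes a_borel: "a \<in> borel_measurable borel"
    and \<beta>_borel: "\<beta> \<in> borel_measurable borel"
    and a_locally_bounded: "\<exists>L. \<forall>v\<in>{t0..b}. \<bar>a v\<bar> \<le> L"
    and \<beta>_le: "t0 \<le> v \<Longrightarrow> \<beta> v \<le> v"
begin

text \<open>\<open>y\<close> jumps from 0 to 1 at \<open>s\<close>: the case \<open>t = s\<close> of
  the integrated equation fixes \<open>y s = 1\<close>. No exceptional null set has to be carried
  along.\<close>

definition fundamental :: "real \<Rightarrow> (real \<Rightarrow> real) \<Rightarrow> bool" where
  "fundamental s y \<longleftrightarrow> (\<forall>t<s. y t = 0) \<and> continuous_on {s..} y \<and>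
     (\<forall>t\<ge>s. ((\<lambda>v. a v * y (\<beta> v)) has_integral 1 - y t) {s..t})"

lemma delayed_product_integrable:
  assumes "t0 \<le> s" and y: "\<And>t. t < s' \<Longrightarrow> y t = 0" "continuous_on {s'..} y"
  shows "(\<lambda>v. a v * y (\<beta> v)) integrable_on {s..t}"
proof -
  obtain C where C: "C \<ge> 0" "\<And>u. u \<le> t \<Longrightarrow> \<bar>y u\<bar> \<le> C"
    using truncated_bounded[OF y] by metis
  obtain L where L: "\<And>v. v \<in> {t0..t} \<Longrightarrow> \<bar>a v\<bar> \<le> L"
    using a_locally_bounded by metis
  show ?thesis
  proof (rule integrable_on_bounded_borel)
    have "(\<lambda>v. y (\<beta> v)) \<in> borel_measurable borel"
      using measurable_compose[OF \<beta>_borel borel_measurable_truncated[OF y]] by simp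
    then show "(\<lambda>v. a v * y (\<beta> v)) \<in> borel_measurable borel"
      by (intro borel_measurable_times a_borel)
    show "\<bar>a v * y (\<beta> v)\<bar> \<le> L * C" if "v \<in> {s..t}" for v
      unfolding abs_mult
      using L[of v] C(2)[of "\<beta> v"] C(1) \<beta>_le[of v] that \<open>t0 \<le> s\<close> by (intro mult_mono) auto
  qed
qed

text \<open>In the weight \<open>exp (2 * L * (t - s))\<close> consecutive Picard iterates differ by
  at most \<open>(1 / 2) ^ n\<close>, so they converge at each \<open>t\<close>, with a bound
  \<open>L\<close> of the coefficient up to \<open>t\<close>. Dominated convergence carries the
  integral equation over to the limit.\<close>

lemma fundamental_exists:
  assumes "t0 \<le> s"
  obtains y where "fundamental s y"
proof -
  define \<Phi> where "\<Phi> y t = (if t < s then 0 else 1 - integral {s..t} (\<lambda>v. a v * y (\<beta> v)))" for y t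
  define Y where "Y n = (\<Phi> ^^ n) (\<lambda>_. 0)" for n
  have Y0: "Y 0 t = 0" and Ysuc: "Y (Suc n) = \<Phi> (Y n)" for n t
    by (simp_all add: Y_def)
  have cont_\<Phi>: "continuous_on {s..} (\<Phi> y)" if int: "\<And>t. (\<lambda>v. a v * y (\<beta> v)) integrable_on {s..t}" for y
  proof -
    have "continuous_on {s..} (\<lambda>t. 1 - integral {s..t} (\<lambda>v. a v * y (\<beta> v)))"
      unfolding continuous_on_eq_continuous_within
    proof
      fix t assume t: "t \<in> {s..}"
      have "continuous_on {s..t + 1} (\<lambda>t. 1 - integral {s..t} (\<lambda>v. a v * y (\<beta> v)))"
        by (intro continuous_intros indefinite_integral_continuous_1 int)
      then have "continuous (at t within {s..t + 1}) (\<lambda>t. 1 - integral {s..t} (\<lambda>v. a v * y (\<beta> v)))"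
        using t by (auto simp: continuous_on_eq_continuous_within)
      moreover have "at t within {s..t + 1} = at t within {s..}"
        using t by (intro at_within_nhd[of _ "{..<t + 1}"]) auto
      ultimately show "continuous (at t within {s..}) (\<lambda>t. 1 - integral {s..t} (\<lambda>v. a v * y (\<beta> v)))"
        by simp
    qed
    then show ?thesis
      by (rule continuous_on_eq) (auto simp: \<Phi>_def)
  qed
  have Y: "(\<forall>t<s. Y n t = 0) \<and> continuous_on {s..} (Y n)" for n
  proof (induction n)
    case 0
    then show ?case by (simp add: Y_def)
  next
    case (Suc n)
    have "continuous_on {s..} (\<Phi> (Y n))"
      using Suc by (intro cont_\<Phi> delayed_product_integrable[OF assms, of s]) auto
    then show ?case by (simp add: Ysuc) (simp add: \<Phi>_def)
  qed
  have Y_int: "(\<lambda>v. a v * Y n (\<beta> v)) integrable_on {s..t}" for n t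
    using Y[of n] by (intro delayed_product_integrable[OF assms, of s]) auto
  have bound: "\<bar>I\<bar> \<le> m / 2 * exp (2 * L * (t - s))"
    if L: "\<And>v. v \<in> {t0..b} \<Longrightarrow> \<bar>a v\<bar> \<le> L" and t: "t \<in> {s..b}" and "m \<ge> 0"
      and I: "((\<lambda>v. a v * z (\<beta> v)) has_integral I) {s..t}"
      and z: "\<And>u. u < s \<Longrightarrow> z u = 0" "\<And>u. u \<in> {s..b} \<Longrightarrow> \<bar>z u\<bar> \<le> m * exp (2 * L * (u - s))"
    for I m L t b z
  proof (rule exp_weighted_integral_bound[OF I])
    fix v assume v: "v \<in> {s..t}"
    have "L \<ge> 0" using L[of s] t assms by force
    have "\<bar>z (\<beta> v)\<bar> \<le> m * exp (2 * L * (v - s))"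
    proof (cases "\<beta> v < s")
      case True
      then show ?thesis using z(1) \<open>m \<ge> 0\<close> by simp
    next
      case False
      then have "\<bar>z (\<beta> v)\<bar> \<le> m * exp (2 * L * (\<beta> v - s))"
        using \<beta>_le[of v] v t assms by (intro z(2)) auto
      also have "\<dots> \<le> m * exp (2 * L * (v - s))"
        using \<beta>_le[of v] v t assms \<open>m \<ge> 0\<close> \<open>L \<ge> 0\<close> by (intro mult_left_mono) (auto intro: mult_left_mono)
      finally show ?thesis .
    qed
    then show "\<bar>a v * z (\<beta> v)\<bar> \<le> L * (m * exp (2 * L * (v - s)))"
      unfolding abs_mult using L[of v] v t assms \<open>L \<ge> 0\<close> by (intro mult_mono) auto
  qed (use that in auto)
  have diff: "\<bar>Y (Suc n) t - Y n t\<bar> \<le> (1 / 2) ^ n * exp (2 * L * (t - s))"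
    if L: "\<And>v. v \<in> {t0..b} \<Longrightarrow> \<bar>a v\<bar> \<le> L" and t: "t \<in> {s..b}" for n L t b
    using t
  proof (induction n arbitrary: t)
    case 0
    have "L \<ge> 0" using L[of s] 0 assms by force
    then show ?case using 0 by (simp add: Ysuc \<Phi>_def Y0)
  next
    case (Suc n)
    have "((\<lambda>v. a v * Y (Suc n) (\<beta> v) - a v * Y n (\<beta> v)) has_integral
        integral {s..t} (\<lambda>v. a v * Y (Suc n) (\<beta> v)) - integral {s..t} (\<lambda>v. a v * Y n (\<beta> v))) {s..t}"
      by (intro has_integral_diff integrable_integral Y_int)
    then have "((\<lambda>v. a v * (Y (Suc n) (\<beta> v) - Y n (\<beta> v))) has_integral - (Y (Suc (Suc n)) t - Y (Suc n) t)) {s..t}"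
      using Suc.prems unfolding Ysuc[of "Suc n"] by (subst Ysuc[of n]) (simp add: \<Phi>_def right_diff_distrib)
    from bound[OF L Suc.prems _ this, of "(1 / 2) ^ n"] Suc.IH Y show ?case
      by (auto simp: abs_minus_commute)
  qed
  \<comment> \<open>The constant 2 reproduces itself: \<open>1 + 2 / 2 * w \<le> 2 * w\<close> once
    the weight \<open>w\<close> is at least 1. Being uniform in \<open>n\<close>, the bound yields
    the dominating function.\<close>
  have bnd: "\<bar>Y n t\<bar> \<le> 2 * exp (2 * L * (t - s))"
    if L: "\<And>v. v \<in> {t0..b} \<Longrightarrow> \<bar>a v\<bar> \<le> L" and t: "t \<in> {s..b}" for n L t b
    using t
  proof (induction n arbitrary: t)
    case 0
    then show ?case by (simp add: Y0)
  next
    case (Suc n)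
    have "L \<ge> 0" using L[of s] Suc.prems assms by force
    then have "exp (2 * L * (t - s)) \<ge> 1" using Suc.prems by simp
    moreover have "\<bar>integral {s..t} (\<lambda>v. a v * Y n (\<beta> v))\<bar> \<le> 2 / 2 * exp (2 * L * (t - s))"
      using bound[OF L Suc.prems _ integrable_integral[OF Y_int], of 2 n] Suc.IH Y by auto
    ultimately have "\<bar>1 - integral {s..t} (\<lambda>v. a v * Y n (\<beta> v))\<bar> \<le> 2 * exp (2 * L * (t - s))" by linarith
    then show ?case using Suc.prems by (simp add: Ysuc \<Phi>_def)
  qed
  have conv: "\<exists>l. (\<lambda>n. Y n t) \<longlonglongrightarrow> l" for t
  proof (cases "t < s")
    case True
    then show ?thesis using Y by auto
  next
    case False
    obtain L where L: "\<And>v. v \<in> {t0..t} \<Longrightarrow> \<bar>a v\<bar> \<le> L"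
      using a_locally_bounded by metis
    have "summable (\<lambda>n. (1 / 2) ^ n * exp (2 * L * (t - s)))"
      by (intro summable_mult2 summable_geometric) auto
    then have "summable (\<lambda>n. Y (Suc n) t - Y n t)"
      by (rule summable_comparison_test'[of _ 0]) (use diff[OF L, of t] False in auto)
    then have "(\<lambda>n. \<Sum>k<n. Y (Suc k) t - Y k t) \<longlonglongrightarrow> (\<Sum>n. Y (Suc n) t - Y n t)"
      by (rule summable_LIMSEQ)
    then show ?thesis
      unfolding sum_lessThan_telescope[of "\<lambda>n. Y n t"] Y0 by auto
  qed
  define y where "y t = lim (\<lambda>n. Y n t)" for t
  have y: "(\<lambda>n. Y n t) \<longlonglongrightarrow> y t" for t
    using conv[of t] by (auto simp: y_def convergent_def convergent_LIMSEQ_iff[symmetric])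
  have y0: "y t = 0" if "t < s" for t
    using LIMSEQ_unique[OF y[of t]] Y that by auto
  have y_int: "((\<lambda>v. a v * y (\<beta> v)) has_integral 1 - y t) {s..t}" if "s \<le> t" for t
  proof -
    obtain L where L: "\<And>v. v \<in> {t0..t} \<Longrightarrow> \<bar>a v\<bar> \<le> L"
      using a_locally_bounded by metis
    have "L \<ge> 0" using L[of s] that assms by force
    show ?thesis
    proof (rule has_integral_dominated_convergence)
      show "((\<lambda>v. a v * Y n (\<beta> v)) has_integral 1 - Y (Suc n) t) {s..t}" for n
        using integrable_integral[OF Y_int[of n t]] that by (simp add: Ysuc \<Phi>_def)
      show "(\<lambda>_. L * (2 * exp (2 * L * (t - s)))) integrable_on {s..t}" by (rule integrable_const_ivl)
      show "\<forall>v\<in>{s..t}. norm (a v * Y n (\<beta> v)) \<le> L * (2 * exp (2 * L * (t - s)))" for n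
      proof
        fix v assume v: "v \<in> {s..t}"
        have "\<bar>Y n (\<beta> v)\<bar> \<le> 2 * exp (2 * L * (t - s))"
        proof (cases "\<beta> v < s")
          case False
          then have "\<bar>Y n (\<beta> v)\<bar> \<le> 2 * exp (2 * L * (\<beta> v - s))"
            using \<beta>_le[of v] v assms by (intro bnd[OF L]) auto
          also have "\<dots> \<le> 2 * exp (2 * L * (t - s))"
            using \<beta>_le[of v] v assms \<open>L \<ge> 0\<close> by (auto intro!: mult_left_mono)
          finally show ?thesis .
        qed (use Y in auto)
        then show "norm (a v * Y n (\<beta> v)) \<le> L * (2 * exp (2 * L * (t - s)))"
          unfolding real_norm_def abs_mult using L[of v] v assms \<open>L \<ge> 0\<close> by (intro mult_mono) auto
      qed
      show "\<forall>v\<in>{s..t}. (\<lambda>n. a v * Y n (\<beta> v)) \<longlonglongrightarrow> a v * y (\<beta> v)"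
        by (intro ballI tendsto_mult_left y)
      show "(\<lambda>n. 1 - Y (Suc n) t) \<longlonglongrightarrow> 1 - y t"
        by (intro tendsto_diff tendsto_const LIMSEQ_Suc y)
    qed
  qed
  have "(\<lambda>v. a v * y (\<beta> v)) integrable_on {s..t}" for t
    using y_int[of t] by (cases "s \<le> t") (auto simp: integrable_on_def)
  \<comment> \<open>The convergence was only pointwise; continuity of the limit comes from the
    integral equation that it satisfies.\<close>
  from cont_\<Phi>[OF this] have "continuous_on {s..} y"
    by (rule continuous_on_eq) (use integral_unique[OF y_int] in \<open>auto simp: \<Phi>_def\<close>)
  with y0 y_int have "fundamental s y" by (auto simp: fundamental_def)
  then show thesis by (rule that)
qed

lemma fundamental_at_start:
  assumes "fundamental s y"
  shows "y s = 1"
proof -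
  have "((\<lambda>v. a v * y (\<beta> v)) has_integral 1 - y s) {s..s}"
    using assms unfolding fundamental_def by blast
  from integral_unique[OF this] show ?thesis by simp
qed

text \<open>Before \<open>\<sigma>\<close> the delayed argument lies before \<open>\<sigma>\<close>
  too, so the integrand vanishes there and the unit jump at \<open>\<sigma>\<close> shows up as a
  step on the right-hand side. Fundamental solutions with different starting points can thus be
  added over one interval that begins at \<open>s\<close>.\<close>

lemma fundamental_from_earlier_base:
  assumes y: "fundamental \<sigma> y" and "t0 \<le> s" "s \<le> \<sigma>" "s \<le> t"
  shows "((\<lambda>v. a v * y (\<beta> v)) has_integral (if \<sigma> \<le> t then 1 else 0) - y t) {s..t}"
proof -
  \<comment> \<open>At \<open>v = \<sigma>\<close> the delayed argument may be
    \<open>\<sigma>\<close> itself, where \<open>y\<close> is 1; this single point is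
    discarded.\<close>
  have zero: "((\<lambda>v. a v * y (\<beta> v)) has_integral 0) {s..u}" if "u \<le> \<sigma>" for u
  proof (rule has_integral_spike[of "{\<sigma>}" _ _ "\<lambda>_. 0"])
    fix v assume v: "v \<in> {s..u} - {\<sigma>}"
    then have "\<beta> v < \<sigma>" using \<beta>_le[of v] assms that by auto
    then show "a v * y (\<beta> v) = 0" using y by (simp add: fundamental_def)
  qed auto
  show ?thesis
  proof (cases "\<sigma> \<le> t")
    case True
    then have "((\<lambda>v. a v * y (\<beta> v)) has_integral 0 + (1 - y t)) {s..t}"
      using y assms zero[of \<sigma>]
      by (intro Henstock_Kurzweil_Integration.has_integral_combine[of s \<sigma> t]) (auto simp: fundamental_def)
    then show ?thesis using True by simp
  next
    case False
    then show ?thesis using zero[of t] y by (simp add: fundamental_def)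
  qed
qed

text \<open>The forcing \<open>f\<close> on each piece of a mesh is replaced by an impulse at the first point of
  \<open>T\<close> after the piece, so that \<open>z\<close> is compared with a finite sum of fundamental solutions. This
  needs no measurability of \<open>Y \<sigma> b\<close> in \<open>\<sigma>\<close>, as the integral form of the variation of constants
  formula would.\<close>

lemma impulse_error_bound:
  fixes f z :: "real \<Rightarrow> real"
  assumes T: "closed T" "s \<in> T" "b \<in> T" and "t0 \<le> s" "s \<le> b"
    and Y: "\<And>\<sigma>. \<sigma> \<in> T \<inter> {s..b} \<Longrightarrow> fundamental \<sigma> (Y \<sigma>)"
    and M: "\<And>\<sigma>. \<sigma> \<in> T \<inter> {s..b} \<Longrightarrow> \<bar>Y \<sigma> b\<bar> \<le> M"
    and \<beta>T: "\<And>v. v \<in> {s..b} \<Longrightarrow> \<beta> v \<in> T"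
    and f: "f integrable_on {s..b}" "\<And>v. v \<in> {s..b} \<Longrightarrow> \<bar>f v\<bar> \<le> C"
    and z: "\<And>t. t < s \<Longrightarrow> z t = 0" "\<And>t. t \<in> T \<inter> {s..b} \<Longrightarrow> \<bar>z t\<bar> \<le> B"
      "\<And>t. t \<in> T \<inter> {s..b} \<Longrightarrow> ((\<lambda>v. a v * z (\<beta> v) - f v) has_integral z0 - z t) {s..t}"
    and L: "\<And>v. v \<in> {s..b} \<Longrightarrow> \<bar>a v\<bar> \<le> L"
    and "n > 0"
  shows "\<bar>z b\<bar> \<le> M * (\<bar>z0\<bar> + integral {s..b} (\<lambda>v. \<bar>f v\<bar>)) + 2 * (C * ((b - s) / real n)) * exp (2 * L * (b - s))"
proof -
  define \<delta> where "\<delta> = (b - s) / real n"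
  define u where "u k = s + real k * \<delta>" for k
  have \<delta>: "\<delta> \<ge> 0" using assms by (simp add: \<delta>_def)
  have u0: "u 0 = s" and un: "u n = b" using \<open>n > 0\<close> by (simp_all add: u_def \<delta>_def)
  have u_mono: "u i \<le> u j" if "i \<le> j" for i j
    using that \<delta> by (simp add: u_def mult_right_mono)
  have u_ge: "s \<le> u k" for k using u_mono[of 0 k] u0 by simp
  have u_le: "u k \<le> b" if "k \<le> n" for k using u_mono[OF that] un by simp
  \<comment> \<open>Mesh points need not belong to \<open>T\<close>. At times in \<open>T\<close>,
    an impulse at \<open>\<sigma> k\<close> is felt exactly from \<open>u (Suc k)\<close> on, and
    \<open>b \<in> T\<close> ensures \<open>\<sigma> k \<le> b\<close>.\<close>
  define \<sigma> where "\<sigma> k = Inf (T \<inter> {u (Suc k)..})" for k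
  have \<sigma>: "\<sigma> k \<in> T \<inter> {s..b}" "\<And>t. t \<in> T \<Longrightarrow> \<sigma> k \<le> t \<longleftrightarrow> u (Suc k) \<le> t" if "k < n" for k
  proof -
    have ne: "b \<in> T \<inter> {u (Suc k)..}" using T u_le[of "Suc k"] that by simp
    have bb: "bdd_below (T \<inter> {u (Suc k)..})" by (auto intro: bdd_belowI[of _ "u (Suc k)"])
    have in_T: "\<sigma> k \<in> T \<inter> {u (Suc k)..}"
      unfolding \<sigma>_def using ne bb T by (intro closed_contains_Inf closed_Int) auto
    moreover have "\<sigma> k \<le> b" unfolding \<sigma>_def by (rule cInf_lower[OF ne bb])
    ultimately show "\<sigma> k \<in> T \<inter> {s..b}" using u_ge[of "Suc k"] by auto
    show "\<sigma> k \<le> t \<longleftrightarrow> u (Suc k) \<le> t" if "t \<in> T" for t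
      using in_T cInf_lower[of t, OF _ bb] that by (auto simp: \<sigma>_def)
  qed
  define F where "F t = integral {s..t} f" for t
  define G where "G t = integral {s..t} (\<lambda>v. \<bar>f v\<bar>)" for t
  define c where "c k = F (u (Suc k)) - F (u k)" for k
  have f_int: "f integrable_on {x..y}" if "s \<le> x" "y \<le> b" for x y
    using integrable_on_subinterval[OF f(1)] that by auto
  have "f absolutely_integrable_on {s..b}"
    using f by (intro absolutely_integrable_integrable_bound[of _ f "\<lambda>_. C"] integrable_const_ivl) auto
  then have "(\<lambda>v. \<bar>f v\<bar>) integrable_on {s..b}"
    by (simp add: absolutely_integrable_on_def)
  then have abs_int: "(\<lambda>v. \<bar>f v\<bar>) integrable_on {x..y}" if "s \<le> x" "y \<le> b" for x y
    using integrable_on_subinterval that by (metis atLeastatMost_subset_iff)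
  have F_diff: "F y - F x = integral {x..y} f" and G_diff: "G y - G x = integral {x..y} (\<lambda>v. \<bar>f v\<bar>)"
    if "s \<le> x" "x \<le> y" "y \<le> b" for x y
    using Henstock_Kurzweil_Integration.integral_combine[of s x y f] f_int[of s y]
      Henstock_Kurzweil_Integration.integral_combine[of s x y "\<lambda>v. \<bar>f v\<bar>"] abs_int[of s y] that
    by (simp_all add: F_def G_def algebra_simps)
  have F_lip: "\<bar>F y - F x\<bar> \<le> C * (y - x)" if "s \<le> x" "x \<le> y" "y \<le> b" for x y
    unfolding F_diff[OF that] using that f f_int by (intro abs_integral_le_const) auto
  have F_G: "\<bar>F y - F x\<bar> \<le> G y - G x" if "s \<le> x" "x \<le> y" "y \<le> b" for x y
    unfolding F_diff[OF that] G_diff[OF that]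
    using Henstock_Kurzweil_Integration.integral_norm_bound_integral[OF f_int[of x y] abs_int[of x y]] that by simp
  have C: "C \<ge> 0" using f(2)[of s] \<open>s \<le> b\<close> by force
  \<comment> \<open>\<open>z0\<close> is the impulse at \<open>s\<close>, and \<open>c k\<close> is
    the whole forcing of one mesh piece, released at once at \<open>\<sigma> k\<close>.\<close>
  define W where "W t = z0 * Y s t + (\<Sum>k<n. c k * Y (\<sigma> k) t)" for t
  define e where "e t = z t - W t" for t
  \<comment> \<open>The forcing that has acted up to \<open>t\<close> but has not yet been released
    as an impulse; it is the only defect in the equation for \<open>e\<close>.\<close>
  define r where "r t = F t - (\<Sum>k<n. if u (Suc k) \<le> t then c k else 0)" for t
  have sT: "s \<in> T \<inter> {s..b}" using assms by simp
  have e_int: "((\<lambda>v. a v * e (\<beta> v)) has_integral r t - e t) {s..t}" if t: "t \<in> T \<inter> {s..b}" for t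
  proof -
    have f_t: "(f has_integral F t) {s..t}"
      unfolding F_def using f_int t by (intro integrable_integral) auto
    have Y_s: "((\<lambda>v. a v * Y s (\<beta> v)) has_integral (if s \<le> t then 1 else 0) - Y s t) {s..t}"
      using fundamental_from_earlier_base[OF Y[OF sT] \<open>t0 \<le> s\<close> order_refl] t by auto
    have Y_\<sigma>: "((\<lambda>v. a v * Y (\<sigma> k) (\<beta> v)) has_integral (if \<sigma> k \<le> t then 1 else 0) - Y (\<sigma> k) t) {s..t}"
      if "k \<in> {..<n}" for k
      using fundamental_from_earlier_base[OF Y[OF \<sigma>(1)] \<open>t0 \<le> s\<close>, of k t] \<sigma>(1)[of k] that t by auto
    have "((\<lambda>v. (\<Sum>k<n. c k * (a v * Y (\<sigma> k) (\<beta> v)))) has_integral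
        (\<Sum>k<n. c k * ((if \<sigma> k \<le> t then 1 else 0) - Y (\<sigma> k) t))) {s..t}"
      by (intro has_integral_sum has_integral_mult_right Y_\<sigma>) auto
    from has_integral_diff[OF has_integral_add[OF z(3)[OF t] f_t] has_integral_add[OF has_integral_mult_right[OF Y_s, of z0] this]]
    have "((\<lambda>v. (a v * z (\<beta> v) - f v) + f v - (z0 * (a v * Y s (\<beta> v)) + (\<Sum>k<n. c k * (a v * Y (\<sigma> k) (\<beta> v)))))
       has_integral (z0 - z t) + F t - (z0 * ((if s \<le> t then 1 else 0) - Y s t)
         + (\<Sum>k<n. c k * ((if \<sigma> k \<le> t then 1 else 0) - Y (\<sigma> k) t)))) {s..t}" .
    moreover have "(z0 - z t) + F t - (z0 * ((if s \<le> t then 1 else 0) - Y s t)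
         + (\<Sum>k<n. c k * ((if \<sigma> k \<le> t then 1 else 0) - Y (\<sigma> k) t))) = r t - e t"
    proof -
      have "(\<Sum>k<n. c k * ((if \<sigma> k \<le> t then 1 else 0) - Y (\<sigma> k) t))
          = (\<Sum>k<n. if u (Suc k) \<le> t then c k else 0) - (\<Sum>k<n. c k * Y (\<sigma> k) t)"
        unfolding sum_subtractf[symmetric] using \<sigma>(2) t by (intro sum.cong) (auto simp: right_diff_distrib)
      then show ?thesis using t by (simp only: e_def W_def r_def) (simp add: right_diff_distrib)
    qed
    moreover have "(\<lambda>v. (a v * z (\<beta> v) - f v) + f v - (z0 * (a v * Y s (\<beta> v)) + (\<Sum>k<n. c k * (a v * Y (\<sigma> k) (\<beta> v)))))
        = (\<lambda>v. a v * e (\<beta> v))"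
      by (simp add: fun_eq_iff e_def W_def right_diff_distrib distrib_left sum_distrib_left mult.left_commute)
    ultimately show ?thesis by (simp only:)
  qed
  have r_le: "\<bar>r t\<bar> \<le> C * \<delta>" if t: "t \<in> T \<inter> {s..b}" for t
  proof -
    \<comment> \<open>\<open>u K\<close> is the last mesh point not beyond \<open>t\<close>; the
      impulses released so far telescope to \<open>F (u K)\<close>, and \<open>t - u K\<close> is at
      most one mesh step.\<close>
    define K where "K = (GREATEST k. k \<le> n \<and> u k \<le> t)"
    have K: "K \<le> n \<and> u K \<le> t"
      unfolding K_def by (rule GreatestI_nat[of _ 0 n]) (use t u0 in auto)
    have K_max: "k \<le> K" if "k \<le> n" "u k \<le> t" for k
      unfolding K_def by (rule Greatest_le_nat[of _ k n]) (use that in auto)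
    have iff: "u (Suc k) \<le> t \<longleftrightarrow> k < K" if "k < n" for k
      using K_max[of "Suc k"] K u_mono[of "Suc k" K] that by auto
    have "(\<Sum>k<n. if u (Suc k) \<le> t then c k else 0) = (\<Sum>k<K. c k)"
      using K iff by (intro sum.mono_neutral_cong_right) auto
    also have "\<dots> = F (u K)"
      unfolding c_def by (subst sum_lessThan_telescope) (simp add: u0 F_def)
    finally have "\<bar>r t\<bar> = \<bar>F t - F (u K)\<bar>" by (simp add: r_def)
    also have "\<dots> \<le> C * (t - u K)" using K t u_ge by (intro F_lip) auto
    also have "\<dots> \<le> C * \<delta>"
    proof (intro mult_left_mono C)
      show "t - u K \<le> \<delta>"
      proof (cases "K = n")
        case True
        then show ?thesis using t un \<delta> by simp
      next
        case False
        then have "t < u (Suc K)" using K_max[of "Suc K"] K by (cases "u (Suc K) \<le> t") auto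
        then show ?thesis by (simp add: u_def algebra_simps)
      qed
    qed
    finally show ?thesis .
  qed
  have "\<forall>\<sigma>\<in>T \<inter> {s..b}. \<exists>D. \<forall>t\<le>b. \<bar>Y \<sigma> t\<bar> \<le> D"
    using truncated_bounded Y unfolding fundamental_def by metis
  then obtain D where D: "\<And>\<sigma> t. \<sigma> \<in> T \<inter> {s..b} \<Longrightarrow> t \<le> b \<Longrightarrow> \<bar>Y \<sigma> t\<bar> \<le> D \<sigma>"
    by metis
  \<comment> \<open>Any bound that is finite for the given mesh will do, since the Gronwall estimate
    does not depend on its size.\<close>
  have e_bd: "\<bar>e t\<bar> \<le> B + (\<bar>z0\<bar> * D s + (\<Sum>k<n. \<bar>c k\<bar> * D (\<sigma> k)))" if t: "t \<in> T \<inter> {s..b}" for t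
  proof -
    have "\<bar>W t\<bar> \<le> \<bar>z0 * Y s t\<bar> + (\<Sum>k<n. \<bar>c k * Y (\<sigma> k) t\<bar>)"
      unfolding W_def by (rule order_trans[OF abs_triangle_ineq]) (simp add: sum_abs)
    also have "\<dots> \<le> \<bar>z0\<bar> * D s + (\<Sum>k<n. \<bar>c k\<bar> * D (\<sigma> k))"
      unfolding abs_mult using D sT \<sigma>(1) t by (intro add_mono sum_mono mult_left_mono) auto
    finally show ?thesis using z(2)[OF t] by (auto simp: e_def)
  qed
  have e_zero: "e t = 0" if "t < s" for t
  proof -
    have "Y (\<sigma> k) t = 0" if "k < n" for k
      using Y[OF \<sigma>(1)[OF that]] \<sigma>(1)[OF that] \<open>t < s\<close> by (auto simp: fundamental_def)
    then show ?thesis using z(1)[OF that] Y[OF sT] that by (simp add: e_def W_def fundamental_def)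
  qed
  have "\<bar>e b\<bar> \<le> 2 * (C * \<delta>) * exp (2 * L * (b - s))"
  proof (rule delay_gronwall[OF L, where \<beta> = \<beta> and T = T and I = "\<lambda>t. r t - e t"
        and B = "B + (\<bar>z0\<bar> * D s + (\<Sum>k<n. \<bar>c k\<bar> * D (\<sigma> k)))"])
    show "\<bar>e t\<bar> \<le> C * \<delta> + \<bar>r t - e t\<bar>" if "t \<in> T \<inter> {s..b}" for t
      using r_le[OF that] by linarith
  qed (use assms e_int e_bd e_zero \<beta>_le \<beta>T C \<delta> in auto)
  \<comment> \<open>Each weight is at most an increment of \<open>G\<close>, and these increments
    telescope, so the total weight does not depend on the mesh.\<close>
  moreover have "\<bar>W b\<bar> \<le> M * (\<bar>z0\<bar> + G b)"
  proof -
    have "M \<ge> 0" using M[OF sT] by linarith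
    have "\<bar>W b\<bar> \<le> \<bar>z0 * Y s b\<bar> + (\<Sum>k<n. \<bar>c k * Y (\<sigma> k) b\<bar>)"
      unfolding W_def by (rule order_trans[OF abs_triangle_ineq]) (simp add: sum_abs)
    also have "\<dots> \<le> \<bar>z0\<bar> * M + (\<Sum>k<n. (G (u (Suc k)) - G (u k)) * M)"
      unfolding abs_mult
    proof (intro add_mono sum_mono mult_mono M sT \<sigma>)
      show "\<bar>c k\<bar> \<le> G (u (Suc k)) - G (u k)" if "k \<in> {..<n}" for k
        unfolding c_def using that u_ge u_mono u_le by (intro F_G) auto
      then show "0 \<le> G (u (Suc k)) - G (u k)" if "k \<in> {..<n}" for k
        using that by (metis abs_ge_zero order_trans)
    qed (use \<open>M \<ge> 0\<close> in auto)
    also have "(\<Sum>k<n. (G (u (Suc k)) - G (u k)) * M) = (G (u n) - G (u 0)) * M"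
      unfolding sum_distrib_right[symmetric] by (subst sum_lessThan_telescope) simp
    also have "G (u 0) = 0" by (simp add: u0 G_def)
    finally show ?thesis by (simp add: un algebra_simps)
  qed
  ultimately show ?thesis
    unfolding e_def G_def \<delta>_def by linarith
qed

text \<open>The error of the impulse approximation is of order \<open>1 / n\<close>, while its main
  term is the same for every mesh. Each impulse contributes to \<open>z b\<close> through the value
  of its fundamental solution at \<open>b\<close>, so \<open>M\<close> has to bound these values for
  all starting points.\<close>

lemma variation_of_constants_bound:
  fixes f z :: "real \<Rightarrow> real"
  assumes T: "closed T" "s \<in> T" "b \<in> T" and "t0 \<le> s" "s \<le> b"
    and Y: "\<And>\<sigma>. \<sigma> \<in> T \<inter> {s..b} \<Longrightarrow> fundamental \<sigma> (Y \<sigma>)"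
    and M: "\<And>\<sigma>. \<sigma> \<in> T \<inter> {s..b} \<Longrightarrow> \<bar>Y \<sigma> b\<bar> \<le> M"
    and \<beta>T: "\<And>v. v \<in> {s..b} \<Longrightarrow> \<beta> v \<in> T"
    and f: "f integrable_on {s..b}" "\<And>v. v \<in> {s..b} \<Longrightarrow> \<bar>f v\<bar> \<le> C"
    and z: "\<And>t. t < s \<Longrightarrow> z t = 0" "\<And>t. t \<in> T \<inter> {s..b} \<Longrightarrow> \<bar>z t\<bar> \<le> B"
      "\<And>t. t \<in> T \<inter> {s..b} \<Longrightarrow> ((\<lambda>v. a v * z (\<beta> v) - f v) has_integral z0 - z t) {s..t}"
  shows "\<bar>z b\<bar> \<le> M * (\<bar>z0\<bar> + integral {s..b} (\<lambda>v. \<bar>f v\<bar>))"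
proof -
  obtain L where "\<And>v. v \<in> {t0..b} \<Longrightarrow> \<bar>a v\<bar> \<le> L" using a_locally_bounded by metis
  then have L: "\<And>v. v \<in> {s..b} \<Longrightarrow> \<bar>a v\<bar> \<le> L" using \<open>t0 \<le> s\<close> by auto
  let ?R = "M * (\<bar>z0\<bar> + integral {s..b} (\<lambda>v. \<bar>f v\<bar>))"
  have "(\<lambda>n. ?R + 2 * (C * ((b - s) / real n)) * exp (2 * L * (b - s))) \<longlonglongrightarrow> ?R + 2 * (C * 0) * exp (2 * L * (b - s))"
    by (intro tendsto_intros lim_const_over_n)
  then have "\<bar>z b\<bar> \<le> ?R + 2 * (C * 0) * exp (2 * L * (b - s))"
    by (rule LIMSEQ_le_const)
      (use impulse_error_bound[OF T \<open>t0 \<le> s\<close> \<open>s \<le> b\<close> Y M \<beta>T f z L] in \<open>auto intro!: exI[of _ 1]\<close>)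
  then show ?thesis by simp
qed

end

section \<open>Time scales\<close>

text \<open>On each side of \<open>t\<close> there is either a one-sided limit or a gap of
  \<open>S\<close>; the value at \<open>t\<close> itself is added to the bound, as it may differ
  from the left limit.\<close>

lemma rd_continuous_locally_bounded_at:
  assumes rd: "rd_continuous_on S g" and t: "t \<in> S"
  obtains U L where "open U" "t \<in> U" "\<And>r. r \<in> U \<inter> S \<Longrightarrow> \<bar>g r\<bar> \<le> L"
proof -
  have ev: "\<forall>\<^sub>F r in F. \<bar>g r\<bar> \<le> \<bar>l\<bar> + 1" if "(g \<longlongrightarrow> l) F" for l F
  proof -
    have "\<forall>\<^sub>F r in F. dist (g r) l < 1" using that by (rule tendstoD) simp
    then show ?thesis by eventually_elim (simp add: dist_real_def)
  qed
  have right: "\<exists>l. \<forall>\<^sub>F r in at t within S \<inter> {t<..}. \<bar>g r\<bar> \<le> l"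
  proof (cases "right_dense S t")
    case True
    then have "(g \<longlongrightarrow> g t) (at t within S)"
      using rd by (auto simp: rd_continuous_on_def continuous_within)
    then have "(g \<longlongrightarrow> g t) (at t within S \<inter> {t<..})"
      by (rule tendsto_within_subset) auto
    from ev[OF this] show ?thesis ..
  next
    case False
    have "\<exists>q>t. S \<inter> {t<..<q} = {}"
    proof (cases "S \<inter> {t<..} = {}")
      case True
      then show ?thesis by (intro exI[of _ "t + 1"]) auto
    next
      case ne: False
      then have "fwd_jump S t \<noteq> t" using False t by (auto simp: right_dense_def graininess_def)
      moreover have J: "fwd_jump S t = Inf (S \<inter> {t<..})" using ne by (simp add: fwd_jump_def)
      moreover have "t \<le> Inf (S \<inter> {t<..})" using ne by (intro cInf_greatest) auto
      moreover have "Inf (S \<inter> {t<..}) \<le> r" if "r \<in> S" "r > t" for r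
        using that by (intro cInf_lower) (auto intro!: bdd_belowI[of _ t])
      ultimately show ?thesis by (intro exI[of _ "fwd_jump S t"]) force
    qed
    then obtain q where q: "q > t" "S \<inter> {t<..<q} = {}" by blast
    have "\<forall>\<^sub>F r in at t within S \<inter> {t<..}. r < q"
      using q(1) order_tendstoD(2)[OF tendsto_ident_at] by blast
    moreover have "\<forall>\<^sub>F r in at t within S \<inter> {t<..}. r \<in> S \<inter> {t<..}"
      by (auto simp: eventually_at_filter)
    ultimately have "\<forall>\<^sub>F r in at t within S \<inter> {t<..}. \<bar>g r\<bar> \<le> 0"
      by eventually_elim (use q(2) in auto)
    then show ?thesis ..
  qed
  have left: "\<exists>l. \<forall>\<^sub>F r in at t within S \<inter> {..<t}. \<bar>g r\<bar> \<le> l"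
  proof (cases "left_dense S t")
    case True
    then obtain l where "(g \<longlongrightarrow> l) (at t within S \<inter> {..<t})"
      using rd by (auto simp: rd_continuous_on_def)
    from ev[OF this] show ?thesis ..
  next
    case False
    have "\<exists>q<t. S \<inter> {q<..<t} = {}"
    proof (cases "S \<inter> {..<t} = {}")
      case True
      then show ?thesis by (intro exI[of _ "t - 1"]) auto
    next
      case ne: False
      then have "bwd_jump S t \<noteq> t" using False t by (auto simp: left_dense_def)
      moreover have J: "bwd_jump S t = Sup (S \<inter> {..<t})" using ne by (simp add: bwd_jump_def)
      moreover have "Sup (S \<inter> {..<t}) \<le> t" using ne by (intro cSup_least) auto
      moreover have "r \<le> Sup (S \<inter> {..<t})" if "r \<in> S" "r < t" for r
        using that by (intro cSup_upper) (auto intro!: bdd_aboveI[of _ t])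
      ultimately show ?thesis by (intro exI[of _ "bwd_jump S t"]) force
    qed
    then obtain q where q: "q < t" "S \<inter> {q<..<t} = {}" by blast
    have "\<forall>\<^sub>F r in at t within S \<inter> {..<t}. q < r"
      using q(1) order_tendstoD(1)[OF tendsto_ident_at] by blast
    moreover have "\<forall>\<^sub>F r in at t within S \<inter> {..<t}. r \<in> S \<inter> {..<t}"
      by (auto simp: eventually_at_filter)
    ultimately have "\<forall>\<^sub>F r in at t within S \<inter> {..<t}. \<bar>g r\<bar> \<le> 0"
      by eventually_elim (use q(2) in auto)
    then show ?thesis ..
  qed
  obtain l1 l2 where l: "\<forall>\<^sub>F r in at t within S \<inter> {t<..}. \<bar>g r\<bar> \<le> l1" "\<forall>\<^sub>F r in at t within S \<inter> {..<t}. \<bar>g r\<bar> \<le> l2"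
    using left right by blast
  obtain U1 where U1: "open U1" "t \<in> U1" "\<And>r. r \<in> U1 \<Longrightarrow> r \<noteq> t \<Longrightarrow> r \<in> S \<inter> {t<..} \<Longrightarrow> \<bar>g r\<bar> \<le> l1"
    using l(1) unfolding eventually_at_topological by blast
  obtain U2 where U2: "open U2" "t \<in> U2" "\<And>r. r \<in> U2 \<Longrightarrow> r \<noteq> t \<Longrightarrow> r \<in> S \<inter> {..<t} \<Longrightarrow> \<bar>g r\<bar> \<le> l2"
    using l(2) unfolding eventually_at_topological by blast
  show thesis
  proof (rule that[of "U1 \<inter> U2" "max (max l1 l2) \<bar>g t\<bar>"])
    show "\<bar>g r\<bar> \<le> max (max l1 l2) \<bar>g t\<bar>" if "r \<in> (U1 \<inter> U2) \<inter> S" for r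
      using U1(3)[of r] U2(3)[of r] that by (cases r t rule: linorder_cases) (auto simp: le_max_iff_disj)
  qed (use U1 U2 in auto)
qed

lemma rd_continuous_bounded_on_compact:
  assumes rd: "rd_continuous_on S g" and "compact K" "K \<subseteq> S"
  obtains L where "\<And>t. t \<in> K \<Longrightarrow> \<bar>g t\<bar> \<le> L"
proof -
  have "\<forall>t\<in>K. \<exists>U L. open U \<and> t \<in> U \<and> (\<forall>r\<in>U \<inter> S. \<bar>g r\<bar> \<le> L)"
    using rd_continuous_locally_bounded_at[OF rd] \<open>K \<subseteq> S\<close> by (metis subsetD)
  then obtain U L where U: "\<And>t. t \<in> K \<Longrightarrow> open (U t) \<and> t \<in> U t \<and> (\<forall>r\<in>U t \<inter> S. \<bar>g r\<bar> \<le> L t)"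
    by metis
  obtain C where C: "C \<subseteq> K" "finite C" "K \<subseteq> (\<Union>c\<in>C. U c)"
    using compactE_image[OF \<open>compact K\<close>, of K U] U by blast
  show thesis
  proof (rule that[of "\<Sum>c\<in>C. \<bar>L c\<bar>"])
    fix t assume t: "t \<in> K"
    then obtain c where c: "c \<in> C" "t \<in> U c" using C by blast
    then have "\<bar>g t\<bar> \<le> L c" using U[of c] C(1) t \<open>K \<subseteq> S\<close> by auto
    then have "\<bar>g t\<bar> \<le> \<bar>L c\<bar>" by linarith
    also have "\<dots> \<le> (\<Sum>c\<in>C. \<bar>L c\<bar>)" using C(2) c(1) by (intro member_le_sum) auto
    finally show "\<bar>g t\<bar> \<le> (\<Sum>c\<in>C. \<bar>L c\<bar>)" .
  qed
qed

section \<open>Linearity of the delta-derivative\<close>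

lemma has_delta_derivative_cong:
  assumes "\<And>t. t \<in> S \<Longrightarrow> x t = y t" "fwd_jump S t \<in> S"
  shows "has_delta_derivative S x d t \<longleftrightarrow> has_delta_derivative S y d t"
  using assms unfolding has_delta_derivative_def by (metis IntE)

lemma has_delta_derivative_diff:
  assumes "has_delta_derivative S F d t" "has_delta_derivative S G e t"
  shows "has_delta_derivative S (\<lambda>t. F t - G t) (d - e) t"
  unfolding has_delta_derivative_def
proof (intro allI impI)
  fix \<epsilon> :: real assume "\<epsilon> > 0"
  then have "\<epsilon> / 2 > 0" by simp
  obtain U where U: "open U" "t \<in> U" "\<forall>r\<in>U \<inter> S. \<bar>F (fwd_jump S t) - F r - d * (fwd_jump S t - r)\<bar> \<le> \<epsilon> / 2 * \<bar>fwd_jump S t - r\<bar>"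
    using assms(1) \<open>\<epsilon> / 2 > 0\<close> unfolding has_delta_derivative_def by blast
  obtain V where V: "open V" "t \<in> V" "\<forall>r\<in>V \<inter> S. \<bar>G (fwd_jump S t) - G r - e * (fwd_jump S t - r)\<bar> \<le> \<epsilon> / 2 * \<bar>fwd_jump S t - r\<bar>"
    using assms(2) \<open>\<epsilon> / 2 > 0\<close> unfolding has_delta_derivative_def by blast
  show "\<exists>U. open U \<and> t \<in> U \<and> (\<forall>r\<in>U \<inter> S. \<bar>F (fwd_jump S t) - G (fwd_jump S t) - (F r - G r) - (d - e) * (fwd_jump S t - r)\<bar> \<le> \<epsilon> * \<bar>fwd_jump S t - r\<bar>)"
  proof (intro exI[of _ "U \<inter> V"] conjI ballI)
    fix r assume r: "r \<in> U \<inter> V \<inter> S"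
    then have "\<bar>F (fwd_jump S t) - F r - d * (fwd_jump S t - r)\<bar> \<le> \<epsilon> / 2 * \<bar>fwd_jump S t - r\<bar>"
      "\<bar>G (fwd_jump S t) - G r - e * (fwd_jump S t - r)\<bar> \<le> \<epsilon> / 2 * \<bar>fwd_jump S t - r\<bar>"
      using U(3) V(3) by blast+
    then show "\<bar>F (fwd_jump S t) - G (fwd_jump S t) - (F r - G r) - (d - e) * (fwd_jump S t - r)\<bar> \<le> \<epsilon> * \<bar>fwd_jump S t - r\<bar>"
      unfolding left_diff_distrib by (simp only: abs_le_iff) linarith
  qed (use U V in auto)
qed

lemma has_delta_derivative_cmult:
  assumes "has_delta_derivative S x d t"
  shows "has_delta_derivative S (\<lambda>t. c * x t) (c * d) t"
  unfolding has_delta_derivative_def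
proof (intro allI impI)
  fix e :: real assume "e > 0"
  then have "e / (\<bar>c\<bar> + 1) > 0" by (simp add: add_nonneg_pos)
  then obtain U where U: "open U" "t \<in> U"
    "\<forall>r\<in>U \<inter> S. \<bar>x (fwd_jump S t) - x r - d * (fwd_jump S t - r)\<bar> \<le> e / (\<bar>c\<bar> + 1) * \<bar>fwd_jump S t - r\<bar>"
    using assms unfolding has_delta_derivative_def by blast
  show "\<exists>U. open U \<and> t \<in> U \<and>
      (\<forall>r\<in>U \<inter> S. \<bar>c * x (fwd_jump S t) - c * x r - c * d * (fwd_jump S t - r)\<bar> \<le> e * \<bar>fwd_jump S t - r\<bar>)"
  proof (intro exI[of _ U] conjI ballI U)
    fix r assume r: "r \<in> U \<inter> S"
    have "\<bar>c * x (fwd_jump S t) - c * x r - c * d * (fwd_jump S t - r)\<bar>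
        = \<bar>c\<bar> * \<bar>x (fwd_jump S t) - x r - d * (fwd_jump S t - r)\<bar>"
      by (simp add: abs_mult[symmetric] algebra_simps)
    also have "\<dots> \<le> (\<bar>c\<bar> + 1) * (e / (\<bar>c\<bar> + 1) * \<bar>fwd_jump S t - r\<bar>)"
      using U(3) r by (intro mult_mono) auto
    also have "\<dots> = e * \<bar>fwd_jump S t - r\<bar>" by (simp add: add_nonneg_eq_0_iff)
    finally show "\<bar>c * x (fwd_jump S t) - c * x r - c * d * (fwd_jump S t - r)\<bar> \<le> e * \<bar>fwd_jump S t - r\<bar>" .
  qed
qed

section \<open>Jump and floor functions of a time scale unbounded above\<close>

locale unbounded_time_scale =
  fixes T :: "real set" and t0 :: real
  assumes T_closed: "closed T" and T_unbounded: "\<not> bdd_above T" and t0_in: "t0 \<in> T"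
begin

abbreviation \<sigma> :: "real \<Rightarrow> real" where "\<sigma> \<equiv> fwd_jump T"

text \<open>The last point of \<open>T\<close> at or before \<open>v\<close>. Taking
  \<open>max t0 v\<close> sends all \<open>v < t0\<close> to \<open>t0\<close>, so the function is
  total, monotone and has values in \<open>T \<inter> {t0..}\<close>.\<close>

definition ts_floor :: "real \<Rightarrow> real" where "ts_floor v = Sup (T \<inter> {t0..max t0 v})"

lemma above_nonempty: "T \<inter> {t<..} \<noteq> {}"
  using T_unbounded unfolding bdd_above_def by (auto simp: not_le)

lemma \<sigma>_eq_Inf: "\<sigma> t = Inf (T \<inter> {t<..})"
  using above_nonempty by (simp add: fwd_jump_def)

lemma bdd_below_above: "bdd_below (T \<inter> {t<..})"
  by (auto intro: bdd_belowI[of _ t])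

lemma \<sigma>_ge: "t \<le> \<sigma> t"
  unfolding \<sigma>_eq_Inf using above_nonempty by (intro cInf_greatest) auto

lemma \<sigma>_le: "r \<in> T \<Longrightarrow> t < r \<Longrightarrow> \<sigma> t \<le> r"
  unfolding \<sigma>_eq_Inf by (intro cInf_lower bdd_below_above) auto

lemma \<sigma>_in: "\<sigma> t \<in> T"
proof -
  have "\<sigma> t \<in> closure (T \<inter> {t<..})"
    unfolding \<sigma>_eq_Inf by (intro closure_contains_Inf above_nonempty bdd_below_above)
  also have "\<dots> \<subseteq> T" using T_closed by (intro closure_minimal) auto
  finally show ?thesis .
qed

lemma \<sigma>_mono: "u \<le> v \<Longrightarrow> \<sigma> u \<le> \<sigma> v"
  unfolding \<sigma>_eq_Inf by (intro cInf_superset_mono above_nonempty bdd_below_above) auto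

lemma \<sigma>_less_witness: "\<sigma> t < c \<Longrightarrow> \<exists>r\<in>T. t < r \<and> r < c"
  unfolding \<sigma>_eq_Inf using cInf_lessD[OF above_nonempty] by auto

lemma fwd_jump_restrict: "c \<le> t \<Longrightarrow> fwd_jump (T \<inter> {c..}) t = \<sigma> t"
proof -
  assume "c \<le> t"
  then have "(T \<inter> {c..}) \<inter> {t<..} = T \<inter> {t<..}" by auto
  then show ?thesis by (simp add: fwd_jump_def)
qed

lemma right_dense_restrict:
  "right_dense (T \<inter> {c..}) t \<longleftrightarrow> t \<in> T \<and> c \<le> t \<and> \<sigma> t = t"
proof (cases "c \<le> t")
  case True
  then have "(T \<inter> {c..}) \<inter> {t<..} = T \<inter> {t<..}" by auto
  then show ?thesis using True above_nonempty[of t]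
    by (simp add: right_dense_def graininess_def fwd_jump_restrict)
qed (simp add: right_dense_def)

lemma floor_bdd: "bdd_above (T \<inter> {t0..max t0 v})"
  by (auto intro: bdd_aboveI[of _ "max t0 v"])

lemma floor_in: "ts_floor v \<in> T" and floor_ge: "t0 \<le> ts_floor v" and floor_le_max: "ts_floor v \<le> max t0 v"
proof -
  have "ts_floor v \<in> T \<inter> {t0..max t0 v}"
    unfolding ts_floor_def using t0_in T_closed
    by (intro closed_contains_Sup floor_bdd closed_Int) auto
  then show "ts_floor v \<in> T" "t0 \<le> ts_floor v" "ts_floor v \<le> max t0 v" by auto
qed

lemma floor_le: "t0 \<le> v \<Longrightarrow> ts_floor v \<le> v"
  using floor_le_max[of v] by simp

lemma floor_greatest: "r \<in> T \<Longrightarrow> t0 \<le> r \<Longrightarrow> r \<le> v \<Longrightarrow> r \<le> ts_floor v"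
  unfolding ts_floor_def by (intro cSup_upper floor_bdd) auto

lemma floor_id: "v \<in> T \<Longrightarrow> t0 \<le> v \<Longrightarrow> ts_floor v = v"
  using floor_greatest[of v v] floor_le[of v] by simp

lemma floor_mono: "u \<le> v \<Longrightarrow> ts_floor u \<le> ts_floor v"
  unfolding ts_floor_def using t0_in by (intro cSup_subset_mono floor_bdd) auto

lemma floor_gap: "v \<in> T \<Longrightarrow> t0 \<le> v \<Longrightarrow> v \<le> w \<Longrightarrow> w < \<sigma> v \<Longrightarrow> ts_floor w = v"
  using floor_greatest[of v w] floor_in[of w] \<sigma>_le[of "ts_floor w" v] floor_le[of w] by force

lemma not_in_gap: "t0 \<le> v \<Longrightarrow> v \<notin> T \<Longrightarrow> ts_floor v < v \<and> v < \<sigma> (ts_floor v)"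
proof -
  assume v: "t0 \<le> v" "v \<notin> T"
  have lt: "ts_floor v < v" using floor_le[OF v(1)] floor_in[of v] v(2) by (metis order_le_less)
  have "v < \<sigma> (ts_floor v)"
  proof (rule ccontr)
    assume "\<not> v < \<sigma> (ts_floor v)"
    then have "\<sigma> (ts_floor v) < v" using \<sigma>_in[of "ts_floor v"] v(2) by (metis linorder_neqE)
    then obtain r where "r \<in> T" "ts_floor v < r" "r < v" using \<sigma>_less_witness by blast
    then show False using floor_greatest[of r v] floor_ge[of v] by auto
  qed
  with lt show ?thesis by blast
qed

text \<open>A point of \<open>T\<close> beyond \<open>t0\<close> outside this countable set is both left-dense and right-dense.\<close>

definition irregular :: "real set" where
  "irregular = insert t0 ({v. \<not> isCont ts_floor v} \<union> {v. \<not> isCont \<sigma> v})"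

lemma countable_irregular: "countable irregular"
  unfolding irregular_def
  by (intro countable_insert countable_Un mono_ctble_discont) (auto simp: mono_def floor_mono \<sigma>_mono)

text \<open>One-sided isolation shows as a jump of a monotone function: left of \<open>v\<close> one
  has \<open>\<sigma> w \<le> v\<close>, so continuity of \<open>\<sigma>\<close> forces
  \<open>\<sigma> v = v\<close>; continuity of \<open>ts_floor\<close> forces floors of points left
  of \<open>v\<close> to approach \<open>v\<close>.\<close>

lemma regular_dense:
  assumes "v \<in> T" "t0 < v" "v \<notin> irregular"
  shows "\<sigma> v = v" and "\<epsilon> > 0 \<Longrightarrow> \<exists>r\<in>T. t0 \<le> r \<and> v - \<epsilon> < r \<and> r < v"
proof -
  have cont: "isCont ts_floor v" "isCont \<sigma> v" using assms by (auto simp: irregular_def)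
  have "eventually (\<lambda>w. w < v) (at_left v)" by (simp add: eventually_at_filter)
  then have "eventually (\<lambda>w. \<sigma> w \<le> v) (at_left v)"
    by eventually_elim (use \<sigma>_le assms in auto)
  moreover have "(\<sigma> \<longlongrightarrow> \<sigma> v) (at_left v)"
    using cont(2) by (auto simp: isCont_def intro: tendsto_within_subset)
  ultimately have "\<sigma> v \<le> v" by (intro tendsto_upperbound) auto
  then show "\<sigma> v = v" using \<sigma>_ge[of v] by simp
  show "\<exists>r\<in>T. t0 \<le> r \<and> v - \<epsilon> < r \<and> r < v" if "\<epsilon> > 0"
  proof -
    have "(ts_floor \<longlongrightarrow> v) (at_left v)"
      using cont(1) floor_id[of v] assms by (auto simp: isCont_def intro: tendsto_within_subset)
    then have "eventually (\<lambda>w. v - \<epsilon> < ts_floor w) (at_left v)"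
      using that by (intro order_tendstoD(1)) auto
    moreover have "eventually (\<lambda>w. t0 < w \<and> w < v) (at_left v)"
      using eventually_at_left_real[OF assms(2)] by eventually_elim auto
    ultimately have "eventually (\<lambda>w. v - \<epsilon> < ts_floor w \<and> t0 < w \<and> w < v) (at_left v)"
      by eventually_elim auto
    then obtain w where "v - \<epsilon> < ts_floor w" "t0 < w" "w < v"
      using eventually_happens[of _ "at_left v"] by auto
    then show ?thesis using floor_in[of w] floor_ge[of w] floor_le[of w] by (intro bexI[of _ "ts_floor w"]) auto
  qed
qed

lemma floor_locally_constant:
  assumes "t0 < v" "v \<notin> T"
  shows "\<forall>\<^sub>F w in nhds v. ts_floor w = ts_floor v"
proof (rule eventually_nhds_in_open[of "{ts_floor v<..<\<sigma> (ts_floor v)}", THEN eventually_mono])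
  show "v \<in> {ts_floor v<..<\<sigma> (ts_floor v)}" using not_in_gap[of v] assms by auto
  fix w assume "w \<in> {ts_floor v<..<\<sigma> (ts_floor v)}"
  then show "ts_floor w = ts_floor v" using floor_in floor_ge by (intro floor_gap) auto
qed simp

text \<open>Off the countable set \<open>irregular\<close> the composition is continuous: it is
  locally constant before \<open>t0\<close> and inside gaps, and every other point is right-dense,
  where rd-continuity is full continuity within the time scale.\<close>

lemma borel_measurable_comp_floor:
  assumes rd: "rd_continuous_on (T \<inter> {t0..}) g"
  shows "(\<lambda>v. g (ts_floor v)) \<in> borel_measurable borel"
proof (rule borel_measurable_continuous_countable_exceptions[OF countable_irregular])
  show "continuous_on (- irregular) (\<lambda>v. g (ts_floor v))"
  proof (intro continuous_at_imp_continuous_on ballI)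
    fix v assume v: "v \<in> - irregular"
    then have "v \<noteq> t0" by (auto simp: irregular_def)
    then consider "v < t0" | "t0 < v" "v \<notin> T" | "t0 < v" "v \<in> T" by linarith
    then show "isCont (\<lambda>v. g (ts_floor v)) v"
    proof cases
      case 1
      have "\<forall>\<^sub>F w in nhds v. g (ts_floor w) = g t0"
      proof (rule eventually_nhds_in_open[of "{..<t0}", THEN eventually_mono])
        fix w assume "w \<in> {..<t0}"
        then show "g (ts_floor w) = g t0" using floor_ge[of w] floor_le_max[of w] by (simp add: max_def)
      qed (use 1 in auto)
      then show ?thesis by (simp add: isCont_cong)
    next
      case 2
      then have "\<forall>\<^sub>F w in nhds v. g (ts_floor w) = g (ts_floor v)"
        using floor_locally_constant[of v] by (auto elim: eventually_mono)
      then show ?thesis by (simp add: isCont_cong)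
    next
      case 3
      have "right_dense (T \<inter> {t0..}) v"
        using regular_dense(1)[of v] 3 v by (simp add: right_dense_restrict)
      then have "continuous (at v within T \<inter> {t0..}) g"
        using rd by (simp add: rd_continuous_on_def)
      then have "continuous (at (ts_floor v) within range ts_floor) g"
        using 3 floor_id[of v] floor_in floor_ge by (auto intro: continuous_within_subset)
      moreover have "isCont ts_floor v" using v by (auto simp: irregular_def)
      ultimately show ?thesis
        using continuous_within_compose[of v UNIV ts_floor g] by (simp add: o_def)
    qed
  qed
qed

lemma rd_continuous_bounded:
  assumes "rd_continuous_on (T \<inter> {t0..}) g"
  obtains L where "\<And>t. t \<in> T \<Longrightarrow> t0 \<le> t \<Longrightarrow> t \<le> b \<Longrightarrow> \<bar>g t\<bar> \<le> L"
proof -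
  have "compact (T \<inter> {t0..b})" by (intro closed_Int_compact T_closed compact_Icc)
  moreover have "T \<inter> {t0..b} \<subseteq> T \<inter> {t0..}" by auto
  ultimately have "\<exists>L. \<forall>t\<in>T \<inter> {t0..b}. \<bar>g t\<bar> \<le> L"
    by (metis rd_continuous_bounded_on_compact[OF assms])
  then obtain L where "\<And>t. t \<in> T \<inter> {t0..b} \<Longrightarrow> \<bar>g t\<bar> \<le> L" by blast
  then show thesis by (intro that[of L]) auto
qed

text \<open>Take \<open>r = t\<close> in the definition and let \<open>\<epsilon>\<close> tend to 0.
  At a right-dense \<open>t\<close> both sides are 0, so scatteredness need not be assumed.\<close>

lemma delta_derivative_right_scattered:
  assumes "has_delta_derivative (T \<inter> {c..}) x d t" "t \<in> T" "c \<le> t"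
  shows "x (\<sigma> t) - x t = d * (\<sigma> t - t)"
proof -
  have "\<bar>x (\<sigma> t) - x t - d * (\<sigma> t - t)\<bar> \<le> 0 + \<epsilon>" if "\<epsilon> > 0" for \<epsilon>
  proof -
    have pos: "\<epsilon> / (1 + \<bar>\<sigma> t - t\<bar>) > 0" using that by (simp add: add_pos_nonneg)
    then obtain U where "t \<in> U" "\<forall>r\<in>U \<inter> (T \<inter> {c..}). \<bar>x (\<sigma> t) - x r - d * (\<sigma> t - r)\<bar> \<le> \<epsilon> / (1 + \<bar>\<sigma> t - t\<bar>) * \<bar>\<sigma> t - r\<bar>"
      using assms(1) unfolding has_delta_derivative_def fwd_jump_restrict[OF assms(3)] by blast
    then have "\<bar>x (\<sigma> t) - x t - d * (\<sigma> t - t)\<bar> \<le> \<epsilon> / (1 + \<bar>\<sigma> t - t\<bar>) * \<bar>\<sigma> t - t\<bar>"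
      using assms by auto
    also have "\<dots> \<le> \<epsilon> / (1 + \<bar>\<sigma> t - t\<bar>) * (1 + \<bar>\<sigma> t - t\<bar>)"
      using pos by (intro mult_left_mono) auto
    also have "\<dots> = \<epsilon>" by simp
    finally show ?thesis by simp
  qed
  then have "\<bar>x (\<sigma> t) - x t - d * (\<sigma> t - t)\<bar> \<le> 0" by (rule field_le_epsilon)
  then show ?thesis by simp
qed

lemma delta_derivative_right_dense:
  assumes "c \<le> t" "\<sigma> t = t"
  shows "has_delta_derivative (T \<inter> {c..}) x d t \<longleftrightarrow> (x has_real_derivative d) (at t within T \<inter> {c..})"
proof
  assume D: "has_delta_derivative (T \<inter> {c..}) x d t"
  show "(x has_real_derivative d) (at t within T \<inter> {c..})"
    unfolding has_field_derivative_def has_derivative_within_alt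
  proof (intro conjI allI impI)
    fix e :: real assume "e > 0"
    then obtain U where U: "open U" "t \<in> U" "\<forall>r\<in>U \<inter> (T \<inter> {c..}). \<bar>x t - x r - d * (t - r)\<bar> \<le> e * \<bar>t - r\<bar>"
      using D assms unfolding has_delta_derivative_def fwd_jump_restrict[OF assms(1)] by metis
    then obtain \<delta> where "\<delta> > 0" "ball t \<delta> \<subseteq> U" using open_contains_ball by metis
    then show "\<exists>da>0. \<forall>y\<in>T \<inter> {c..}. norm (y - t) < da \<longrightarrow> norm (x y - x t - d * (y - t)) \<le> e * norm (y - t)"
    proof (intro exI[of _ \<delta>] conjI ballI impI)
      fix y assume y: "y \<in> T \<inter> {c..}" "norm (y - t) < \<delta>"
      then have "y \<in> U" using \<open>ball t \<delta> \<subseteq> U\<close> by (auto simp: dist_real_def)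
      then have "\<bar>x t - x y - d * (t - y)\<bar> \<le> e * \<bar>t - y\<bar>" using U(3) y by blast
      moreover have "x y - x t - d * (y - t) = - (x t - x y - d * (t - y))" by (simp add: algebra_simps)
      ultimately show "norm (x y - x t - d * (y - t)) \<le> e * norm (y - t)"
        by (simp add: abs_minus_commute)
    qed
  qed (rule bounded_linear_mult_right)
next
  assume D: "(x has_real_derivative d) (at t within T \<inter> {c..})"
  show "has_delta_derivative (T \<inter> {c..}) x d t"
    unfolding has_delta_derivative_def fwd_jump_restrict[OF assms(1)] assms(2)
  proof (intro allI impI)
    fix e :: real assume "e > 0"
    then obtain \<delta> where "\<delta> > 0" and \<delta>: "\<And>y. y \<in> T \<inter> {c..} \<Longrightarrow> norm (y - t) < \<delta> \<Longrightarrow> norm (x y - x t - d * (y - t)) \<le> e * norm (y - t)"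
      using D unfolding has_field_derivative_def has_derivative_within_alt by meson
    show "\<exists>U. open U \<and> t \<in> U \<and> (\<forall>r\<in>U \<inter> (T \<inter> {c..}). \<bar>x t - x r - d * (t - r)\<bar> \<le> e * \<bar>t - r\<bar>)"
    proof (intro exI[of _ "ball t \<delta>"] conjI ballI)
      fix r assume "r \<in> ball t \<delta> \<inter> (T \<inter> {c..})"
      then have "norm (x r - x t - d * (r - t)) \<le> e * norm (r - t)"
        by (intro \<delta>) (auto simp: dist_real_def)
      moreover have "x t - x r - d * (t - r) = - (x r - x t - d * (r - t))" by (simp add: algebra_simps)
      ultimately show "\<bar>x t - x r - d * (t - r)\<bar> \<le> e * \<bar>t - r\<bar>"
        by (simp add: abs_minus_commute)
    qed (use \<open>\<delta> > 0\<close> in auto)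
  qed
qed

lemma has_delta_derivative_right_scatteredI:
  assumes "c \<le> t" "t < \<sigma> t" and cont: "continuous (at t within T \<inter> {c..}) x"
    and eq: "x (\<sigma> t) - x t = d * (\<sigma> t - t)"
  shows "has_delta_derivative (T \<inter> {c..}) x d t"
  unfolding has_delta_derivative_def fwd_jump_restrict[OF assms(1)]
proof (intro allI impI)
  fix e :: real assume "e > 0"
  define \<mu> where "\<mu> = \<sigma> t - t"
  have "\<mu> > 0" using assms by (simp add: \<mu>_def)
  \<comment> \<open>Near \<open>t\<close> the error is
    \<open>\<bar>(x t - x r) + d * (r - t)\<bar>\<close>, while
    \<open>\<bar>\<sigma> t - r\<bar>\<close> stays above \<open>\<mu> / 2\<close>. So each of the
    two terms may take \<open>e * \<mu> / 4\<close>; the 1 added to \<open>\<bar>d\<bar>\<close>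
    avoids division by 0.\<close>
  have "\<forall>\<^sub>F r in at t within T \<inter> {c..}. dist (x r) (x t) < e * \<mu> / 4"
    using cont \<open>e > 0\<close> \<open>\<mu> > 0\<close> by (intro tendstoD) (auto simp: continuous_within)
  moreover have "\<forall>\<^sub>F r in at t within T \<inter> {c..}. dist r t < min (\<mu> / 2) (e * \<mu> / (4 * (\<bar>d\<bar> + 1)))"
    using \<open>e > 0\<close> \<open>\<mu> > 0\<close> by (intro tendstoD tendsto_ident_at) (auto simp: add_nonneg_pos)
  ultimately have "\<forall>\<^sub>F r in at t within T \<inter> {c..}. \<bar>x (\<sigma> t) - x r - d * (\<sigma> t - r)\<bar> \<le> e * \<bar>\<sigma> t - r\<bar>"
  proof eventually_elim
    case (elim r)
    have "\<bar>x (\<sigma> t) - x r - d * (\<sigma> t - r)\<bar> = \<bar>(x t - x r) + d * (r - t)\<bar>"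
      using eq by (simp add: algebra_simps)
    also have "\<dots> \<le> \<bar>x t - x r\<bar> + \<bar>d\<bar> * \<bar>r - t\<bar>" by (metis abs_mult abs_triangle_ineq)
    also have "\<bar>d\<bar> * \<bar>r - t\<bar> \<le> (\<bar>d\<bar> + 1) * (e * \<mu> / (4 * (\<bar>d\<bar> + 1)))"
      using elim by (intro mult_mono) (auto simp: dist_real_def)
    also have "\<dots> = e * \<mu> / 4" by (simp add: add_nonneg_eq_0_iff field_simps) 
    finally have "\<bar>x (\<sigma> t) - x r - d * (\<sigma> t - r)\<bar> \<le> e * (\<mu> / 2)"
      using elim by (simp add: dist_real_def abs_minus_commute)
    also have "\<dots> \<le> e * \<bar>\<sigma> t - r\<bar>"
    proof (intro mult_left_mono)
      have "\<bar>r - t\<bar> < \<mu> / 2" using elim by (simp add: dist_real_def)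
      then show "\<mu> / 2 \<le> \<bar>\<sigma> t - r\<bar>" unfolding \<mu>_def
        using abs_ge_self[of "\<sigma> t - r"] abs_ge_self[of "r - t"] by (simp add: field_simps)
    qed (use \<open>e > 0\<close> in auto)
    finally show ?case .
  qed
  moreover have "\<bar>x (\<sigma> t) - x t - d * (\<sigma> t - t)\<bar> \<le> e * \<bar>\<sigma> t - t\<bar>"
    using eq \<open>e > 0\<close> by simp
  ultimately show "\<exists>U. open U \<and> t \<in> U \<and> (\<forall>r\<in>U \<inter> (T \<inter> {c..}). \<bar>x (\<sigma> t) - x r - d * (\<sigma> t - r)\<bar> \<le> e * \<bar>\<sigma> t - r\<bar>)"
    unfolding eventually_at_topological by (metis IntE)
qed

lemma delta_derivative_continuous:
  assumes D: "has_delta_derivative (T \<inter> {c..}) x d t" and "t \<in> T" "c \<le> t"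
  shows "continuous (at t within T \<inter> {c..}) x"
proof -
  obtain U where U: "open U" "t \<in> U" "\<forall>r\<in>U \<inter> (T \<inter> {c..}). \<bar>x (\<sigma> t) - x r - d * (\<sigma> t - r)\<bar> \<le> 1 * \<bar>\<sigma> t - r\<bar>"
    using D unfolding has_delta_derivative_def fwd_jump_restrict[OF assms(3)] by (metis zero_less_one)
  show ?thesis
    unfolding continuous_within
  proof (rule tendstoI)
    fix e :: real assume "e > 0"
    \<comment> \<open>Chosen so that \<open>\<eta> * \<bar>\<sigma> t - t\<bar> < e\<close>, the
      limit of the error bound as \<open>r\<close> tends to \<open>t\<close>.\<close>
    define \<eta> where "\<eta> = (if \<sigma> t = t then 1 else e / (2 * \<bar>\<sigma> t - t\<bar> + 2))"
    have "\<eta> > 0" using \<open>e > 0\<close> by (auto simp: \<eta>_def intro!: divide_pos_pos add_nonneg_pos)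
    then obtain V where V: "open V" "t \<in> V" "\<forall>r\<in>V \<inter> (T \<inter> {c..}). \<bar>x (\<sigma> t) - x r - d * (\<sigma> t - r)\<bar> \<le> \<eta> * \<bar>\<sigma> t - r\<bar>"
      using D unfolding has_delta_derivative_def fwd_jump_restrict[OF assms(3)] by metis
    have eq: "x (\<sigma> t) - x t = d * (\<sigma> t - t)"
      by (rule delta_derivative_right_scattered[OF assms])
    have "((\<lambda>r. \<eta> * \<bar>\<sigma> t - r\<bar> + \<bar>d\<bar> * \<bar>t - r\<bar>) \<longlongrightarrow> \<eta> * \<bar>\<sigma> t - t\<bar> + \<bar>d\<bar> * \<bar>t - t\<bar>) (at t within T \<inter> {c..})"
      by (intro tendsto_intros)
    moreover have "\<eta> * \<bar>\<sigma> t - t\<bar> + \<bar>d\<bar> * \<bar>t - t\<bar> < e"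
    proof (cases "\<sigma> t = t")
      case False
      have "e * \<bar>\<sigma> t - t\<bar> < e * (2 * \<bar>\<sigma> t - t\<bar> + 2)"
        using \<open>e > 0\<close> by (intro mult_strict_left_mono) auto
      then show ?thesis using False by (simp add: \<eta>_def pos_divide_less_eq add_nonneg_pos)
    qed (use \<open>e > 0\<close> in auto)
    ultimately have "\<forall>\<^sub>F r in at t within T \<inter> {c..}. \<eta> * \<bar>\<sigma> t - r\<bar> + \<bar>d\<bar> * \<bar>t - r\<bar> < e"
      by (rule order_tendstoD(2))
    moreover have "\<forall>\<^sub>F r in at t within T \<inter> {c..}. r \<in> V \<inter> (T \<inter> {c..})"
      using V(1,2) unfolding eventually_at_topological by blast
    ultimately show "\<forall>\<^sub>F r in at t within T \<inter> {c..}. dist (x r) (x t) < e"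
    proof eventually_elim
      case (elim r)
      have "x t - x r = (x (\<sigma> t) - x r - d * (\<sigma> t - r)) + d * (t - r)"
        using eq by (simp add: algebra_simps)
      then have "\<bar>x t - x r\<bar> \<le> \<bar>x (\<sigma> t) - x r - d * (\<sigma> t - r)\<bar> + \<bar>d\<bar> * \<bar>t - r\<bar>"
        by (metis abs_mult abs_triangle_ineq)
      moreover have "\<bar>x (\<sigma> t) - x r - d * (\<sigma> t - r)\<bar> \<le> \<eta> * \<bar>\<sigma> t - r\<bar>"
        using V(3) elim by blast
      ultimately have "\<bar>x t - x r\<bar> < e" using elim by linarith
      then show ?case by (simp add: dist_real_def abs_minus_commute)
    qed
  qed
qed

text \<open>This is the uniqueness of antiderivatives, on which the description in
  \<open>delta_integral\<close> rests. The estimate with slope \<open>\<epsilon>\<close> is pushed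
  from \<open>t0\<close> to \<open>b\<close> by a supremum argument, and then
  \<open>\<epsilon>\<close> tends to 0.\<close>

lemma zero_delta_derivative_const:
  assumes D: "\<And>t. t \<in> T \<Longrightarrow> t0 \<le> t \<Longrightarrow> has_delta_derivative (T \<inter> {t0..}) D 0 t"
    and b: "b \<in> T" "t0 \<le> b"
  shows "D b = D t0"
proof -
  have "\<bar>D b - D t0\<bar> \<le> \<epsilon> * (b - t0)" if "\<epsilon> > 0" for \<epsilon>
  proof -
    define P where "P r \<longleftrightarrow> \<bar>D r - D t0\<bar> \<le> \<epsilon> * (r - t0)" for r
    \<comment> \<open>\<open>v\<close> runs over real numbers, not just over \<open>T\<close>, so
      the supremum may fall into a gap.\<close>
    define Q where "Q = {v \<in> {t0..b}. \<forall>r\<in>T \<inter> {t0..v}. P r}"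
    have Q0: "t0 \<in> Q" using b by (auto simp: Q_def P_def)
    have bddQ: "bdd_above Q" by (auto simp: Q_def intro: bdd_aboveI[of _ b])
    define w where "w = Sup Q"
    have w: "t0 \<le> w" "w \<le> b"
    proof -
      show "t0 \<le> w" unfolding w_def by (rule cSup_upper[OF Q0 bddQ])
      show "w \<le> b" unfolding w_def by (rule cSup_least) (use Q0 in \<open>auto simp: Q_def\<close>)
    qed
    have below: "P r" if "r \<in> T" "t0 \<le> r" "r < w" for r
    proof -
      obtain v where "v \<in> Q" "r < v"
        using less_cSupD[of Q r] Q0 \<open>r < w\<close> unfolding w_def by blast
      then show ?thesis using that by (auto simp: Q_def)
    qed
    \<comment> \<open>A left-dense \<open>w\<close> inherits the estimate by continuity, a
      left-scattered one from its predecessor \<open>p\<close>, as \<open>D w = D p\<close>.\<close>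
    have at_w: "P w" if wT: "w \<in> T"
    proof (cases "w = t0")
      case True
      then show ?thesis by (simp add: P_def)
    next
      case False
      then have "t0 < w" using w by simp
      have cont: "(D \<longlongrightarrow> D w) (at w within T \<inter> {t0..})"
        using delta_derivative_continuous[OF D[OF wT w(1)] wT w(1)] by (simp add: continuous_within)
      define p where "p = Sup (T \<inter> {t0..<w})"
      have ne: "T \<inter> {t0..<w} \<noteq> {}" using t0_in \<open>t0 < w\<close> by auto
      have bd: "bdd_above (T \<inter> {t0..<w})" by (auto intro: bdd_aboveI[of _ w])
      have "p \<in> closure (T \<inter> {t0..<w})" unfolding p_def by (rule closure_contains_Sup[OF ne bd])
      moreover have "closure (T \<inter> {t0..<w}) \<subseteq> T" using T_closed by (intro closure_minimal) auto
      ultimately have pT: "p \<in> T" by blast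
      have p: "t0 \<le> p" "p \<le> w"
        using ne cSup_upper[OF _ bd] cSup_least[OF ne, of w] by (force simp: p_def)+
      have p_up: "r \<le> p" if "r \<in> T" "t0 \<le> r" "r < w" for r
        unfolding p_def using that by (intro cSup_upper bd) auto
      show ?thesis
      proof (cases "p = w")
        case True
        have nontriv: "at w within (T \<inter> {t0..<w}) \<noteq> bot"
        proof -
          have "w islimpt (T \<inter> {t0..<w})"
            unfolding islimpt_approachable
          proof (intro allI impI)
            fix e :: real assume "e > 0"
            then obtain r where "r \<in> T \<inter> {t0..<w}" "w - e < r"
              using less_cSupD[OF ne, of "w - e"] True by (auto simp: p_def)
            then show "\<exists>x'\<in>T \<inter> {t0..<w}. x' \<noteq> w \<and> dist x' w < e"
              by (intro bexI[of _ r]) (auto simp: dist_real_def)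
          qed
          then show ?thesis by (simp add: trivial_limit_within)
        qed
        have lim: "(D \<longlongrightarrow> D w) (at w within (T \<inter> {t0..<w}))"
          by (rule tendsto_within_subset[OF cont]) auto
        have "\<forall>\<^sub>F r in at w within (T \<inter> {t0..<w}). \<bar>D r - D t0\<bar> \<le> \<epsilon> * (r - t0)"
          unfolding eventually_at_topological using below by (auto simp: P_def intro!: exI[of _ UNIV])
        moreover have "((\<lambda>r. \<bar>D r - D t0\<bar>) \<longlongrightarrow> \<bar>D w - D t0\<bar>) (at w within (T \<inter> {t0..<w}))"
          by (intro tendsto_intros lim)
        moreover have "((\<lambda>r. \<epsilon> * (r - t0)) \<longlongrightarrow> \<epsilon> * (w - t0)) (at w within (T \<inter> {t0..<w}))"
          by (intro tendsto_intros)
        ultimately show ?thesis unfolding P_def using tendsto_le[OF nontriv] by blast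
      next
        case False
        then have "p < w" using p by simp
        have "\<sigma> p = w"
        proof (rule antisym)
          show "\<sigma> p \<le> w" using \<sigma>_le wT \<open>p < w\<close> by blast
          show "w \<le> \<sigma> p"
          proof (rule ccontr)
            assume "\<not> w \<le> \<sigma> p"
            then obtain r where "r \<in> T" "p < r" "r < w" using \<sigma>_less_witness[of p w] by auto
            then show False using p_up[of r] p by auto
          qed
        qed
        then have "D w = D p"
          using delta_derivative_right_scattered[OF D[OF pT p(1)] pT p(1)] by simp
        moreover have "\<epsilon> * (p - t0) \<le> \<epsilon> * (w - t0)" using p \<open>\<epsilon> > 0\<close> by (intro mult_left_mono) auto
        ultimately show ?thesis using below[OF pT p(1) \<open>p < w\<close>] by (simp add: P_def)
      qed
    qed
    have wQ: "w \<in> Q"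
      using w below at_w by (auto simp: Q_def) (metis order_le_less)
    have "w = b"
    proof (rule ccontr)
      assume "w \<noteq> b"
      then have "w < b" using w by simp
      \<comment> \<open>Either \<open>T\<close> has no points immediately after \<open>w\<close>,
        which includes the case \<open>w \<notin> T\<close>, or \<open>w\<close> is right-dense and
        the zero derivative limits the growth to slope \<open>\<epsilon>\<close>.\<close>
      have "\<exists>c>w. \<forall>r\<in>T. w < r \<longrightarrow> r \<le> c \<longrightarrow> P r"
      proof (cases "\<sigma> w = w")
        case False
        then have "w < \<sigma> w" using \<sigma>_ge[of w] by simp
        then show ?thesis
          using \<sigma>_le[of _ w] by (intro exI[of _ "(w + \<sigma> w) / 2"]) force
      next
        case True
        have wT: "w \<in> T" using True \<sigma>_in[of w] by simp
        have "(D has_real_derivative 0) (at w within T \<inter> {t0..})"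
          using D[OF wT w(1)] delta_derivative_right_dense[OF w(1) True] by simp
        then obtain \<delta> where "\<delta> > 0" and \<delta>: "\<And>y. y \<in> T \<inter> {t0..} \<Longrightarrow> norm (y - w) < \<delta> \<Longrightarrow> norm (D y - D w - 0 * (y - w)) \<le> \<epsilon> * norm (y - w)"
          using \<open>\<epsilon> > 0\<close> unfolding has_field_derivative_def has_derivative_within_alt by meson
        show ?thesis
        proof (intro exI[of _ "w + \<delta> / 2"] conjI ballI impI)
          fix r assume r: "r \<in> T" "w < r" "r \<le> w + \<delta> / 2"
          have "\<bar>D r - D w\<bar> \<le> \<epsilon> * (r - w)" using \<delta>[of r] r w \<open>\<delta> > 0\<close> by auto
          moreover have "\<bar>D w - D t0\<bar> \<le> \<epsilon> * (w - t0)" using at_w[OF wT] by (simp add: P_def)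
          ultimately show "P r" unfolding P_def right_diff_distrib by linarith
        qed (use \<open>\<delta> > 0\<close> in auto)
      qed
      then obtain c where c: "c > w" "\<And>r. r \<in> T \<Longrightarrow> w < r \<Longrightarrow> r \<le> c \<Longrightarrow> P r" by blast
      have "P r" if "r \<in> T \<inter> {t0..min c b}" for r
        using that c(2)[of r] wQ by (cases "r \<le> w") (auto simp: Q_def)
      then have "min c b \<in> Q"
        using w \<open>w < b\<close> c(1) by (auto simp: Q_def)
      then have "min c b \<le> w" unfolding w_def by (intro cSup_upper bddQ)
      then show False using c(1) \<open>w < b\<close> by auto
    qed
    then show ?thesis using wQ b by (auto simp: Q_def P_def)
  qed
  then have le: "\<bar>D b - D t0\<bar> \<le> 0 + e" if "e > 0" for e
  proof -
    have "e / (b - t0 + 1) > 0" using that b by simp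
    then have "\<bar>D b - D t0\<bar> \<le> e / (b - t0 + 1) * (b - t0)" by fact
    also have "\<dots> \<le> e / (b - t0 + 1) * (b - t0 + 1)" using that b by (intro mult_left_mono) auto
    also have "\<dots> = e" using b by simp
    finally show ?thesis by simp
  qed
  have "\<bar>D b - D t0\<bar> \<le> 0" by (rule field_le_epsilon) (rule le)
  then show ?thesis by simp
qed

section \<open>The delta-integral as an integral over the real line\<close>

lemma comp_floor_integrable:
  assumes rd: "rd_continuous_on (T \<inter> {t0..}) g"
  shows "(\<lambda>v. g (ts_floor v)) integrable_on {u..v}"
proof -
  obtain L where L: "\<And>t. t \<in> T \<Longrightarrow> t0 \<le> t \<Longrightarrow> t \<le> max t0 v \<Longrightarrow> \<bar>g t\<bar> \<le> L"
    using rd_continuous_bounded[OF rd] by blast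
  show ?thesis
  proof (rule integrable_on_bounded_borel[OF borel_measurable_comp_floor[OF rd]])
    fix w assume "w \<in> {u..v}"
    then show "\<bar>g (ts_floor w)\<bar> \<le> L"
      using floor_in[of w] floor_ge[of w] floor_le_max[of w] by (intro L) (auto simp: max_def split: if_splits)
  qed
qed

lemma has_integral_gap:
  assumes "t \<in> T" "t0 \<le> t"
  shows "((\<lambda>v. g (ts_floor v)) has_integral g t * (\<sigma> t - t)) {t..\<sigma> t}"
proof (rule has_integral_spike[of "{\<sigma> t}" _ _ "\<lambda>_. g t"])
  fix v assume "v \<in> {t..\<sigma> t} - {\<sigma> t}"
  then show "g (ts_floor v) = g t" using floor_gap[OF assms, of v] by auto
next
  show "((\<lambda>_. g t) has_integral g t * (\<sigma> t - t)) {t..\<sigma> t}"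
    using has_integral_const_real[of "g t" t "\<sigma> t"] \<sigma>_ge[of t] by (simp add: mult.commute)
qed auto

text \<open>On a gap the integrand is the constant \<open>g t\<close>, which gives the difference
  quotient at a right-scattered point. At a right-dense point the integrand is close to
  \<open>g t\<close> by rd-continuity.\<close>

lemma delta_derivative_indefinite_integral:
  assumes rd: "rd_continuous_on (T \<inter> {t0..}) g" and t: "t \<in> T" "t0 \<le> t"
  shows "has_delta_derivative (T \<inter> {t0..}) (\<lambda>t. integral {t0..t} (\<lambda>v. g (ts_floor v))) (g t) t"
proof (cases "\<sigma> t = t")
  case False
  then have lt: "t < \<sigma> t" using \<sigma>_ge[of t] by simp
  show ?thesis
  proof (rule has_delta_derivative_right_scatteredI[OF t(2) lt])
    have "continuous_on {t0..t + 1} (\<lambda>t. integral {t0..t} (\<lambda>v. g (ts_floor v)))"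
      by (intro indefinite_integral_continuous_1 comp_floor_integrable rd)
    then have "continuous (at t within {t0..t + 1}) (\<lambda>t. integral {t0..t} (\<lambda>v. g (ts_floor v)))"
      using t by (auto simp: continuous_on_eq_continuous_within)
    moreover have "at t within {t0..t + 1} = at t within {t0..}"
      using t by (intro at_within_nhd[of _ "{..<t + 1}"]) auto
    ultimately have "continuous (at t within {t0..}) (\<lambda>t. integral {t0..t} (\<lambda>v. g (ts_floor v)))" by simp
    then show "continuous (at t within T \<inter> {t0..}) (\<lambda>t. integral {t0..t} (\<lambda>v. g (ts_floor v)))"
      by (rule continuous_within_subset) auto
    have "integral {t0..t} (\<lambda>v. g (ts_floor v)) + integral {t..\<sigma> t} (\<lambda>v. g (ts_floor v)) = integral {t0..\<sigma> t} (\<lambda>v. g (ts_floor v))"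
      using t lt by (intro Henstock_Kurzweil_Integration.integral_combine comp_floor_integrable rd) auto
    then show "integral {t0..\<sigma> t} (\<lambda>v. g (ts_floor v)) - integral {t0..t} (\<lambda>v. g (ts_floor v)) = g t * (\<sigma> t - t)"
      using integral_unique[OF has_integral_gap[OF t, of g]] by simp
  qed
next
  case True
  let ?G = "\<lambda>t. integral {t0..t} (\<lambda>v. g (ts_floor v))"
  have "right_dense (T \<inter> {t0..}) t" using t True by (simp add: right_dense_restrict)
  then have cont: "(g \<longlongrightarrow> g t) (at t within T \<inter> {t0..})"
    using rd by (simp add: rd_continuous_on_def continuous_within)
  have "(?G has_real_derivative g t) (at t within T \<inter> {t0..})"
    unfolding has_field_derivative_def has_derivative_within_alt
  proof (intro conjI allI impI)
    fix e :: real assume "e > 0"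
    then obtain \<delta> where "\<delta> > 0" and "\<And>r. r \<in> T \<inter> {t0..} \<Longrightarrow> r \<noteq> t \<and> dist r t < \<delta> \<Longrightarrow> dist (g r) (g t) < e"
      using tendstoD[OF cont] unfolding eventually_at by (metis zero_less_dist_iff)
    then have \<delta>: "\<bar>g r - g t\<bar> \<le> e" if "r \<in> T" "t0 \<le> r" "\<bar>r - t\<bar> < \<delta>" for r
      using that \<open>e > 0\<close> by (cases "r = t") (force simp: dist_real_def)+
    have bd: "\<bar>?G v - ?G u - g t * (v - u)\<bar> \<le> e * (v - u)"
      if "u \<in> T" "t0 \<le> u" "v \<in> T" "u \<le> v" "u = t \<or> v = t" "v - u < \<delta>" for u v
    proof -
      have "?G v - ?G u = integral {u..v} (\<lambda>v. g (ts_floor v))"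
        using Henstock_Kurzweil_Integration.integral_combine[of t0 u v "\<lambda>v. g (ts_floor v)"] that comp_floor_integrable[OF rd]
        by auto
      moreover have "integral {u..v} (\<lambda>v. g (ts_floor v) - g t) = integral {u..v} (\<lambda>v. g (ts_floor v)) - g t * (v - u)"
        using that by (subst Henstock_Kurzweil_Integration.integral_diff) (auto intro: comp_floor_integrable[OF rd] integrable_const_ivl)
      moreover have "\<bar>integral {u..v} (\<lambda>v. g (ts_floor v) - g t)\<bar> \<le> e * (v - u)"
      proof (rule abs_integral_le_const)
        fix w assume w: "w \<in> {u..v}"
        \<comment> \<open>Both ends belong to \<open>T\<close>, so floors stay between them and
          continuity of \<open>g\<close> along the time scale suffices.\<close>
        then have "u \<le> ts_floor w" "ts_floor w \<le> v"
          using that floor_greatest[of u w] floor_le[of w] by auto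
        then show "\<bar>g (ts_floor w) - g t\<bar> \<le> e"
          using that floor_in floor_ge by (intro \<delta>) auto
      qed (use that in \<open>auto intro!: Henstock_Kurzweil_Integration.integrable_diff comp_floor_integrable[OF rd] integrable_const_ivl\<close>)
      ultimately show ?thesis by simp
    qed
    show "\<exists>d>0. \<forall>y\<in>T \<inter> {t0..}. norm (y - t) < d \<longrightarrow> norm (?G y - ?G t - g t * (y - t)) \<le> e * norm (y - t)"
    proof (intro exI[of _ \<delta>] conjI ballI impI)
      fix y assume y: "y \<in> T \<inter> {t0..}" "norm (y - t) < \<delta>"
      show "norm (?G y - ?G t - g t * (y - t)) \<le> e * norm (y - t)"
      proof (cases "t \<le> y")
        case True
        then show ?thesis using bd[of t y] y t by simp
      next
        case False
        then have "\<bar>?G t - ?G y - g t * (t - y)\<bar> \<le> e * (t - y)" using bd[of y t] y t by simp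
        moreover have "?G y - ?G t - g t * (y - t) = - (?G t - ?G y - g t * (t - y))" by (simp add: algebra_simps)
        ultimately show ?thesis using False by simp
      qed
    qed (use \<open>\<delta> > 0\<close> in auto)
  qed (rule bounded_linear_mult_right)
  then show ?thesis using delta_derivative_right_dense[OF t(2) True] by simp
qed

text \<open>The indefinite integral is an antiderivative and any two antiderivatives differ by a
  constant, so the definite description is proper. In this form the hypothesis on \<open>A\<close>
  applies to integrals of the interpolated equation.\<close>

lemma delta_integral_eq_integral:
  assumes rd: "rd_continuous_on (T \<inter> {t0..}) g" and "p \<in> T" "t0 \<le> p" "q \<in> T" "p \<le> q"
  shows "delta_integral (T \<inter> {t0..}) g p q = integral {p..q} (\<lambda>v. g (ts_floor v))"
proof -
  let ?G = "\<lambda>t. integral {t0..t} (\<lambda>v. g (ts_floor v))"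
  have G: "\<forall>t\<in>T \<inter> {t0..}. has_delta_derivative (T \<inter> {t0..}) ?G (g t) t"
    using delta_derivative_indefinite_integral[OF rd] by auto
  have "I = ?G q - ?G p" if F: "\<forall>t\<in>T \<inter> {t0..}. has_delta_derivative (T \<inter> {t0..}) F (g t) t" and "I = F q - F p" for F I
  proof -
    have D: "has_delta_derivative (T \<inter> {t0..}) (\<lambda>t. F t - ?G t) 0 t" if "t \<in> T" "t0 \<le> t" for t
      using has_delta_derivative_diff[of _ F "g t" t ?G "g t"] F G that by simp
    have "F q - ?G q = F t0 - ?G t0" "F p - ?G p = F t0 - ?G t0"
      using assms(2-) by (intro zero_delta_derivative_const[OF D]; simp)+
    then show ?thesis using \<open>I = F q - F p\<close> by simp
  qed
  then have "delta_integral (T \<inter> {t0..}) g p q = ?G q - ?G p"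
    unfolding delta_integral_def using G by (intro the_equality) blast+
  also have "\<dots> = integral {p..q} (\<lambda>v. g (ts_floor v))"
    using Henstock_Kurzweil_Integration.integral_combine[of t0 p q "\<lambda>v. g (ts_floor v)"] assms comp_floor_integrable[OF rd]
    by auto
  finally show ?thesis .
qed

end

section \<open>Delay dynamic equations\<close>

lemma lipschitz_on_bounded:
  fixes x :: "real \<Rightarrow> real"
  assumes "L-lipschitz_on (T \<inter> {s..b}) x" "s \<in> T" "t \<in> T \<inter> {s..b}"
  shows "\<bar>x t\<bar> \<le> \<bar>x s\<bar> + L * (b - s)"
proof -
  have "\<bar>x t - x s\<bar> \<le> L * (t - s)"
    using lipschitz_onD[OF assms(1), of t s] assms by (simp add: dist_real_def)
  also have "\<dots> \<le> L * (b - s)"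
    using assms lipschitz_on_nonneg[OF assms(1)] by (intro mult_left_mono) auto
  finally show ?thesis by linarith
qed

section \<open>Linear interpolation across the gaps\<close>

context unbounded_time_scale
begin

text \<open>A zero denominator is harmless for \<open>v \<ge> t0\<close>: if
  \<open>ts_floor v\<close> is right-dense, then \<open>v\<close> equals its floor and the first
  factor is 0.\<close>

definition extension :: "(real \<Rightarrow> real) \<Rightarrow> real \<Rightarrow> real" where
  "extension x v = x (ts_floor v) +
     (v - ts_floor v) * ((x (\<sigma> (ts_floor v)) - x (ts_floor v)) / (\<sigma> (ts_floor v) - ts_floor v))"

lemma extension_id: "v \<in> T \<Longrightarrow> t0 \<le> v \<Longrightarrow> extension x v = x v"
  by (simp add: extension_def floor_id)

text \<open>The slope across a gap is itself bounded by \<open>L\<close>. Two points are compared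
  through a point of \<open>T\<close> between them or else lie in one gap. \<open>b \<in> T\<close>
  keeps the right end of each gap inside the interval where \<open>x\<close> is known to be
  Lipschitz.\<close>

lemma extension_lipschitz:
  assumes lip: "L-lipschitz_on (T \<inter> {s..b}) x" and "s \<in> T" "b \<in> T" "t0 \<le> s"
  shows "L-lipschitz_on {s..b} (extension x)"
proof -
  have L: "L \<ge> 0" by (rule lipschitz_on_nonneg[OF lip])
  have lipT: "\<bar>x u - x v\<bar> \<le> L * (u - v)" if "u \<in> T" "v \<in> T" "s \<le> v" "v \<le> u" "u \<le> b" for u v
    using lipschitz_onD[OF lip, of u v] that by (simp add: dist_real_def)
  define m where "m p = (x (\<sigma> p) - x p) / (\<sigma> p - p)" for p
  have gap: "ts_floor v \<in> T" "s \<le> ts_floor v" "ts_floor v < v" "v < \<sigma> (ts_floor v)" "\<sigma> (ts_floor v) \<le> b"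
      "\<bar>m (ts_floor v)\<bar> \<le> L"
      "extension x v = x (ts_floor v) + (v - ts_floor v) * m (ts_floor v)"
      "extension x v = x (\<sigma> (ts_floor v)) - (\<sigma> (ts_floor v) - v) * m (ts_floor v)"
    if v: "v \<in> {s..b}" "v \<notin> T" for v
  proof -
    show 1: "ts_floor v \<in> T" by (rule floor_in)
    show 2: "s \<le> ts_floor v" using floor_greatest assms v by auto
    show 3: "ts_floor v < v" "v < \<sigma> (ts_floor v)" using not_in_gap[of v] v assms by auto
    then show 4: "\<sigma> (ts_floor v) \<le> b" using \<sigma>_le[OF \<open>b \<in> T\<close>, of "ts_floor v"] v by auto
    have "\<bar>x (\<sigma> (ts_floor v)) - x (ts_floor v)\<bar> \<le> L * (\<sigma> (ts_floor v) - ts_floor v)"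
      using 1 2 3 4 \<sigma>_in by (intro lipT) auto
    then show "\<bar>m (ts_floor v)\<bar> \<le> L" using 3 by (simp add: m_def abs_divide pos_divide_le_eq)
    show e: "extension x v = x (ts_floor v) + (v - ts_floor v) * m (ts_floor v)"
      by (simp add: extension_def m_def)
    have "(\<sigma> (ts_floor v) - ts_floor v) * m (ts_floor v) = x (\<sigma> (ts_floor v)) - x (ts_floor v)"
      using 3 by (simp add: m_def)
    then show "extension x v = x (\<sigma> (ts_floor v)) - (\<sigma> (ts_floor v) - v) * m (ts_floor v)"
      unfolding e by (simp add: algebra_simps)
  qed
  have up: "\<bar>extension x v - x t\<bar> \<le> L * (v - t)" if "t \<in> T" "s \<le> t" "t \<le> v" "v \<le> b" for t v
  proof (cases "v \<in> T")
    case True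
    then show ?thesis using lipT[of v t] that assms by (simp add: extension_id)
  next
    case False
    let ?p = "ts_floor v"
    have v: "v \<in> {s..b}" using that by auto
    have "t \<le> ?p" using floor_greatest that assms by auto
    then have "\<bar>x ?p - x t\<bar> \<le> L * (?p - t)"
      using gap[OF v False] that by (intro lipT) auto
    moreover have "\<bar>(v - ?p) * m ?p\<bar> \<le> (v - ?p) * L"
      unfolding abs_mult using gap[OF v False] by (intro mult_mono) auto
    moreover have "L * (v - t) = L * (?p - t) + (v - ?p) * L" by (simp add: algebra_simps)
    ultimately show ?thesis unfolding gap(7)[OF v False] by linarith
  qed
  have down: "\<bar>x t - extension x v\<bar> \<le> L * (t - v)" if "t \<in> T" "s \<le> v" "v \<le> t" "t \<le> b" for t v
  proof (cases "v \<in> T")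
    case True
    then show ?thesis using lipT[of t v] that assms by (simp add: extension_id)
  next
    case False
    let ?q = "\<sigma> (ts_floor v)"
    have v: "v \<in> {s..b}" using that by auto
    have "?q \<le> t" using gap[OF v False] that \<sigma>_le[of t "ts_floor v"] by auto
    then have "\<bar>x t - x ?q\<bar> \<le> L * (t - ?q)"
      using gap[OF v False] that \<sigma>_in by (intro lipT) auto
    moreover have "\<bar>(?q - v) * m (ts_floor v)\<bar> \<le> (?q - v) * L"
      unfolding abs_mult using gap[OF v False] by (intro mult_mono) auto
    moreover have "L * (t - v) = L * (t - ?q) + (?q - v) * L" by (simp add: algebra_simps)
    ultimately show ?thesis unfolding gap(8)[OF v False] by linarith
  qed
  have main: "\<bar>extension x v - extension x u\<bar> \<le> L * (v - u)" if "s \<le> u" "u \<le> v" "v \<le> b" for u v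
  proof (cases "\<exists>t\<in>T. u \<le> t \<and> t \<le> v")
    case True
    then obtain t where t: "t \<in> T" "u \<le> t" "t \<le> v" by blast
    have "\<bar>extension x v - x t\<bar> \<le> L * (v - t)" "\<bar>x t - extension x u\<bar> \<le> L * (t - u)"
      using t that by (intro up down; simp)+
    moreover have "L * (v - u) = L * (v - t) + L * (t - u)" by (simp add: algebra_simps)
    ultimately show ?thesis by linarith
  next
    case False
    then have uv: "u \<notin> T" "v \<notin> T" "u \<in> {s..b}" "v \<in> {s..b}" using that by auto
    have "\<not> u \<le> ts_floor v" using False gap[OF uv(4,2)] by (meson less_imp_le)
    then have "ts_floor v \<le> ts_floor u" using gap[OF uv(4,2)] assms by (intro floor_greatest[of "ts_floor v" u]) auto
    then have "ts_floor v = ts_floor u" using floor_mono[OF that(2)] by simp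
    then have "extension x v - extension x u = (v - u) * m (ts_floor u)"
      unfolding gap(7)[OF uv(4,2)] gap(7)[OF uv(3,1)] by (simp add: algebra_simps)
    also have "\<bar>\<dots>\<bar> \<le> (v - u) * L"
      unfolding abs_mult using that gap(6)[OF uv(3,1)] by (intro mult_mono) auto
    finally show ?thesis by (simp add: mult.commute)
  qed
  show ?thesis
  proof (rule lipschitz_onI[OF _ L])
    fix u v assume "u \<in> {s..b}" "v \<in> {s..b}"
    then show "dist (extension x u) (extension x v) \<le> L * dist u v"
      using main[of u v] main[of v u] by (cases "u \<le> v") (auto simp: dist_real_def abs_minus_commute)
  qed
qed

lemma negligible_irregular: "negligible irregular"
  using negligible_countable_Union[of "(\<lambda>v. {v}) ` irregular"] countable_irregular by auto

lemma extension_derivative_gap: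
  assumes "t0 < v" "v \<notin> T"
  shows "(extension x has_real_derivative
    (x (\<sigma> (ts_floor v)) - x (ts_floor v)) / (\<sigma> (ts_floor v) - ts_floor v)) (at v)"
proof -
  define p where "p = ts_floor v"
  define m where "m = (x (\<sigma> p) - x p) / (\<sigma> p - p)"
  have "((\<lambda>w. x p + (w - p) * m) has_real_derivative m) (at v)"
    by (auto intro!: derivative_eq_intros)
  moreover have "\<forall>\<^sub>F w in nhds v. extension x w = x p + (w - p) * m"
    using floor_locally_constant[OF assms] by eventually_elim (simp add: extension_def p_def m_def)
  ultimately have "(extension x has_real_derivative m) (at v)"
    by (subst DERIV_cong_ev[OF refl _ refl])
  then show ?thesis by (simp add: m_def p_def)
qed

text \<open>Inside a gap the error of the linear approximation is a convex combination of the errors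
  at the two ends. Both ends lie on the same side of \<open>v\<close>, so
  \<open>\<bar>w - v\<bar>\<close> is the same convex combination of their distances and the bound
  carries over.\<close>

lemma extension_derivative_dense:
  assumes v: "v \<in> T" "s < v" "t0 \<le> s" "v \<notin> irregular"
    and D: "(x has_real_derivative d) (at v within T \<inter> {s..})"
  shows "(extension x has_real_derivative d) (at v)"
  unfolding has_field_derivative_def has_derivative_at_alt
proof (intro conjI allI impI)
  fix e :: real assume "e > 0"
  then obtain \<delta> where "\<delta> > 0" and \<delta>: "\<And>y. y \<in> T \<inter> {s..} \<Longrightarrow> norm (y - v) < \<delta> \<Longrightarrow> norm (x y - x v - d * (y - v)) \<le> e * norm (y - v)"
    using D unfolding has_field_derivative_def has_derivative_within_alt by meson
  \<comment> \<open>Points \<open>l\<close> and \<open>r\<close> of \<open>T\<close> on either side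
    of \<open>v\<close> confine the gap around any nearby \<open>w\<close> to the range where the
    estimate on \<open>T\<close> holds; \<open>v \<notin> irregular\<close> provides them.\<close>
  have "min \<delta> (v - s) > 0" using \<open>\<delta> > 0\<close> v by simp
  then obtain l where l: "l \<in> T" "v - min \<delta> (v - s) < l" "l < v"
    using regular_dense(2)[of v "min \<delta> (v - s)"] v by auto
  have "\<sigma> v = v" using regular_dense(1)[of v] v by simp
  then obtain r where r: "r \<in> T" "v < r" "r < v + \<delta>"
    using \<sigma>_less_witness[of v "v + \<delta>"] \<open>\<delta> > 0\<close> by auto
  define E where "E y = x y - x v - d * (y - v)" for y
  have E: "\<bar>E y\<bar> \<le> e * \<bar>y - v\<bar>" if "y \<in> T" "l \<le> y" "y \<le> r" for y
    using \<delta>[of y] that l r by (auto simp: E_def)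
  have main: "\<bar>extension x w - extension x v - d * (w - v)\<bar> \<le> e * \<bar>w - v\<bar>" if w: "l \<le> w" "w \<le> r" for w
  proof (cases "w \<in> T")
    case True
    then show ?thesis using E[of w] w l v by (simp add: extension_id E_def)
  next
    case False
    define p where "p = ts_floor w"
    define q where "q = \<sigma> p"
    have wt: "t0 \<le> w" using w l v by linarith
    have p: "p \<in> T" "l \<le> p" "p < w" "w < q" "q \<in> T" "q \<le> r"
      using floor_in[of w] floor_greatest[of l w] not_in_gap[OF wt False] \<sigma>_in \<sigma>_le[OF r(1), of p] l v w
      by (auto simp: p_def q_def)
    define c where "c = (w - p) / (q - p)"
    have c: "0 \<le> c" "c \<le> 1" using p by (auto simp: c_def)
    have wc: "w - p = c * (q - p)" using p by (simp add: c_def)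
    have "extension x w = x p + c * (x q - x p)"
      by (simp add: extension_def p_def[symmetric] q_def[symmetric] c_def)
    moreover have "extension x v = x v" using v by (simp add: extension_id)
    moreover have "w - v = (p - v) + c * (q - p)" using wc by simp
    then have "d * (w - v) = d * ((p - v) + c * (q - p))" by (rule arg_cong)
    ultimately have "extension x w - extension x v - d * (w - v) = (1 - c) * E p + c * E q"
      by (simp add: E_def algebra_simps)
    also have "\<bar>\<dots>\<bar> \<le> (1 - c) * (e * \<bar>p - v\<bar>) + c * (e * \<bar>q - v\<bar>)"
    proof (rule order_trans[OF abs_triangle_ineq], rule add_mono)
      show "\<bar>(1 - c) * E p\<bar> \<le> (1 - c) * (e * \<bar>p - v\<bar>)"
        unfolding abs_mult using c E[of p] p by (intro mult_mono) auto
      show "\<bar>c * E q\<bar> \<le> c * (e * \<bar>q - v\<bar>)"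
        unfolding abs_mult using c E[of q] p by (intro mult_mono) auto
    qed
    also have "\<dots> = e * ((1 - c) * \<bar>p - v\<bar> + c * \<bar>q - v\<bar>)" by (simp add: algebra_simps)
    also have "(1 - c) * \<bar>p - v\<bar> + c * \<bar>q - v\<bar> = \<bar>w - v\<bar>"
    proof -
      have "v \<le> p \<or> q \<le> v" using \<sigma>_le[OF v(1), of p] by (cases "p < v") (auto simp: q_def)
      then show ?thesis
      proof
        assume "v \<le> p"
        then show ?thesis using p wc by (simp add: algebra_simps)
      next
        assume "q \<le> v"
        then show ?thesis using p wc by (simp add: algebra_simps)
      qed
    qed
    finally show ?thesis .
  qed
  show "\<exists>\<delta>>0. \<forall>y. norm (y - v) < \<delta> \<longrightarrow> norm (extension x y - extension x v - d * (y - v)) \<le> e * norm (y - v)"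
  proof (intro exI[of _ "min (v - l) (r - v)"] conjI allI impI)
    fix y assume "norm (y - v) < min (v - l) (r - v)"
    then have "l \<le> y" "y \<le> r" by (auto simp: abs_if split: if_splits)
    then show "norm (extension x y - extension x v - d * (y - v)) \<le> e * norm (y - v)" using main by simp
  qed (use l r in auto)
qed (rule bounded_linear_mult_right)

end

text \<open>(A2) speaks of \<open>\<alpha>\<close> at values of \<open>\<sigma>\<close> only, and
  neither a right-scattered \<open>t0\<close> nor a left-dense right-scattered point is such a
  value. There \<open>not_advanced\<close> keeps the equation from reading beyond
  \<open>\<sigma> t\<close>.\<close>

locale delay_dynamic_equation = unbounded_time_scale +
  fixes A \<alpha> :: "real \<Rightarrow> real"
  assumes A_rd: "rd_continuous_on (T \<inter> {t0..}) A"
    and A_nonneg: "t \<in> T \<Longrightarrow> t0 \<le> t \<Longrightarrow> 0 \<le> A t"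
    and \<alpha>_rd: "rd_continuous_on (T \<inter> {t0..}) \<alpha>"
    and \<alpha>_in: "t \<in> T \<Longrightarrow> t0 \<le> t \<Longrightarrow> \<alpha> t \<in> T"
    and \<alpha>_lim: "filterlim \<alpha> at_top (inf at_top (principal (T \<inter> {t0..})))"
    and delay: "(\<forall>t\<in>T \<inter> {t0..}. \<alpha> t \<le> t) \<or> (\<forall>t\<in>T \<inter> {t0..}. \<alpha> (\<sigma> t) \<le> t)"
    and not_advanced: "t \<in> T \<Longrightarrow> t0 \<le> t \<Longrightarrow> \<alpha> t \<le> \<sigma> t"
begin

text \<open>Where \<open>\<alpha> t = \<sigma> t > t\<close> the equation is implicit in \<open>x (\<sigma> t)\<close>. Solving for it gives an
  equation with delay \<open>\<alpha>' t = t\<close> and the smaller coefficient \<open>A' t\<close>.\<close>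

definition \<alpha>' :: "real \<Rightarrow> real" where "\<alpha>' t = min (\<alpha> t) t"

definition A' :: "real \<Rightarrow> real" where
  "A' t = (if t < \<alpha> t then A t / (1 + A t * (\<sigma> t - t)) else A t)"

text \<open>Interpolating \<open>x\<close> linearly across the gaps of \<open>T\<close> turns the dynamic equation into the
  delay differential equation \<open>y'(v) = - a v * y (\<beta> v)\<close> on the real line.\<close>

definition a :: "real \<Rightarrow> real" where "a v = A' (ts_floor v)"

definition \<beta> :: "real \<Rightarrow> real" where "\<beta> v = \<alpha>' (ts_floor v)"

lemma A'_nonneg: "t \<in> T \<Longrightarrow> t0 \<le> t \<Longrightarrow> 0 \<le> A' t"
  using A_nonneg \<sigma>_ge[of t] by (auto simp: A'_def intro!: divide_nonneg_nonneg add_nonneg_nonneg mult_nonneg_nonneg)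

lemma A'_le: "t \<in> T \<Longrightarrow> t0 \<le> t \<Longrightarrow> A' t \<le> A t"
proof -
  assume t: "t \<in> T" "t0 \<le> t"
  have "A t \<ge> 0" "A t * (\<sigma> t - t) \<ge> 0" using A_nonneg[OF t] \<sigma>_ge[of t] by auto
  then have "A t / (1 + A t * (\<sigma> t - t)) \<le> A t / 1" by (intro divide_left_mono) auto
  then show ?thesis by (simp add: A'_def)
qed

lemma a_nonneg: "0 \<le> a v"
  unfolding a_def using floor_in floor_ge by (intro A'_nonneg)

lemma a_le: "a v \<le> A (ts_floor v)"
  unfolding a_def using floor_in floor_ge by (intro A'_le)

lemma \<alpha>'_in: "t \<in> T \<Longrightarrow> t0 \<le> t \<Longrightarrow> \<alpha>' t \<in> T"
  using \<alpha>_in by (auto simp: \<alpha>'_def min_def)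

lemma \<beta>_in: "\<beta> v \<in> T"
  unfolding \<beta>_def using floor_in floor_ge by (intro \<alpha>'_in)

sublocale linear_delay a \<beta> t0
proof
  have fl: "ts_floor \<in> borel_measurable borel"
    by (rule borel_measurable_mono) (auto simp: mono_def floor_mono)
  have \<sigma>fl: "(\<lambda>v. \<sigma> (ts_floor v)) \<in> borel_measurable borel"
    by (rule borel_measurable_mono) (auto simp: mono_def intro: floor_mono \<sigma>_mono)
  note [measurable] = fl \<sigma>fl borel_measurable_comp_floor[OF A_rd] borel_measurable_comp_floor[OF \<alpha>_rd]
  show "a \<in> borel_measurable borel"
    unfolding a_def A'_def by measurable
  show "\<beta> \<in> borel_measurable borel"
    unfolding \<beta>_def \<alpha>'_def by measurable
  show "\<exists>L. \<forall>v\<in>{t0..b}. \<bar>a v\<bar> \<le> L" for b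
  proof -
    obtain L where L: "\<And>t. t \<in> T \<Longrightarrow> t0 \<le> t \<Longrightarrow> t \<le> b \<Longrightarrow> \<bar>A t\<bar> \<le> L"
      using rd_continuous_bounded[OF A_rd] by blast
    have "\<bar>a v\<bar> \<le> L" if "v \<in> {t0..b}" for v
      using L[of "ts_floor v"] floor_in[of v] floor_ge[of v] floor_le[of v] that a_nonneg[of v] a_le[of v] by auto
    then show ?thesis by blast
  qed
  show "\<beta> v \<le> v" if "t0 \<le> v" for v
    using floor_le[OF that] by (simp add: \<beta>_def \<alpha>'_def min.coboundedI2)
qed

text \<open>\<open>T\<close> has no points strictly between \<open>t\<close> and
  \<open>\<sigma> t\<close>, so an argument beyond \<open>t\<close> that is not beyond
  \<open>\<sigma> t\<close> must be \<open>\<sigma> t\<close>.\<close>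

lemma \<alpha>_cases:
  assumes "t \<in> T" "t0 \<le> t"
  obtains "\<alpha> t \<le> t" "\<alpha>' t = \<alpha> t" "A' t = A t"
  | "t < \<sigma> t" "\<alpha> t = \<sigma> t" "\<alpha>' t = t" "A' t = A t / (1 + A t * (\<sigma> t - t))"
proof (cases "\<alpha> t \<le> t")
  case True
  then show thesis by (intro that(1)) (auto simp: \<alpha>'_def A'_def)
next
  case False
  then have "\<alpha> t = \<sigma> t" using \<sigma>_le[OF \<alpha>_in[OF assms], of t] not_advanced[OF assms] by simp
  then show thesis using False by (intro that(2)) (auto simp: \<alpha>'_def A'_def)
qed

text \<open>In the implicit case \<open>x (\<sigma> t) = x t + d * (\<sigma> t - t)\<close> turns
  the equation into a linear one for \<open>d\<close>, whose coefficient
  \<open>1 + A t * (\<sigma> t - t)\<close> is positive because \<open>A\<close> is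
  nonnegative.\<close>

lemma equation_iff:
  assumes t: "t \<in> T" "s \<le> t" "t0 \<le> s" and D: "has_delta_derivative (T \<inter> {s..}) x d t"
  shows "d + A t * x (\<alpha> t) = 0 \<longleftrightarrow> d = - (A' t * x (\<alpha>' t))"
proof -
  have "t0 \<le> t" using t by simp
  from t(1) this show ?thesis
  proof (cases rule: \<alpha>_cases)
    case 1
    then show ?thesis by (auto simp: algebra_simps)
  next
    case 2
    define c where "c = 1 + A t * (\<sigma> t - t)"
    have "c > 0" using A_nonneg[of t] t 2 by (auto simp: c_def intro!: add_pos_nonneg)
    have x\<sigma>: "x (\<sigma> t) = x t + d * (\<sigma> t - t)"
      using delta_derivative_right_scattered[OF D t(1,2)] by simp
    then have "d + A t * x (\<alpha> t) = c * d + A t * x t"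
      unfolding 2(2) x\<sigma> c_def by (simp add: algebra_simps)
    moreover have "c * d + A t * x t = 0 \<longleftrightarrow> d = - (A t / c * x t)"
      using \<open>c > 0\<close> by (auto simp: field_simps)
    ultimately show ?thesis unfolding 2(3,4) c_def by simp
  qed
qed

text \<open>The interpolated solution is Lipschitz and has slope
  \<open>- (a v * x (\<beta> v))\<close> off a null set: in a gap this is the equation at its left
  end, elsewhere the derivative within \<open>T\<close> becomes a two-sided one.\<close>

lemma solution_imp_integral:
  assumes s: "s \<in> T" "t0 \<le> s" and sol: "solution T A \<alpha> s x0 \<phi> x" and t: "t \<in> T" "s \<le> t"
  shows "((\<lambda>v. a v * x (\<beta> v)) has_integral x0 - x t) {s..t}"
proof -
  have "\<forall>b. \<exists>L. L-lipschitz_on (T \<inter> {s..b}) x" using sol by (simp add: solution_def)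
  then obtain L where L: "L-lipschitz_on (T \<inter> {s..t}) x" by blast
  obtain N where N: "delta_null (T \<inter> {s..}) N"
    and eq: "\<And>t. t \<in> T \<inter> {s..} - N \<Longrightarrow> \<exists>d. has_delta_derivative (T \<inter> {s..}) x d t \<and> d + A t * x (\<alpha> t) = 0"
    using sol unfolding solution_def by blast
  have eq': "has_delta_derivative (T \<inter> {s..}) x (- (A' t * x (\<alpha>' t))) t" if "t \<in> T" "s \<le> t" "t \<notin> N" for t
    using eq[of t] equation_iff[OF that(1,2) s(2), of x] that by auto
  have "((\<lambda>v. - (a v * x (\<beta> v))) has_integral extension x t - extension x s) {s..t}"
  proof (rule has_integral_lipschitz_derivative[OF extension_lipschitz[OF L s(1) t(1) s(2)] t(2)])
    show "negligible (N \<union> irregular)"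
      using N negligible_irregular by (auto simp: delta_null_def)
    fix v assume v: "v \<in> {s<..<t}" "v \<notin> N \<union> irregular"
    show "(extension x has_real_derivative - (a v * x (\<beta> v))) (at v)"
    proof (cases "v \<in> T")
      case True
      then have "\<sigma> v = v" using regular_dense(1)[of v] v s by auto
      then have "(x has_real_derivative - (A' v * x (\<alpha>' v))) (at v within T \<inter> {s..})"
        using eq'[of v] delta_derivative_right_dense[of s v] True v by auto
      then have "(extension x has_real_derivative - (A' v * x (\<alpha>' v))) (at v)"
        using extension_derivative_dense[of v s] True v s by auto
      then show ?thesis using True v s by (simp add: a_def \<beta>_def floor_id)
    next
      case False
      let ?p = "ts_floor v"
      have p: "?p \<in> T" "s \<le> ?p" "?p < \<sigma> ?p"
        using floor_in[of v] floor_greatest[of s v] not_in_gap[of v] v s False by auto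
      \<comment> \<open>One exceptional left end would spoil a whole gap; this cannot happen since
        delta-null sets contain only right-dense points.\<close>
      then have "\<not> right_dense (T \<inter> {s..}) ?p" by (simp add: right_dense_restrict)
      then have "?p \<notin> N" using N by (auto simp: delta_null_def)
      from delta_derivative_right_scattered[OF eq'[OF p(1,2) this] p(1,2)]
      have "(x (\<sigma> ?p) - x ?p) / (\<sigma> ?p - ?p) = - (a v * x (\<beta> v))"
        using p by (simp add: a_def \<beta>_def)
      then show ?thesis using extension_derivative_gap[of v x] v s False by auto
    qed
  qed
  from has_integral_neg[OF this] show ?thesis
    using s t sol by (simp add: extension_id solution_def)
qed

lemma \<alpha>_eventually_ge:
  obtains B where "t0 \<le> B" "\<And>t. t \<in> T \<Longrightarrow> B \<le> t \<Longrightarrow> c \<le> \<alpha> t"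
proof -
  have "\<forall>\<^sub>F t in inf at_top (principal (T \<inter> {t0..})). c \<le> \<alpha> t"
    using \<alpha>_lim by (simp add: filterlim_at_top)
  then obtain B where B: "\<And>t. B \<le> t \<Longrightarrow> t \<in> T \<inter> {t0..} \<Longrightarrow> c \<le> \<alpha> t"
    by (auto simp: eventually_inf_principal eventually_at_top_linorder)
  show thesis by (rule that[of "max B t0"]) (use B in auto)
qed

text \<open>\<open>\<alpha>\<close> is bounded on compact parts and nonnegative near infinity; this
  makes the infimum in \<open>alpha_star\<close> a genuine one.\<close>

lemma \<alpha>_bdd_below: "bdd_below (\<alpha> ` (T \<inter> {t0..}))"
proof -
  obtain B where B: "t0 \<le> B" "\<And>t. t \<in> T \<Longrightarrow> B \<le> t \<Longrightarrow> 0 \<le> \<alpha> t" using \<alpha>_eventually_ge[of 0] by metis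
  obtain L where L: "\<And>t. t \<in> T \<Longrightarrow> t0 \<le> t \<Longrightarrow> t \<le> B \<Longrightarrow> \<bar>\<alpha> t\<bar> \<le> L"
    using rd_continuous_bounded[OF \<alpha>_rd] by blast
  show ?thesis
  proof (rule bdd_belowI2)
    fix t assume "t \<in> T \<inter> {t0..}"
    then show "min 0 (- L) \<le> \<alpha> t" using B(2)[of t] L[of t] by (cases "t \<le> B") auto
  qed
qed

lemma alpha_star_le: "t \<in> T \<Longrightarrow> t0 \<le> s \<Longrightarrow> s \<le> t \<Longrightarrow> alpha_star T \<alpha> s \<le> \<alpha> t"
  unfolding alpha_star_def by (intro cINF_lower bdd_below_mono[OF \<alpha>_bdd_below]) auto

text \<open>The infimum includes \<open>\<alpha> s\<close> and \<open>\<alpha> (\<sigma> s)\<close>,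
  and the first (A1) or the second (A2) is at most \<open>s\<close>. Hence \<open>s\<close> lies in
  the domain of the solutions that start at \<open>s\<close>.\<close>

lemma alpha_star_le_self:
  assumes "s \<in> T" "t0 \<le> s"
  shows "alpha_star T \<alpha> s \<le> s"
  using delay
proof
  assume "\<forall>t\<in>T \<inter> {t0..}. \<alpha> t \<le> t"
  then show ?thesis using alpha_star_le[of s s] assms by force
next
  assume "\<forall>t\<in>T \<inter> {t0..}. \<alpha> (\<sigma> t) \<le> t"
  then show ?thesis using alpha_star_le[of "\<sigma> s" s] \<sigma>_in[of s] \<sigma>_ge[of s] assms by force
qed

lemma \<beta>_history:
  assumes s: "s \<in> T" "t0 \<le> s" and v: "s \<le> v" and less: "\<beta> v < s"
  shows "\<beta> v \<in> T \<inter> {alpha_star T \<alpha> s..<s}" and "\<beta> v = \<alpha> (ts_floor v)"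
proof -
  have p: "ts_floor v \<in> T" "s \<le> ts_floor v" using floor_in floor_greatest assms by auto
  then show eq: "\<beta> v = \<alpha> (ts_floor v)" using less by (auto simp: \<beta>_def \<alpha>'_def min_def split: if_splits)
  show "\<beta> v \<in> T \<inter> {alpha_star T \<alpha> s..<s}"
    using less \<beta>_in[of v] alpha_star_le[OF p(1) s(2) p(2)] eq by auto
qed

text \<open>The integral equation is differentiated: almost everywhere by Lebesgue differentiation
  at right-dense points, and over the whole gap at right-scattered ones. Local boundedness of the
  integrand gives the Lipschitz condition.\<close>

lemma fundamental_imp_solution:
  assumes s: "s \<in> T" "t0 \<le> s" and y: "fundamental s y"
  defines "R \<equiv> T \<inter> {alpha_star T \<alpha> s..}"
  shows "solution T A \<alpha> s 1 (\<lambda>_. 0) (restrict y R)"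
proof -
  let ?x = "restrict y R"
  have star: "alpha_star T \<alpha> s \<le> s" by (rule alpha_star_le_self[OF s])
  have x_eq: "?x t = y t" if "t \<in> T" "alpha_star T \<alpha> s \<le> t" for t using that by (simp add: R_def)
  have x_eq': "?x t = y t" if "t \<in> T" "s \<le> t" for t using that star by (intro x_eq) auto
  have y0: "y t = 0" if "t < s" for t using y that by (simp add: fundamental_def)
  have x0: "?x t = 0" if "t \<in> T" "alpha_star T \<alpha> s \<le> t" "t < s" for t
    using x_eq[OF that(1,2)] y0[OF that(3)] by simp
  have y_int: "((\<lambda>v. a v * y (\<beta> v)) has_integral 1 - y t) {s..t}" if "s \<le> t" for t
    using y that by (simp add: fundamental_def)
  have y1: "y s = 1" by (rule fundamental_at_start[OF y])
  have int: "(\<lambda>v. a v * y (\<beta> v)) integrable_on {u..t}" if "s \<le> u" for u t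
    using y that s by (intro delayed_product_integrable[of _ s]) (auto simp: fundamental_def)
  have y_diff: "y u - y t = integral {u..t} (\<lambda>v. a v * y (\<beta> v))" if "s \<le> u" "u \<le> t" for u t
    using Henstock_Kurzweil_Integration.integral_combine[OF that int[OF order_refl]]
      integral_unique[OF y_int[of u]] integral_unique[OF y_int[of t]] that by simp
  have bounded: "\<exists>C. \<forall>v\<in>{s..b}. \<bar>a v * y (\<beta> v)\<bar> \<le> C" for b
  proof -
    obtain C where C: "C \<ge> 0" "\<And>t. t \<le> b \<Longrightarrow> \<bar>y t\<bar> \<le> C"
      using truncated_bounded[of s y b] y by (auto simp: fundamental_def)
    obtain L where L: "\<And>v. v \<in> {t0..b} \<Longrightarrow> \<bar>a v\<bar> \<le> L" using a_locally_bounded by metis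
    have "\<bar>a v * y (\<beta> v)\<bar> \<le> L * C" if "v \<in> {s..b}" for v
      unfolding abs_mult using C L[of v] \<beta>_le[of v] that s by (intro mult_mono) auto
    then show ?thesis by blast
  qed
  have lip: "\<exists>L. L-lipschitz_on (T \<inter> {s..b}) ?x" for b
  proof -
    obtain C where C: "\<And>v. v \<in> {s..b} \<Longrightarrow> \<bar>a v * y (\<beta> v)\<bar> \<le> C" using bounded by blast
    have le: "\<bar>y u - y t\<bar> \<le> max C 0 * (t - u)" if "s \<le> u" "u \<le> t" "t \<le> b" for u t
      unfolding y_diff[OF that(1,2)] using C that int
      by (intro abs_integral_le_const) (auto simp: le_max_iff_disj)
    have "(max C 0)-lipschitz_on (T \<inter> {s..b}) ?x"
    proof (rule lipschitz_onI)
      fix u t assume ut: "u \<in> T \<inter> {s..b}" "t \<in> T \<inter> {s..b}"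
      then have "dist (y u) (y t) \<le> max C 0 * dist u t"
        using le[of u t] le[of t u] by (cases "u \<le> t") (auto simp: dist_real_def abs_minus_commute)
      then show "dist (?x u) (?x t) \<le> max C 0 * dist u t" using x_eq' ut by simp
    qed auto
    then show ?thesis ..
  qed
  \<comment> \<open>The differentiation theorem needs a bounded integrand on a compact interval, so
    the half-line is exhausted by countably many.\<close>
  have "\<forall>n. \<exists>N. negligible N \<and> (\<forall>v. v \<in> {s<..<s + real (Suc n)} \<longrightarrow> v \<notin> N \<longrightarrow>
      ((\<lambda>t. integral {s..t} (\<lambda>v. a v * y (\<beta> v))) has_real_derivative a v * y (\<beta> v)) (at v))"
  proof
    fix n
    obtain C where C: "\<And>v. v \<in> {s..s + real (Suc n)} \<Longrightarrow> \<bar>a v * y (\<beta> v)\<bar> \<le> C" using bounded by blast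
    have "(\<lambda>v. y (\<beta> v)) \<in> borel_measurable borel"
      using measurable_compose[OF \<beta>_borel borel_measurable_truncated[of s y]] y by (simp add: fundamental_def)
    then have meas: "(\<lambda>v. a v * y (\<beta> v)) \<in> borel_measurable borel"
      by (intro borel_measurable_times a_borel)
    have le: "s \<le> s + real (Suc n)" by simp
    show "\<exists>N. negligible N \<and> (\<forall>v. v \<in> {s<..<s + real (Suc n)} \<longrightarrow> v \<notin> N \<longrightarrow>
      ((\<lambda>t. integral {s..t} (\<lambda>v. a v * y (\<beta> v))) has_real_derivative a v * y (\<beta> v)) (at v))"
      by (rule indefinite_integral_derivative_ae[OF meas le C]) (assumption, blast)
  qed
  then obtain N where N: "\<And>n. negligible (N n)" "\<And>n v. v \<in> {s<..<s + real (Suc n)} \<Longrightarrow> v \<notin> N n \<Longrightarrow>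
      ((\<lambda>t. integral {s..t} (\<lambda>v. a v * y (\<beta> v))) has_real_derivative a v * y (\<beta> v)) (at v)"
    by metis
  \<comment> \<open>A delta-null set may contain right-dense points only, so all others are removed.
    \<open>s\<close> is added because \<open>y\<close> jumps there and only two-sided derivatives
    are at hand.\<close>
  define M where "M = {t \<in> T \<inter> {s..}. \<sigma> t = t \<and> t \<in> insert s (\<Union>n. N n)}"
  have "negligible (insert s (\<Union>n. N n))"
    using negligible_countable_Union[of "range N"] N(1) by auto
  then have "negligible M" by (rule negligible_subset) (auto simp: M_def)
  then have M_null: "delta_null (T \<inter> {s..}) M"
    by (auto simp: delta_null_def M_def right_dense_restrict)
  have y_deriv: "(y has_real_derivative - (a v * y (\<beta> v))) (at v)" if v: "s < v" "v \<notin> (\<Union>n. N n)" for v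
  proof -
    obtain n where "v - s < real n" using reals_Archimedean2 by blast
    then have "((\<lambda>t. integral {s..t} (\<lambda>v. a v * y (\<beta> v))) has_real_derivative a v * y (\<beta> v)) (at v)"
      using v by (intro N(2)[of _ n]) auto
    then have "((\<lambda>t. 1 - integral {s..t} (\<lambda>v. a v * y (\<beta> v))) has_real_derivative - (a v * y (\<beta> v))) (at v)"
      by (auto intro!: derivative_eq_intros)
    moreover have "\<forall>\<^sub>F t in nhds v. y t = 1 - integral {s..t} (\<lambda>v. a v * y (\<beta> v))"
      by (rule eventually_nhds_in_open[of "{s<..}", THEN eventually_mono])
        (use v integral_unique[OF y_int] in auto)
    ultimately show ?thesis by (subst DERIV_cong_ev[OF refl _ refl])
  qed
  have delta: "has_delta_derivative (T \<inter> {s..}) ?x (- (A' t * ?x (\<alpha>' t))) t"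
    if t: "t \<in> T" "s \<le> t" "t \<notin> M" for t
  proof -
    have t0t: "t0 \<le> t" using t s by simp
    have "alpha_star T \<alpha> s \<le> \<alpha>' t"
      using alpha_star_le[OF t(1) s(2) t(2)] star t by (simp add: \<alpha>'_def)
    then have x\<alpha>: "?x (\<alpha>' t) = y (\<alpha>' t)" using \<alpha>'_in[OF t(1) t0t] by (intro x_eq)
    have fl: "a t * y (\<beta> t) = A' t * y (\<alpha>' t)" using t t0t by (simp add: a_def \<beta>_def floor_id)
    have "has_delta_derivative (T \<inter> {s..}) y (- (A' t * y (\<alpha>' t))) t"
    proof (cases "\<sigma> t = t")
      case True
      then have "t \<noteq> s" "t \<notin> (\<Union>n. N n)" using t by (auto simp: M_def)
      then have "(y has_real_derivative - (a t * y (\<beta> t))) (at t)" using t by (intro y_deriv) auto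
      then have "(y has_real_derivative - (A' t * y (\<alpha>' t))) (at t within T \<inter> {s..})"
        unfolding fl by (rule has_field_derivative_at_within)
      then show ?thesis using delta_derivative_right_dense[OF t(2) True] by simp
    next
      case False
      then have lt: "t < \<sigma> t" using \<sigma>_ge[of t] by simp
      show ?thesis
      proof (rule has_delta_derivative_right_scatteredI[OF t(2) lt])
        have "continuous_on {s..} y" using y by (simp add: fundamental_def)
        then show "continuous (at t within T \<inter> {s..}) y"
          using t by (auto simp: continuous_on_eq_continuous_within intro: continuous_within_subset)
        have "((\<lambda>v. a v * y (\<beta> v)) has_integral A' t * y (\<alpha>' t) * (\<sigma> t - t)) {t..\<sigma> t}"
          using has_integral_gap[OF t(1) t0t, of "\<lambda>p. A' p * y (\<alpha>' p)"] by (simp add: a_def \<beta>_def)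
        then show "y (\<sigma> t) - y t = - (A' t * y (\<alpha>' t)) * (\<sigma> t - t)"
          using y_diff[OF t(2), of "\<sigma> t"] lt by (simp add: integral_unique)
      qed
    qed
    then show ?thesis
      unfolding x\<alpha> using x_eq' \<sigma>_in \<sigma>_ge[of t] t
      by (subst has_delta_derivative_cong[of _ _ y]) (auto simp: fwd_jump_restrict)
  qed
  show ?thesis
    unfolding solution_def
  proof (intro conjI allI exI[of _ M] ballI)
    show "rd_continuous_on (T \<inter> {alpha_star T \<alpha> s..s}) ?x"
    proof -
      \<comment> \<open>The restricted function is 0 near every point before \<open>s\<close> and on
        the left of \<open>s\<close>. Its value 1 at \<open>s\<close> is no obstruction, since
        \<open>s\<close> is the greatest point of the initial interval and hence not right-dense
        there.\<close>
      have ev: "\<forall>\<^sub>F r in at t within F. ?x r = 0"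
        if "t \<le> s" "F \<subseteq> T \<inter> {alpha_star T \<alpha> s..s}" "t < s \<or> F \<subseteq> {..<t}" for t F
        using that(3)
      proof
        assume "t < s"
        then have "\<forall>\<^sub>F r in at t within F. r \<in> {..<s} \<and> r \<in> F"
          unfolding eventually_at_topological by (intro exI[of _ "{..<s}"]) auto
        then show ?thesis by eventually_elim (rule x0; use that in auto)
      next
        assume "F \<subseteq> {..<t}"
        then have "\<forall>\<^sub>F r in at t within F. r \<in> {..<s} \<and> r \<in> F"
          using that(1) unfolding eventually_at_topological by (intro exI[of _ UNIV]) auto
        then show ?thesis by eventually_elim (rule x0; use that in auto)
      qed
      have "continuous (at t within T \<inter> {alpha_star T \<alpha> s..s}) ?x"
        if "right_dense (T \<inter> {alpha_star T \<alpha> s..s}) t" for t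
      proof -
        have t: "t \<in> T" "alpha_star T \<alpha> s \<le> t" "t < s" using that by (auto simp: right_dense_def)
        then have "?x t = 0" by (rule x0)
        then show ?thesis
          unfolding continuous_within using t by (auto intro!: tendsto_eventually ev)
      qed
      moreover have "\<exists>l. (?x \<longlongrightarrow> l) (at t within T \<inter> {alpha_star T \<alpha> s..s} \<inter> {..<t})"
        if "left_dense (T \<inter> {alpha_star T \<alpha> s..s}) t" for t
        using that by (intro exI[of _ 0] tendsto_eventually ev) (auto simp: left_dense_def)
      ultimately show ?thesis by (simp add: rd_continuous_on_def)
    qed
    show "\<exists>L. L-lipschitz_on (T \<inter> {s..b}) ?x" for b by (rule lip)
    show "delta_null (T \<inter> {s..}) M" by (rule M_null)
    show "?x s = 1" using x_eq'[OF s(1)] y1 by simp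
    show "?x t = 0" if "t \<in> T \<inter> {alpha_star T \<alpha> s..<s}" for t using that x0[of t] by auto
    show "\<exists>d. has_delta_derivative (T \<inter> {s..}) ?x d t \<and> d + A t * ?x (\<alpha> t) = 0"
      if "t \<in> T \<inter> {s..} - M" for t
    proof -
      have t: "t \<in> T" "s \<le> t" "t \<notin> M" using that by auto
      show ?thesis using delta[OF t] equation_iff[OF t(1,2) s(2) delta[OF t]] by blast
    qed
  qed
qed

text \<open>As the histories agree, the difference may be set to 0 before \<open>s\<close>; it then
  satisfies the integral equation with zero data, and \<open>delay_gronwall\<close> applies with
  \<open>R = 0\<close>.\<close>

lemma solution_unique:
  assumes s: "s \<in> T" "t0 \<le> s" and sol: "solution T A \<alpha> s x0 \<phi> x" "solution T A \<alpha> s x0 \<phi> z"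
    and t: "t \<in> T" "s \<le> t"
  shows "x t = z t"
proof -
  define e where "e t = (if t < s then 0 else x t - z t)" for t
  obtain L where L: "\<And>v. v \<in> {t0..t} \<Longrightarrow> \<bar>a v\<bar> \<le> L" using a_locally_bounded by metis
  obtain Lx where Lx: "Lx-lipschitz_on (T \<inter> {s..t}) x" using sol(1) unfolding solution_def by blast
  obtain Lz where Lz: "Lz-lipschitz_on (T \<inter> {s..t}) z" using sol(2) unfolding solution_def by blast
  have "\<bar>e t\<bar> \<le> 2 * 0 * exp (2 * L * (t - s))"
  proof (rule delay_gronwall[where a = a and \<beta> = \<beta> and T = T and I = "\<lambda>t. - e t" and b = t
        and B = "(\<bar>x s\<bar> + Lx * (t - s)) + (\<bar>z s\<bar> + Lz * (t - s))"])
    show "\<bar>a v\<bar> \<le> L" "\<beta> v \<le> v" if "v \<in> {s..t}" for v using L[of v] \<beta>_le[of v] that s by auto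
    show "e (\<beta> v) = 0" if "\<beta> v < s" for v using that by (simp add: e_def)
    show "\<beta> v \<in> T" for v by (rule \<beta>_in)
    show "((\<lambda>v. a v * e (\<beta> v)) has_integral - e u) {s..u}" if u: "u \<in> T \<inter> {s..t}" for u
    proof -
      have "((\<lambda>v. a v * x (\<beta> v) - a v * z (\<beta> v)) has_integral (x0 - x u) - (x0 - z u)) {s..u}"
        using u by (intro has_integral_diff solution_imp_integral[OF s sol(1)] solution_imp_integral[OF s sol(2)]) auto
      moreover have "(x0 - x u) - (x0 - z u) = - e u" using u by (auto simp: e_def)
      ultimately have I: "((\<lambda>v. a v * x (\<beta> v) - a v * z (\<beta> v)) has_integral - e u) {s..u}" by simp
      show ?thesis
      proof (rule has_integral_spike[OF negligible_empty _ I])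
        fix v assume v: "v \<in> {s..u} - {}"
        show "a v * e (\<beta> v) = a v * x (\<beta> v) - a v * z (\<beta> v)"
        proof (cases "\<beta> v < s")
          case True
          then have "\<beta> v \<in> T \<inter> {alpha_star T \<alpha> s..<s}" using v by (intro \<beta>_history[OF s]) auto
          then have "x (\<beta> v) = z (\<beta> v)" using sol by (simp add: solution_def)
          then show ?thesis using True by (simp add: e_def)
        qed (simp add: e_def right_diff_distrib)
      qed
    qed
    show "\<bar>e u\<bar> \<le> (\<bar>x s\<bar> + Lx * (t - s)) + (\<bar>z s\<bar> + Lz * (t - s))" if "u \<in> T \<inter> {s..t}" for u
      using lipschitz_on_bounded[OF Lx s(1) that] lipschitz_on_bounded[OF Lz s(1) that] that by (auto simp: e_def)
  qed (use t in auto)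
  then show ?thesis using t by (simp add: e_def)
qed

lemma fundamental_solution_eq:
  assumes s: "s \<in> T" "t0 \<le> s" and y: "fundamental s y"
  defines "R \<equiv> T \<inter> {alpha_star T \<alpha> s..}"
  shows "(\<lambda>t. fundamental_solution T A \<alpha> t s) = restrict y R"
proof -
  have sol: "solution T A \<alpha> s 1 (\<lambda>_. 0) (restrict y R)"
    unfolding R_def by (rule fundamental_imp_solution[OF s y])
  have "(THE x. x \<in> extensional R \<and> solution T A \<alpha> s 1 (\<lambda>_. 0) x) = restrict y R"
  proof (rule the_equality)
    show "restrict y R \<in> extensional R \<and> solution T A \<alpha> s 1 (\<lambda>_. 0) (restrict y R)" using sol by simp
    fix x assume x: "x \<in> extensional R \<and> solution T A \<alpha> s 1 (\<lambda>_. 0) x"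
    show "x = restrict y R"
    proof (rule extensionalityI[of _ R])
      fix t assume t: "t \<in> R"
      show "x t = restrict y R t"
      proof (cases "t < s")
        case True
        then have "t \<in> T \<inter> {alpha_star T \<alpha> s..<s}" using t by (simp add: R_def)
        then show ?thesis using x sol unfolding solution_def by metis
      next
        case False
        then show ?thesis using solution_unique[OF s conjunct2[OF x] sol] t by (simp add: R_def)
      qed
    qed (use x in auto)
  qed
  then show ?thesis by (simp only: fundamental_solution_def R_def)
qed

end

section \<open>Stability\<close>

lemma solution_cmult:
  assumes "solution T A \<alpha> s x0 \<phi> x"
  shows "solution T A \<alpha> s (c * x0) (\<lambda>t. c * \<phi> t) (\<lambda>t. c * x t)"
  unfolding solution_def
proof (intro conjI)
  have rd: "rd_continuous_on (T \<inter> {alpha_star T \<alpha> s..s}) x" using assms by (simp add: solution_def)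
  show "rd_continuous_on (T \<inter> {alpha_star T \<alpha> s..s}) (\<lambda>t. c * x t)"
    unfolding rd_continuous_on_def
  proof (intro conjI allI impI)
    show "continuous (at t within T \<inter> {alpha_star T \<alpha> s..s}) (\<lambda>t. c * x t)"
      if "right_dense (T \<inter> {alpha_star T \<alpha> s..s}) t" for t
      using rd that by (auto simp: rd_continuous_on_def intro: continuous_mult_left)
    show "\<exists>l. ((\<lambda>t. c * x t) \<longlongrightarrow> l) (at t within T \<inter> {alpha_star T \<alpha> s..s} \<inter> {..<t})"
      if "left_dense (T \<inter> {alpha_star T \<alpha> s..s}) t" for t
      using rd that unfolding rd_continuous_on_def by (blast intro: tendsto_mult_left)
  qed
  have lip: "\<forall>b. \<exists>L. L-lipschitz_on (T \<inter> {s..b}) x" using assms by (simp add: solution_def)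
  show "\<forall>b. \<exists>L. L-lipschitz_on (T \<inter> {s..b}) (\<lambda>t. c * x t)"
  proof
    fix b
    obtain L where "L-lipschitz_on (T \<inter> {s..b}) x" using lip by blast
    then have "(\<bar>c\<bar> * L)-lipschitz_on (T \<inter> {s..b}) (\<lambda>t. c * x t)" by (rule lipschitz_on_cmult_real)
    then show "\<exists>L. L-lipschitz_on (T \<inter> {s..b}) (\<lambda>t. c * x t)" ..
  qed
  obtain N where N: "delta_null (T \<inter> {s..}) N"
    "\<forall>t\<in>T \<inter> {s..} - N. \<exists>d. has_delta_derivative (T \<inter> {s..}) x d t \<and> d + A t * x (\<alpha> t) = 0"
    using assms unfolding solution_def by blast
  have "\<exists>d. has_delta_derivative (T \<inter> {s..}) (\<lambda>t. c * x t) d t \<and> d + A t * (c * x (\<alpha> t)) = 0"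
    if t: "t \<in> T \<inter> {s..} - N" for t
  proof -
    obtain d where d: "has_delta_derivative (T \<inter> {s..}) x d t" "d + A t * x (\<alpha> t) = 0"
      using bspec[OF N(2) t] by blast
    have "c * d + A t * (c * x (\<alpha> t)) = c * (d + A t * x (\<alpha> t))" by (simp add: algebra_simps)
    then show ?thesis using has_delta_derivative_cmult[OF d(1), of c] d(2) by auto
  qed
  then show "\<exists>N. delta_null (T \<inter> {s..}) N \<and> (\<forall>t\<in>T \<inter> {s..} - N.
      \<exists>d. has_delta_derivative (T \<inter> {s..}) (\<lambda>t. c * x t) d t \<and> d + A t * (c * x (\<alpha> t)) = 0)"
    using N(1) by blast
qed (use assms in \<open>auto simp: solution_def\<close>)

context delay_dynamic_equation
begin

lemma fundamental_solution_value:
  assumes "s \<in> T" "t0 \<le> s" "fundamental s y" "t \<in> T" "s \<le> t"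
  shows "fundamental_solution T A \<alpha> t s = y t"
  using fun_cong[OF fundamental_solution_eq[OF assms(1-3)], of t] alpha_star_le_self[OF assms(1,2)] assms(4,5)
  by simp

lemma alpha_star_ge:
  assumes "\<And>t. t \<in> T \<Longrightarrow> s \<le> t \<Longrightarrow> c \<le> \<alpha> t"
  shows "c \<le> alpha_star T \<alpha> s"
proof -
  have "T \<inter> {s..} \<noteq> {}" using above_nonempty[of s] by auto
  then show ?thesis unfolding alpha_star_def using assms by (intro cINF_greatest) auto
qed

text \<open>The supremum is finite because \<alpha> tends to infinity, and it lies in
  \<open>T\<close> because \<open>T\<close> is closed. The last claim says that the initial function
  is never read by the equation at points of \<open>T\<close> beyond \<open>m\<close>.\<close>

lemma alpha_inv:
  assumes s: "s \<in> T" "t0 \<le> s"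
  defines "m \<equiv> alpha_inv T t0 \<alpha> s"
  shows "m \<in> T" "s \<le> m" "\<And>\<eta>. \<eta> \<in> T \<Longrightarrow> s \<le> \<eta> \<Longrightarrow> \<alpha> \<eta> \<le> s \<Longrightarrow> \<eta> \<le> m"
proof -
  define Q where "Q = {\<eta> \<in> T \<inter> {t0..}. alpha_star T \<alpha> \<eta> \<le> s}"
  have m: "m = Sup Q" by (simp add: m_def Q_def alpha_inv_def)
  have sQ: "s \<in> Q" using s alpha_star_le_self[OF s] by (simp add: Q_def)
  obtain B where B: "t0 \<le> B" "\<And>t. t \<in> T \<Longrightarrow> B \<le> t \<Longrightarrow> s + 1 \<le> \<alpha> t"
    using \<alpha>_eventually_ge[of "s + 1"] by metis
  have bdd: "bdd_above Q"
  proof (rule bdd_aboveI)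
    fix \<eta> assume \<eta>: "\<eta> \<in> Q"
    show "\<eta> \<le> B"
    proof (rule ccontr)
      assume "\<not> \<eta> \<le> B"
      then have "s + 1 \<le> alpha_star T \<alpha> \<eta>" using B(2) by (intro alpha_star_ge) auto
      then show False using \<eta> by (simp add: Q_def)
    qed
  qed
  have "m \<in> closure Q" unfolding m using sQ bdd by (intro closure_contains_Sup) auto
  moreover have "closure Q \<subseteq> T" using T_closed by (intro closure_minimal) (auto simp: Q_def)
  ultimately show "m \<in> T" by blast
  show "s \<le> m" unfolding m by (rule cSup_upper[OF sQ bdd])
  show "\<eta> \<le> m" if "\<eta> \<in> T" "s \<le> \<eta>" "\<alpha> \<eta> \<le> s" for \<eta>
    unfolding m
  proof (rule cSup_upper[OF _ bdd])
    have "alpha_star T \<alpha> \<eta> \<le> \<alpha> \<eta>" using that s by (intro alpha_star_le) auto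
    then show "\<eta> \<in> Q" using that s by (auto simp: Q_def)
  qed
qed

text \<open>The forcing is dominated by \<open>P\<close> times \<open>A\<close> on
  \<open>{s..m}\<close>, which the delta-integral measures, plus \<open>P\<close> times the constant
  \<open>A m\<close> on the gap after \<open>m\<close>, which \<open>C\<close> measures. The second
  part is present only if the equation at \<open>m\<close> still reads the initial function.\<close>

lemma history_integral_bound:
  assumes s: "s \<in> T" "t0 \<le> s" and "P \<ge> 0"
    and f_int: "(\<lambda>v. \<bar>f v\<bar>) integrable_on {s..b}"
    and f: "\<And>v. v \<in> {s..b} \<Longrightarrow> \<bar>f v\<bar> \<le> P * (if \<beta> v < s then a v else 0)"
  defines "m \<equiv> alpha_inv T t0 \<alpha> s"
  assumes K: "delta_integral (T \<inter> {t0..}) A s m \<le> K"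
    and C: "0 \<le> C" "\<alpha> m < s \<Longrightarrow> A m * (\<sigma> m - m) \<le> C"
  shows "integral {s..b} (\<lambda>v. \<bar>f v\<bar>) \<le> P * (K + C)"
proof -
  note m = alpha_inv[OF s, folded m_def]
  have t0m: "t0 \<le> m" using m(2) s by simp
  define c where "c = (if \<alpha> m < s then A m else 0)"
  have c: "c \<ge> 0" "c * (\<sigma> m - m) \<le> C" using A_nonneg[OF m(1) t0m] C by (auto simp: c_def)
  define g1 where "g1 v = (if v \<in> {s..m} then A (ts_floor v) else 0)" for v
  define g2 where "g2 v = (if v \<in> {m..\<sigma> m} then c else 0)" for v
  have A_fl: "A (ts_floor v) \<ge> 0" for v using floor_in floor_ge by (intro A_nonneg)
  define b' where "b' = max b (\<sigma> m)"
  have "(g1 has_integral integral {s..m} (\<lambda>v. A (ts_floor v))) {s..b'}"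
    unfolding g1_def using \<sigma>_ge[of m]
    by (subst has_integral_restrict) (auto simp: b'_def intro!: integrable_integral comp_floor_integrable A_rd)
  then have g1: "(g1 has_integral delta_integral (T \<inter> {t0..}) A s m) {s..b'}"
    using delta_integral_eq_integral[OF A_rd s m(1,2)] by simp
  have "((\<lambda>_. c) has_integral c * (\<sigma> m - m)) {m..\<sigma> m}"
    using has_integral_const_real[of c m "\<sigma> m"] \<sigma>_ge[of m] by (simp add: mult.commute)
  then have g2: "(g2 has_integral c * (\<sigma> m - m)) {s..b'}"
    unfolding g2_def using m(2) by (subst has_integral_restrict) (auto simp: b'_def)
  have g: "((\<lambda>v. P * (g1 v + g2 v)) has_integral P * (delta_integral (T \<inter> {t0..}) A s m + c * (\<sigma> m - m))) {s..b'}"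
    by (intro has_integral_mult_right has_integral_add g1 g2)
  have g_nonneg: "0 \<le> g1 v" "0 \<le> g2 v" for v using A_fl c by (auto simp: g1_def g2_def)
  have le: "(if \<beta> v < s then a v else 0) \<le> g1 v + g2 v" if v: "v \<in> {s..b}" for v
  proof (cases "\<beta> v < s")
    case True
    let ?p = "ts_floor v"
    have v': "s \<le> v" "t0 \<le> v" using v s by auto
    have p: "?p \<in> T" "s \<le> ?p" using floor_in floor_greatest s v by auto
    have \<alpha>p: "\<alpha> ?p < s" using \<beta>_history(2)[OF s v'(1) True] True by simp
    then have pm: "?p \<le> m" using m(3)[OF p] by simp
    show ?thesis
    proof (cases "v \<le> m")
      case True
      then show ?thesis using a_le[of v] a_nonneg[of v] g_nonneg[of v] v by (auto simp: g1_def)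
    next
      \<comment> \<open>Past \<open>m\<close> only the gap that follows \<open>m\<close> remains,
        because the floor of \<open>v\<close> is at most \<open>m\<close>.\<close>
      case False
      then have "m \<le> ?p" using floor_greatest[OF m(1) t0m] by simp
      then have eq: "?p = m" using pm by simp
      then have "v \<notin> T" using False floor_id[of v] v' by auto
      then have "v < \<sigma> m" using not_in_gap[of v] v' eq by simp
      then have "g2 v = A m" using False \<alpha>p eq by (simp add: g2_def c_def)
      then show ?thesis using a_le[of v] eq g_nonneg(1)[of v] True by simp
    qed
  qed (use g_nonneg[of v] in simp)
  have "integral {s..b} (\<lambda>v. \<bar>f v\<bar>) \<le> integral {s..b} (\<lambda>v. P * (g1 v + g2 v))"
  proof (rule integral_le[OF f_int])
    show "(\<lambda>v. P * (g1 v + g2 v)) integrable_on {s..b}"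
      by (rule integrable_on_subinterval[OF has_integral_integrable[OF g]]) (auto simp: b'_def)
    show "\<bar>f v\<bar> \<le> P * (g1 v + g2 v)" if "v \<in> {s..b}" for v
      using f[OF that] mult_left_mono[OF le[OF that] \<open>P \<ge> 0\<close>] by linarith
  qed
  also have "\<dots> \<le> integral {s..b'} (\<lambda>v. P * (g1 v + g2 v))"
  proof (rule integral_subset_le)
    show "(\<lambda>v. P * (g1 v + g2 v)) integrable_on {s..b}"
      by (rule integrable_on_subinterval[OF has_integral_integrable[OF g]]) (auto simp: b'_def)
  qed (use g g_nonneg \<open>P \<ge> 0\<close> in \<open>auto simp: b'_def\<close>)
  also have "\<dots> = P * (delta_integral (T \<inter> {t0..}) A s m + c * (\<sigma> m - m))"
    by (rule integral_unique[OF g])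
  also have "\<dots> \<le> P * (K + C)" using K c \<open>P \<ge> 0\<close> by (intro mult_left_mono add_mono)
  finally show ?thesis .
qed

text \<open>The integral of \<open>A\<close> up to \<open>m = \<alpha>\<^sub>-\<^sub>1(s)\<close> leaves out the gap to the right of \<open>m\<close>, although
  \<open>\<alpha> m < s\<close> is possible. The fundamental solution started at \<open>\<alpha> m\<close> has slope \<open>- A m\<close> on this gap,
  so that its boundedness controls \<open>A m * (\<sigma> m - m)\<close>.\<close>

lemma delayed_gap_bound:
  assumes M: "\<forall>t\<in>T. \<forall>s\<in>T. t0 \<le> s \<and> s \<le> t \<longrightarrow> \<bar>fundamental_solution T A \<alpha> t s\<bar> \<le> M"
  shows "\<exists>C\<ge>0. \<forall>m\<in>T. t0 \<le> m \<longrightarrow> \<alpha> m \<le> m \<longrightarrow> A m * (\<sigma> m - m) \<le> C"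
proof -
  obtain B where B: "t0 \<le> B" "\<And>t. t \<in> T \<Longrightarrow> B \<le> t \<Longrightarrow> t0 \<le> \<alpha> t"
    using \<alpha>_eventually_ge[of t0] by metis
  obtain L where L: "\<And>t. t \<in> T \<Longrightarrow> t0 \<le> t \<Longrightarrow> t \<le> B \<Longrightarrow> \<bar>A t\<bar> \<le> L"
    using rd_continuous_bounded[OF A_rd] by blast
  have L0: "L \<ge> 0" using L[OF t0_in] B(1) by force
  have late: "A m * (\<sigma> m - m) \<le> 2 * M" if m: "m \<in> T" "t0 \<le> m" "\<alpha> m \<le> m" "t0 \<le> \<alpha> m" for m
  proof -
    have \<alpha>m: "\<alpha> m \<in> T" by (rule \<alpha>_in[OF m(1,2)])
    obtain y where y: "fundamental (\<alpha> m) y" using fundamental_exists[OF m(4)] by blast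
    have "((\<lambda>v. a v * y (\<beta> v)) has_integral A' m * y (\<alpha>' m) * (\<sigma> m - m)) {m..\<sigma> m}"
      using has_integral_gap[OF m(1,2), of "\<lambda>p. A' p * y (\<alpha>' p)"] by (simp add: a_def \<beta>_def)
    moreover have "A' m = A m" "\<alpha>' m = \<alpha> m" using m(3) by (auto simp: A'_def \<alpha>'_def)
    ultimately have gap: "((\<lambda>v. a v * y (\<beta> v)) has_integral A m * (\<sigma> m - m)) {m..\<sigma> m}"
      using fundamental_at_start[OF y] by simp
    have 1: "((\<lambda>v. a v * y (\<beta> v)) has_integral 1 - y m + A m * (\<sigma> m - m)) {\<alpha> m..\<sigma> m}"
      using y m(3) \<sigma>_ge[of m] gap
      by (intro Henstock_Kurzweil_Integration.has_integral_combine[of "\<alpha> m" m "\<sigma> m"]) (auto simp: fundamental_def)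
    have 2: "((\<lambda>v. a v * y (\<beta> v)) has_integral 1 - y (\<sigma> m)) {\<alpha> m..\<sigma> m}"
      using y m(3) \<sigma>_ge[of m] by (auto simp: fundamental_def)
    have "A m * (\<sigma> m - m) = y m - y (\<sigma> m)"
      using has_integral_unique[OF 1 2] by simp
    moreover have "\<bar>fundamental_solution T A \<alpha> m (\<alpha> m)\<bar> \<le> M" using M \<alpha>m m by blast
    then have "\<bar>y m\<bar> \<le> M" using fundamental_solution_value[OF \<alpha>m m(4) y m(1,3)] by simp
    moreover have \<sigma>m: "\<alpha> m \<le> \<sigma> m" using m(3) \<sigma>_ge[of m] by simp
    then have "\<bar>fundamental_solution T A \<alpha> (\<sigma> m) (\<alpha> m)\<bar> \<le> M" using M \<alpha>m m(4) \<sigma>_in[of m] by blast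
    then have "\<bar>y (\<sigma> m)\<bar> \<le> M" using fundamental_solution_value[OF \<alpha>m m(4) y \<sigma>_in \<sigma>m] by simp
    ultimately show ?thesis by linarith
  qed
  \<comment> \<open>If \<open>\<alpha> m < t0\<close>, no fundamental solution starts at
    \<open>\<alpha> m\<close>. Such \<open>m\<close> are bounded by \<open>B\<close>, so local
    boundedness of \<open>A\<close> takes over.\<close>
  have early: "A m * (\<sigma> m - m) \<le> L * (\<sigma> B - t0)" if m: "m \<in> T" "t0 \<le> m" "\<alpha> m < t0" for m
  proof -
    have "m \<le> B" using B(2)[of m] m by force
    then show ?thesis
      using L[OF m(1,2)] \<sigma>_mono[of m B] \<sigma>_ge[of m] m(2) L0 by (intro mult_mono) auto
  qed
  show ?thesis
  proof (intro exI[of _ "max 0 (max (2 * M) (L * (\<sigma> B - t0)))"] conjI ballI impI)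
    show "A m * (\<sigma> m - m) \<le> max 0 (max (2 * M) (L * (\<sigma> B - t0)))"
      if "m \<in> T" "t0 \<le> m" "\<alpha> m \<le> m" for m
      using late[of m] early[of m] that by (cases "t0 \<le> \<alpha> m") (auto simp: le_max_iff_disj)
  qed simp
qed

text \<open>Cutting the solution off before \<open>s\<close> gives \<open>z\<close>, and the lost
  history reappears as the forcing \<open>f\<close>, equal to
  \<open>- a v * \<phi> (\<beta> v)\<close> where \<open>\<beta> v < s\<close> and 0 elsewhere on
  \<open>{s..t}\<close>. Then \<open>variation_of_constants_bound\<close> and
  \<open>history_integral_bound\<close> combine.\<close>

lemma solution_bound:
  assumes M: "\<forall>t\<in>T. \<forall>s\<in>T. t0 \<le> s \<and> s \<le> t \<longrightarrow> \<bar>fundamental_solution T A \<alpha> t s\<bar> \<le> M"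
    and s: "s \<in> T" "t0 \<le> s" and sol: "solution T A \<alpha> s x0 \<phi> x" and t: "t \<in> T" "s \<le> t"
    and \<phi>: "\<And>\<eta>. \<eta> \<in> T \<inter> {alpha_star T \<alpha> s..<s} \<Longrightarrow> \<bar>\<phi> \<eta>\<bar> \<le> P" and "P \<ge> 0"
    and K: "delta_integral (T \<inter> {t0..}) A s (alpha_inv T t0 \<alpha> s) \<le> K"
    and C: "0 \<le> C" "\<And>m. m \<in> T \<Longrightarrow> t0 \<le> m \<Longrightarrow> \<alpha> m \<le> m \<Longrightarrow> A m * (\<sigma> m - m) \<le> C"
  shows "\<bar>x t\<bar> \<le> M * (\<bar>x0\<bar> + P * (K + C))"
proof -
  have "\<forall>\<sigma>. \<exists>y. t0 \<le> \<sigma> \<longrightarrow> fundamental \<sigma> y" using fundamental_exists by metis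
  then obtain Y where Y: "\<And>\<sigma>. t0 \<le> \<sigma> \<Longrightarrow> fundamental \<sigma> (Y \<sigma>)" by metis
  have "\<forall>b. \<exists>L. L-lipschitz_on (T \<inter> {s..b}) x" using sol by (simp add: solution_def)
  then obtain L where L: "L-lipschitz_on (T \<inter> {s..t}) x" by blast
  \<comment> \<open>Freezing the value after \<open>t\<close> gives a function continuous on the
    whole half-line from a Lipschitz bound that holds only up to \<open>t\<close>.\<close>
  define z where "z u = (if u < s then 0 else extension x (min u t))" for u
  have z0: "z u = 0" if "u < s" for u using that by (simp add: z_def)
  have zx: "z u = x u" if "u \<in> T \<inter> {s..t}" for u
    using that s by (simp add: z_def extension_id)
  have "continuous_on {s..t} (extension x)"
    by (rule lipschitz_on_continuous_on[OF extension_lipschitz[OF L s(1) t(1) s(2)]])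
  then have "continuous_on {s..} (\<lambda>u. extension x (min u t))"
    by (rule continuous_on_compose2) (use t in \<open>auto intro!: continuous_intros\<close>)
  then have z_cont: "continuous_on {s..} z"
    by (rule continuous_on_eq) (auto simp: z_def)
  define f where "f v = a v * z (\<beta> v) - a v * x (\<beta> v)" for v
  have x_int: "((\<lambda>v. a v * x (\<beta> v)) has_integral x0 - x u) {s..u}" if "u \<in> T" "s \<le> u" for u
    by (rule solution_imp_integral[OF s sol that])
  have f_int: "f integrable_on {s..t}"
    unfolding f_def using delayed_product_integrable[OF s(2) z0 z_cont] x_int[OF t]
    by (intro Henstock_Kurzweil_Integration.integrable_diff) auto
  have f_le: "\<bar>f v\<bar> \<le> P * (if \<beta> v < s then a v else 0)" if v: "v \<in> {s..t}" for v
  proof (cases "\<beta> v < s")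
    case True
    have h: "\<beta> v \<in> T \<inter> {alpha_star T \<alpha> s..<s}" using \<beta>_history(1)[OF s _ True] v by simp
    then have "x (\<beta> v) = \<phi> (\<beta> v)" using sol by (simp add: solution_def)
    then have "\<bar>f v\<bar> = a v * \<bar>\<phi> (\<beta> v)\<bar>" using z0[OF True] a_nonneg[of v] by (simp add: f_def abs_mult)
    also have "\<dots> \<le> a v * P" using \<phi>[OF h] a_nonneg by (rule mult_left_mono)
    finally show ?thesis using True by (simp add: mult.commute)
  next
    case False
    then have "\<beta> v \<in> T \<inter> {s..t}" using \<beta>_in \<beta>_le[of v] v s by auto
    then show ?thesis using False by (simp add: f_def zx)
  qed
  obtain La where La: "\<And>v. v \<in> {t0..t} \<Longrightarrow> \<bar>a v\<bar> \<le> La" using a_locally_bounded by metis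
  have f_bd: "\<bar>f v\<bar> \<le> P * La" if "v \<in> {s..t}" for v
  proof -
    have "(if \<beta> v < s then a v else 0) \<le> La" using La[of v] that s by auto
    then show ?thesis using f_le[OF that] mult_left_mono[OF _ \<open>P \<ge> 0\<close>] order_trans by blast
  qed
  have "f absolutely_integrable_on {s..t}"
    using f_int f_bd by (intro absolutely_integrable_integrable_bound[of _ f "\<lambda>_. P * La"] integrable_const_ivl) auto
  then have f_abs: "(\<lambda>v. \<bar>f v\<bar>) integrable_on {s..t}" by (simp add: absolutely_integrable_on_def)
  have "\<bar>z t\<bar> \<le> M * (\<bar>x0\<bar> + integral {s..t} (\<lambda>v. \<bar>f v\<bar>))"
  proof (rule variation_of_constants_bound[OF T_closed s(1) t(1) s(2) t(2)])
    show "fundamental \<tau> (Y \<tau>)" if "\<tau> \<in> T \<inter> {s..t}" for \<tau> using that s by (intro Y) auto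
    show "\<bar>Y \<tau> t\<bar> \<le> M" if "\<tau> \<in> T \<inter> {s..t}" for \<tau>
    proof -
      have \<tau>: "\<tau> \<in> T" "t0 \<le> \<tau>" "\<tau> \<le> t" using that s by auto
      then have "\<bar>fundamental_solution T A \<alpha> t \<tau>\<bar> \<le> M" using M t(1) by blast
      then show ?thesis using fundamental_solution_value[OF \<tau>(1,2) Y[OF \<tau>(2)] t(1) \<tau>(3)] by simp
    qed
    show "\<beta> v \<in> T" for v by (rule \<beta>_in)
    show "f integrable_on {s..t}" by (rule f_int)
    show "\<bar>f v\<bar> \<le> P * La" if "v \<in> {s..t}" for v by (rule f_bd[OF that])
    show "z u = 0" if "u < s" for u by (rule z0[OF that])
    show "\<bar>z u\<bar> \<le> \<bar>x s\<bar> + L * (t - s)" if "u \<in> T \<inter> {s..t}" for u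
      using lipschitz_on_bounded[OF L s(1) that] zx[OF that] by simp
    show "((\<lambda>v. a v * z (\<beta> v) - f v) has_integral x0 - z u) {s..u}" if "u \<in> T \<inter> {s..t}" for u
      using x_int[of u] zx[OF that] that by (simp add: f_def)
  qed
  moreover have "integral {s..t} (\<lambda>v. \<bar>f v\<bar>) \<le> P * (K + C)"
  proof (rule history_integral_bound[OF s \<open>P \<ge> 0\<close> f_abs f_le K C(1)])
    note m = alpha_inv[OF s]
    assume "\<alpha> (alpha_inv T t0 \<alpha> s) < s"
    then show "A (alpha_inv T t0 \<alpha> s) * (\<sigma> (alpha_inv T t0 \<alpha> s) - alpha_inv T t0 \<alpha> s) \<le> C"
      using m(1,2) s by (intro C(2)) auto
  qed
  moreover have "M \<ge> 0" using M s t by force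
  ultimately have "\<bar>z t\<bar> \<le> M * (\<bar>x0\<bar> + P * (K + C))"
    by (meson add_left_mono mult_left_mono order_trans)
  then show ?thesis using zx[of t] t by simp
qed

lemma bounded_imp_uniformly_stable:
  assumes M: "M > 0" "\<forall>t\<in>T. \<forall>s\<in>T. t0 \<le> s \<and> s \<le> t \<longrightarrow> \<bar>fundamental_solution T A \<alpha> t s\<bar> \<le> M"
    and bdd: "bdd_above ((\<lambda>s. delta_integral (T \<inter> {t0..}) A s (alpha_inv T t0 \<alpha> s)) ` (T \<inter> {t0..}))"
  shows "uniformly_stable T t0 A \<alpha>"
  unfolding uniformly_stable_def
proof (intro allI impI)
  fix \<epsilon> :: real assume "\<epsilon> > 0"
  obtain K where K: "\<And>s. s \<in> T \<inter> {t0..} \<Longrightarrow> delta_integral (T \<inter> {t0..}) A s (alpha_inv T t0 \<alpha> s) \<le> K"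
    using bdd by (auto simp: bdd_above_def)
  obtain C where C: "0 \<le> C" "\<And>m. m \<in> T \<Longrightarrow> t0 \<le> m \<Longrightarrow> \<alpha> m \<le> m \<Longrightarrow> A m * (\<sigma> m - m) \<le> C"
    using delayed_gap_bound[OF M(2)] by blast
  \<comment> \<open>With data below \<delta> the solution is at most
    \<open>M * D * \<delta> = \<epsilon> / 2\<close>: the 1 in \<open>D\<close> accounts for
    \<open>x0\<close>, the rest for the history. The factor 2 in \<delta> makes the final inequality
    strict, and \<open>max\<close> allows for a negative \<open>K\<close>.\<close>
  define D where "D = 1 + max K 0 + C"
  have D: "D > 0" using C by (simp add: D_def add_pos_nonneg)
  define \<delta> where "\<delta> = \<epsilon> / (2 * M * D)"
  have \<delta>: "\<delta> > 0" using D M \<open>\<epsilon> > 0\<close> by (simp add: \<delta>_def)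
  show "\<exists>\<delta>>0. \<forall>s\<in>T \<inter> {t0..}. \<forall>x0 \<phi> x. solution T A \<alpha> s x0 \<phi> x \<longrightarrow>
      ennreal \<bar>x0\<bar> + (SUP \<eta>\<in>T \<inter> {alpha_star T \<alpha> s..<s}. ennreal \<bar>\<phi> \<eta>\<bar>) < ennreal \<delta> \<longrightarrow>
      (\<forall>t\<in>T \<inter> {s..}. \<bar>x t\<bar> < \<epsilon>)"
  proof (intro exI[of _ \<delta>] conjI \<delta> ballI allI impI)
    fix s x0 \<phi> x t
    assume s: "s \<in> T \<inter> {t0..}" and sol: "solution T A \<alpha> s x0 \<phi> x" and t: "t \<in> T \<inter> {s..}"
      and small: "ennreal \<bar>x0\<bar> + (SUP \<eta>\<in>T \<inter> {alpha_star T \<alpha> s..<s}. ennreal \<bar>\<phi> \<eta>\<bar>) < ennreal \<delta>"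
    have "ennreal \<bar>x0\<bar> < ennreal \<delta>"
      using small by (rule le_less_trans[rotated]) simp
    then have x0: "\<bar>x0\<bar> \<le> \<delta>" by (simp add: ennreal_less_iff)
    have \<phi>: "\<bar>\<phi> \<eta>\<bar> \<le> \<delta>" if "\<eta> \<in> T \<inter> {alpha_star T \<alpha> s..<s}" for \<eta>
    proof -
      have "ennreal \<bar>\<phi> \<eta>\<bar> \<le> (SUP \<eta>\<in>T \<inter> {alpha_star T \<alpha> s..<s}. ennreal \<bar>\<phi> \<eta>\<bar>)"
        by (rule SUP_upper[OF that])
      also have "\<dots> \<le> ennreal \<bar>x0\<bar> + (SUP \<eta>\<in>T \<inter> {alpha_star T \<alpha> s..<s}. ennreal \<bar>\<phi> \<eta>\<bar>)" by simp
      finally have "ennreal \<bar>\<phi> \<eta>\<bar> < ennreal \<delta>" using small by (rule le_less_trans)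
      then show ?thesis by (simp add: ennreal_less_iff)
    qed
    have "\<bar>x t\<bar> \<le> M * (\<bar>x0\<bar> + \<delta> * (max K 0 + C))"
      using s t \<phi> \<delta> C K[OF s]
      by (intro solution_bound[OF M(2) _ _ sol]) (auto simp: le_max_iff_disj)
    also have "\<dots> \<le> M * (\<delta> + \<delta> * (max K 0 + C))"
      using x0 M by (intro mult_left_mono add_right_mono) auto
    also have "\<dots> = M * D * \<delta>" by (simp add: D_def algebra_simps)
    also have "\<dots> = \<epsilon> / 2" using M D by (simp add: \<delta>_def)
    finally show "\<bar>x t\<bar> < \<epsilon>" using \<open>\<epsilon> > 0\<close> by simp
  qed
qed

text \<open>Stability is needed for the single tolerance 1: the fundamental solution scaled by
  \<open>\<delta> / 2\<close> has data of size \<open>\<delta> / 2\<close>, stays below 1, and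
  scaling back gives \<open>2 / \<delta>\<close>.\<close>

lemma uniformly_stable_imp_bounded:
  assumes "uniformly_stable T t0 A \<alpha>"
  shows "\<exists>M>0. \<forall>t\<in>T. \<forall>s\<in>T. t0 \<le> s \<and> s \<le> t \<longrightarrow> \<bar>fundamental_solution T A \<alpha> t s\<bar> \<le> M"
proof -
  obtain \<delta> where \<delta>: "\<delta> > 0" and stable: "\<And>s x0 \<phi> x t. s \<in> T \<inter> {t0..} \<Longrightarrow> solution T A \<alpha> s x0 \<phi> x \<Longrightarrow>
      ennreal \<bar>x0\<bar> + (SUP \<eta>\<in>T \<inter> {alpha_star T \<alpha> s..<s}. ennreal \<bar>\<phi> \<eta>\<bar>) < ennreal \<delta> \<Longrightarrow>
      t \<in> T \<inter> {s..} \<Longrightarrow> \<bar>x t\<bar> < 1"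
    using assms unfolding uniformly_stable_def by (meson zero_less_one)
  show ?thesis
  proof (intro exI[of _ "2 / \<delta>"] conjI ballI impI)
    fix t s assume "t \<in> T" "s \<in> T" "t0 \<le> s \<and> s \<le> t"
    then have s: "s \<in> T" "t0 \<le> s" and t: "t \<in> T" "s \<le> t" by auto
    obtain y where y: "fundamental s y" using fundamental_exists[OF s(2)] by blast
    define x where "x = restrict y (T \<inter> {alpha_star T \<alpha> s..})"
    have X: "fundamental_solution T A \<alpha> t s = x t"
      unfolding x_def by (rule fun_cong[OF fundamental_solution_eq[OF s y]])
    have sol: "solution T A \<alpha> s (\<delta> / 2 * 1) (\<lambda>t. \<delta> / 2 * 0) (\<lambda>t. \<delta> / 2 * x t)"
      unfolding x_def by (intro solution_cmult fundamental_imp_solution s y)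
    have "(SUP \<eta>\<in>T \<inter> {alpha_star T \<alpha> s..<s}. ennreal \<bar>\<delta> / 2 * 0\<bar>) = 0"
      by (cases "T \<inter> {alpha_star T \<alpha> s..<s} = {}") (simp_all add: bot_ennreal)
    then have "\<bar>\<delta> / 2 * x t\<bar> < 1"
      using stable[OF _ sol] s t \<delta> by (auto simp: ennreal_less_iff)
    then show "\<bar>fundamental_solution T A \<alpha> t s\<bar> \<le> 2 / \<delta>"
      using \<delta> by (simp add: X abs_mult field_simps)
  qed (use \<delta> in auto)
qed

end

theorem theorem2p3:
  fixes T :: "real set" and t0 :: real and A \<alpha> :: "real \<Rightarrow> real"
  assumes "time_scale T"
    and "\<not> bdd_above T"
    and "t0 \<in> T"
    and "rd_continuous_on (T \<inter> {t0..}) A"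
    and "\<forall>t\<in>T \<inter> {t0..}. 0 \<le> A t"
    and "rd_continuous_on (T \<inter> {t0..}) \<alpha>"
    and "\<forall>t\<in>T \<inter> {t0..}. \<alpha> t \<in> T"
    and "filterlim \<alpha> at_top (inf at_top (principal (T \<inter> {t0..})))"
    and delay: "(\<forall>t\<in>T \<inter> {t0..}. \<alpha> t \<le> t) \<or> (\<forall>t\<in>T \<inter> {t0..}. \<alpha> (fwd_jump T t) \<le> t)"
    and not_advanced: "\<forall>t\<in>T \<inter> {t0..}. \<alpha> t \<le> fwd_jump T t"
    and "bdd_above ((\<lambda>s. delta_integral (T \<inter> {t0..}) A s (alpha_inv T t0 \<alpha> s)) ` (T \<inter> {t0..}))"
  shows "uniformly_stable T t0 A \<alpha> \<longleftrightarrow>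
    (\<exists>M0>0. \<forall>t\<in>T. \<forall>s\<in>T. t0 \<le> s \<and> s \<le> t \<longrightarrow> \<bar>fundamental_solution T A \<alpha> t s\<bar> \<le> M0)"
proof -
  interpret delay_dynamic_equation T t0 A \<alpha>
    using assms by unfold_locales (auto simp: time_scale_def)
  show ?thesis
    using uniformly_stable_imp_bounded bounded_imp_uniformly_stable[OF _ _ assms(11)] by blast
qed

end
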